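(* Let $n \in \mathbb{N}$, let $(a,b) \subseteq \mathbb{R}$ be an open interval, and let $p_0, \dots, p_n$ be (Lebesgue) measurable, a.e. real-valued functions on $(a,b)$ with $1/p_0, p_1, \dots, p_n \in L^1_{loc}((a,b))$. Let $\tau_{2n}$ be the associated $2n$-th order symmetric differential expression $$\tau_{2n}u = u^{[2n]} = \sum_{k=0}^n (-1)^{n-k}\big(p_k u^{(n-k)}\big)^{(n-k)},$$ understood via quasi-derivatives, and let $T_{2n,min}$ be the minimal operator in $L^2((a,b))$ generated by $\tau_{2n}$. Suppose that $\tau_{2n}$ is in the limit circle case at $a$ and $b$, that is, for some (and hence for all) $z \in \mathbb{C}$, the equation $\tau_{2n}y = zy$ has $2n$ linearly independent solutions $y_j$ satisfying $y_j \in L^2((a,b))$, $1 \leq j \leq 2n$. Then $T_{2n,min}$ has deficiency indices $(2n,2n)$, and $(T_{2n,min})^m$ has deficiency indices $(2mn,2mn)$ for every $m \in \mathbb{N}$.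
   Context: The quasi-derivatives are $u^{[0]} = u$, $u^{[k]} = u^{(k)}$ for $1 \leq k \leq n-1$, $u^{[n]} = p_0 u^{(n)}$, and $u^{[n+k]} = p_k u^{[n-k]} - \big(u^{[n+k-1]}\big)'$ for $1 \leq k \leq n$. The maximal operator in $L^2((a,b))$ acts as $f \mapsto \tau_{2n}f$ on all $f \in L^2((a,b))$ with $f^{[k]} \in AC_{loc}((a,b))$, $0 \leq k \leq 2n-1$, and $\tau_{2n}f \in L^2((a,b))$; the minimal operator $T_{2n,min}$ is the closure of the restriction of the maximal operator to those elements of its domain that have compact support in $(a,b)$ (it is closed, densely defined, and symmetric, and its adjoint is the maximal operator). For a densely defined closed symmetric operator $S$ in a Hilbert space, its deficiency indices are $(n_+(S),n_-(S))$ with $n_{\pm}(S) = \dim(\ker(S^* \mp iI))$. Powers $S^m$ are defined on their natural domains, $\operatorname{dom}(S^{m}) = \{f \in \operatorname{dom}(S^{m-1}) \mid S^{m-1}f \in \operatorname{dom}(S)\}$. *)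

theory Defs
  imports "HOL-Analysis.Analysis" "HOL-Library.Extended_Nat"
begin

section \<open>Complex inner product spaces\<close>

text \<open>The inner product is linear in the second argument. Topology and norm are those of the
  underlying real inner product space.\<close>

class complex_inner = real_inner +
  fixes scaleC :: "complex \<Rightarrow> 'a \<Rightarrow> 'a"  (infixr "*C" 75)
    and cinner :: "'a \<Rightarrow> 'a \<Rightarrow> complex"
  assumes scaleC_add_right: "c *C (x + y) = c *C x + c *C y"
    and scaleC_add_left: "(c + d) *C x = c *C x + d *C x"
    and scaleC_scaleC: "c *C d *C x = (c * d) *C x"
    and scaleC_one: "1 *C x = x"
    and scaleR_scaleC: "r *\<^sub>R x = complex_of_real r *C x"
    and cinner_commute: "cinner x y = cnj (cinner y x)"
    and cinner_add_right: "cinner x (y + z) = cinner x y + cinner x z"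
    and cinner_scaleC_right: "cinner x (c *C y) = c * cinner x y"
    and inner_eq_Re_cinner: "inner x y = Re (cinner x y)"

global_interpretation complex_vector: vector_space "scaleC :: complex \<Rightarrow> 'a \<Rightarrow> 'a::complex_inner"
  defines cspan = complex_vector.span
    and csubspace = complex_vector.subspace
    and cdim = complex_vector.dim
  by unfold_locales (simp_all add: scaleC_add_right scaleC_add_left scaleC_scaleC scaleC_one)

definition ecdim :: "'a::complex_inner set \<Rightarrow> enat" where
  "ecdim V = (if \<exists>B. finite B \<and> V \<subseteq> cspan B then enat (cdim V) else \<infinity>)"

section \<open>Operators in a Hilbert space\<close>

text \<open>The Hilbert space is a closed complex subspace \<open>H\<close> of the ambient type, and an operator in
  \<open>H\<close> is represented by its graph, so that the domain is the relational \<open>Domain\<close>, and the power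
  \<open>S ^^ m\<close> of relations (for \<open>m \<ge> 1\<close>) is the power of the operator on its natural domain.\<close>

definition linear_operator :: "'a::complex_inner set \<Rightarrow> ('a \<times> 'a) set \<Rightarrow> bool" where
  "linear_operator H S \<longleftrightarrow> S \<subseteq> H \<times> H \<and> single_valued S \<and> (0, 0) \<in> S \<and>
     (\<forall>(f, f')\<in>S. \<forall>(g, g')\<in>S. \<forall>c. (f + c *C g, f' + c *C g') \<in> S)"

definition symmetric_operator :: "'a::complex_inner set \<Rightarrow> ('a \<times> 'a) set \<Rightarrow> bool" where
  "symmetric_operator H S \<longleftrightarrow> linear_operator H S \<and>
     (\<forall>(f, f')\<in>S. \<forall>(g, g')\<in>S. cinner f' g = cinner f g')"

definition closed_symmetric_operator :: "'a::complex_inner set \<Rightarrow> ('a \<times> 'a) set \<Rightarrow> bool" where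
  "closed_symmetric_operator H S \<longleftrightarrow>
     symmetric_operator H S \<and> closed S \<and> H \<subseteq> closure (Domain S)"

definition adjoint_operator :: "'a::complex_inner set \<Rightarrow> ('a \<times> 'a) set \<Rightarrow> ('a \<times> 'a) set" where
  "adjoint_operator H S =
     {(g, h) \<in> H \<times> H. \<forall>(f, f')\<in>S. cinner g f' = cinner h f}"

definition eigenspace :: "('a::complex_inner \<times> 'a) set \<Rightarrow> complex \<Rightarrow> 'a set" where
  "eigenspace S z = {f. (f, z *C f) \<in> S}"

definition deficiency_indices :: "'a::complex_inner set \<Rightarrow> ('a \<times> 'a) set \<Rightarrow> enat \<times> enat" where
  "deficiency_indices H S =
     (ecdim (eigenspace (adjoint_operator H S) \<i>),
      ecdim (eigenspace (adjoint_operator H S) (- \<i>)))"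

text \<open>Deficiency indices are a notion for densely defined closed symmetric operators only.\<close>

definition has_deficiency_indices ::
    "'a::complex_inner set \<Rightarrow> ('a \<times> 'a) set \<Rightarrow> enat \<times> enat \<Rightarrow> bool" where
  "has_deficiency_indices H S d \<longleftrightarrow>
     closed_symmetric_operator H S \<and> deficiency_indices H S = d"

section \<open>The space of square integrable functions\<close>

lemma borel_measurable_cnj_comp [measurable (raw)]:
  "f \<in> borel_measurable M \<Longrightarrow> (\<lambda>x. cnj (f x)) \<in> borel_measurable M"
  by (rule borel_measurable_continuous_on[where f = cnj]) (auto intro: continuous_intros)

definition sq_integrable :: "'a measure \<Rightarrow> ('a \<Rightarrow> complex) \<Rightarrow> bool" where
  "sq_integrable M f \<longleftrightarrow> f \<in> borel_measurable M \<and> integrable M (\<lambda>x. (cmod (f x))\<^sup>2)"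

lemma sq_integrable_add:
  assumes "sq_integrable M f" "sq_integrable M g"
  shows "sq_integrable M (\<lambda>x. f x + g x)"
proof -
  have le: "(cmod (f x + g x))\<^sup>2 \<le> 2 * (cmod (f x))\<^sup>2 + 2 * (cmod (g x))\<^sup>2" for x
  proof -
    have "(cmod (f x + g x))\<^sup>2 \<le> (cmod (f x) + cmod (g x))\<^sup>2"
      by (simp add: norm_triangle_ineq power_mono)
    also have "\<dots> \<le> 2 * (cmod (f x))\<^sup>2 + 2 * (cmod (g x))\<^sup>2"
      using sum_squares_bound[of "cmod (f x)" "cmod (g x)"] by (simp add: power2_sum)
    finally show ?thesis .
  qed
  have "integrable M (\<lambda>x. (cmod (f x + g x))\<^sup>2)"
    by (rule Bochner_Integration.integrable_bound
        [where f = "\<lambda>x. 2 * (cmod (f x))\<^sup>2 + 2 * (cmod (g x))\<^sup>2"])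
      (use assms le in \<open>auto simp: sq_integrable_def\<close>)
  then show ?thesis using assms by (auto simp: sq_integrable_def)
qed

lemma sq_integrable_scale:
  "sq_integrable M f \<Longrightarrow> sq_integrable M (\<lambda>x. c * f x)"
  by (auto simp: sq_integrable_def norm_mult power_mult_distrib)

lemma sq_integrable_mult:
  assumes "sq_integrable M f" "sq_integrable M g"
  shows "integrable M (\<lambda>x. cnj (f x) * g x)"
proof (rule Bochner_Integration.integrable_bound[where f = "\<lambda>x. (cmod (f x))\<^sup>2 + (cmod (g x))\<^sup>2"])
  have "cmod (f x) * cmod (g x) \<le> (cmod (f x))\<^sup>2 + (cmod (g x))\<^sup>2" for x
    using sum_squares_bound[of "cmod (f x)" "cmod (g x)"]
      mult_nonneg_nonneg[of "cmod (f x)" "cmod (g x)", OF norm_ge_zero norm_ge_zero] by linarith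
  then show "AE x in M. norm (cnj (f x) * g x) \<le> norm ((cmod (f x))\<^sup>2 + (cmod (g x))\<^sup>2)"
    by (simp add: norm_mult)
qed (use assms in \<open>auto simp: sq_integrable_def\<close>)

definition L2_rel :: "(real \<Rightarrow> complex) \<Rightarrow> (real \<Rightarrow> complex) \<Rightarrow> bool" where
  "L2_rel f g \<longleftrightarrow> sq_integrable lebesgue f \<and> sq_integrable lebesgue g \<and>
     (AE x in lebesgue. f x = g x)"

lemma part_equivp_L2_rel: "part_equivp L2_rel"
proof (rule part_equivpI)
  show "\<exists>f. L2_rel f f"
    by (rule exI[of _ "\<lambda>_. 0"]) (simp add: L2_rel_def sq_integrable_def)
  show "symp L2_rel"
    by (auto simp: symp_def L2_rel_def eq_commute)
  show "transp L2_rel"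
    by (auto simp: transp_def L2_rel_def)
qed

quotient_type L2 = "real \<Rightarrow> complex" / partial: L2_rel
  by (rule part_equivp_L2_rel)

instantiation L2 :: complex_inner
begin

lift_definition zero_L2 :: L2 is "\<lambda>_. 0"
  by (simp add: L2_rel_def sq_integrable_def)

lift_definition plus_L2 :: "L2 \<Rightarrow> L2 \<Rightarrow> L2" is "\<lambda>f g x. f x + g x"
  by (auto simp: L2_rel_def sq_integrable_add)

lift_definition uminus_L2 :: "L2 \<Rightarrow> L2" is "\<lambda>f x. - f x"
  by (auto simp: L2_rel_def sq_integrable_def)

lift_definition scaleC_L2 :: "complex \<Rightarrow> L2 \<Rightarrow> L2" is "\<lambda>c f x. c * f x"
  by (auto simp: L2_rel_def sq_integrable_scale)

lift_definition cinner_L2 :: "L2 \<Rightarrow> L2 \<Rightarrow> complex" is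
  "\<lambda>f g. LINT x|lebesgue. cnj (f x) * g x"
  by (rule integral_cong_AE) (auto simp: L2_rel_def sq_integrable_def)

definition minus_L2 :: "L2 \<Rightarrow> L2 \<Rightarrow> L2" where "minus_L2 f g = f + (- g)"
definition scaleR_L2 :: "real \<Rightarrow> L2 \<Rightarrow> L2" where "scaleR_L2 r f = complex_of_real r *C f"
definition inner_L2 :: "L2 \<Rightarrow> L2 \<Rightarrow> real" where "inner_L2 f g = Re (cinner f g)"
definition norm_L2 :: "L2 \<Rightarrow> real" where "norm_L2 f = sqrt (inner f f)"
definition sgn_L2 :: "L2 \<Rightarrow> L2" where "sgn_L2 f = inverse (norm f) *\<^sub>R f"
definition dist_L2 :: "L2 \<Rightarrow> L2 \<Rightarrow> real" where "dist_L2 f g = norm (f - g)"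
definition uniformity_L2 :: "(L2 \<times> L2) filter" where
  "uniformity_L2 = (INF e\<in>{0<..}. principal {(f, g). dist f g < e})"
definition open_L2 :: "L2 set \<Rightarrow> bool" where
  "open_L2 U \<longleftrightarrow> (\<forall>x\<in>U. eventually (\<lambda>(x', y). x' = x \<longrightarrow> y \<in> U) uniformity)"

instance
proof
  fix f g h :: L2 and c d :: complex and r s :: real
  show "f + g + h = f + (g + h)"
    by transfer (auto simp: L2_rel_def sq_integrable_add add.assoc)
  show comm: "f + g = g + f"
    by transfer (auto simp: L2_rel_def sq_integrable_add add.commute)
  show "0 + f = f"
    by transfer (auto simp: L2_rel_def)
  show "- f + f = 0"
    by transfer (auto simp: L2_rel_def sq_integrable_def)
  show "f - g = f + - g"
    by (rule minus_L2_def)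
  show C1: "c *C (f + g) = c *C f + c *C g" for c f and g :: L2
    by transfer (auto simp: L2_rel_def sq_integrable_add sq_integrable_scale distrib_left)
  show C2: "(c + d) *C f = c *C f + d *C f" for c d and f :: L2
    by transfer (auto simp: L2_rel_def sq_integrable_add sq_integrable_scale distrib_right)
  show C3: "c *C d *C f = (c * d) *C f" for c d and f :: L2
    by transfer (auto simp: L2_rel_def sq_integrable_scale mult.assoc)
  show C4: "1 *C f = f"
    by transfer (auto simp: L2_rel_def)
  show sR: "r *\<^sub>R f = complex_of_real r *C f"
    by (rule scaleR_L2_def)
  show "r *\<^sub>R (f + g) = r *\<^sub>R f + r *\<^sub>R g" "(r + s) *\<^sub>R f = r *\<^sub>R f + s *\<^sub>R f"
    "r *\<^sub>R s *\<^sub>R f = (r * s) *\<^sub>R f" "1 *\<^sub>R f = f"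
    by (simp_all add: scaleR_L2_def C1 C2 C3 C4)
  show "sgn f = inverse (norm f) *\<^sub>R f"
    by (rule sgn_L2_def)
  show "dist f g = norm (f - g)"
    by (rule dist_L2_def)
  show "uniformity = (INF e\<in>{0<..}. principal {(f::L2, g). dist f g < e})"
    by (rule uniformity_L2_def)
  show "open U \<longleftrightarrow> (\<forall>x\<in>U. eventually (\<lambda>(x', y). x' = x \<longrightarrow> y \<in> U) uniformity)" for U :: "L2 set"
    by (rule open_L2_def)
  show ci: "cinner f g = cnj (cinner g f)" for f g :: L2
    by transfer (simp add: mult.commute flip: Bochner_Integration.integral_cnj)
  show ca: "cinner f (g + h) = cinner f g + cinner f h" for f g h :: L2
    by transfer (simp add: L2_rel_def distrib_left sq_integrable_mult)
  show cs: "cinner f (c *C g) = c * cinner f g" for f g :: L2 and c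
    by transfer (simp add: L2_rel_def mult.left_commute)
  show "inner f g = Re (cinner f g)"
    by (rule inner_L2_def)
  show "inner f g = inner g f"
    unfolding inner_L2_def by (subst ci) simp
  have ca': "cinner (f + g) h = cinner f h + cinner g h"
    by (metis ci ca complex_cnj_add)
  show "inner (f + g) h = inner f h + inner g h"
    by (simp add: inner_L2_def ca')
  have "cinner (r *\<^sub>R f) g = r * cinner f g"
    by (subst (1 2) ci) (simp add: sR cs)
  then show "inner (r *\<^sub>R f) g = r * inner f g"
    by (simp add: inner_L2_def)
  have self: "inner f f = Re (LINT x|lebesgue. cnj (rep_L2 f x) * rep_L2 f x)" 
    by (simp add: inner_L2_def cinner_L2_def)
  have rep: "sq_integrable lebesgue (rep_L2 f)"
    using Quotient3_rep_reflp[OF Quotient3_L2, of f] by (simp add: L2_rel_def)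
  have "(LINT x|lebesgue. cnj (rep_L2 f x) * rep_L2 f x)
      = (LINT x|lebesgue. complex_of_real ((cmod (rep_L2 f x))\<^sup>2))"
    by (simp only: complex_norm_square mult.commute)
  then have self': "inner f f = (LINT x|lebesgue. (cmod (rep_L2 f x))\<^sup>2)"
    using self by (simp only: integral_complex_of_real Re_complex_of_real)
  show "0 \<le> inner f f"
    by (simp add: self')
  have "inner f f = 0 \<longleftrightarrow> (AE x in lebesgue. rep_L2 f x = 0)"
    using rep by (simp add: self' sq_integrable_def integral_nonneg_eq_0_iff_AE)
  also have "\<dots> \<longleftrightarrow> L2_rel (rep_L2 f) (\<lambda>_. 0)"
    using rep by (simp add: L2_rel_def sq_integrable_def)
  also have "\<dots> \<longleftrightarrow> f = 0"
    using rep by (metis L2_rel_def Quotient3_L2 Quotient3_abs_rep Quotient3_rel_abs Quotient3_rel_rep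
        Quotient3_rep_abs zero_L2_def zero_L2.rsp)
  finally show "inner f f = 0 \<longleftrightarrow> f = 0" .
  show "norm f = sqrt (inner f f)"
    by (rule norm_L2_def)
qed

end

text \<open>\<open>L\<^sup>2(I)\<close> is identified with the subspace of those elements of \<open>L\<^sup>2(\<real>)\<close> that vanish almost
  everywhere outside \<open>I\<close>; \<open>L2_of I u\<close> is the element given by a function \<open>u\<close> on \<open>I\<close>.\<close>

definition L2_of :: "real set \<Rightarrow> (real \<Rightarrow> complex) \<Rightarrow> L2" where
  "L2_of I u = abs_L2 (\<lambda>x. if x \<in> I then u x else 0)"

definition L2_on :: "real set \<Rightarrow> L2 set" where
  "L2_on I = {L2_of I u | u. sq_integrable (lebesgue_on I) u}"

lemma sq_integrable_extend:
  assumes "I \<in> sets lebesgue"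
  shows "sq_integrable lebesgue (\<lambda>x. if x \<in> I then u x else 0) \<longleftrightarrow> sq_integrable (lebesgue_on I) u"
proof -
  have "(\<lambda>x. (cmod (if x \<in> I then u x else 0))\<^sup>2) = (\<lambda>x. indicator I x *\<^sub>R (cmod (u x))\<^sup>2)"
    by (auto simp: fun_eq_iff)
  then show ?thesis
    using assms
    by (simp add: sq_integrable_def integrable_restrict_space borel_measurable_if)
qed

lemma L2_of_eq_iff:
  assumes "I \<in> sets lebesgue" "sq_integrable (lebesgue_on I) u" "sq_integrable (lebesgue_on I) v"
  shows "L2_of I u = L2_of I v \<longleftrightarrow> (AE x in lebesgue_on I. u x = v x)"
proof -
  have "L2_of I u = L2_of I v \<longleftrightarrow>
      L2_rel (\<lambda>x. if x \<in> I then u x else 0) (\<lambda>x. if x \<in> I then v x else 0)"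
    unfolding L2_of_def
    using assms
    by (subst Quotient3_rel[OF Quotient3_L2, symmetric]) (simp add: L2_rel_def sq_integrable_extend)
  also have "\<dots> \<longleftrightarrow> (AE x in lebesgue. x \<in> I \<longrightarrow> u x = v x)"
    using assms by (auto simp: L2_rel_def sq_integrable_extend intro!: AE_cong)
  also have "\<dots> \<longleftrightarrow> (AE x in lebesgue_on I. u x = v x)"
    using assms by (simp add: AE_restrict_space_iff)
  finally show ?thesis .
qed

lemma cinner_L2_of:
  assumes "I \<in> sets lebesgue" "sq_integrable (lebesgue_on I) u" "sq_integrable (lebesgue_on I) v"
  shows "cinner (L2_of I u) (L2_of I v) = (LINT x|lebesgue_on I. cnj (u x) * v x)"
proof -
  have "cinner (L2_of I u) (L2_of I v) =
      (LINT x|lebesgue. cnj (if x \<in> I then u x else 0) * (if x \<in> I then v x else 0))"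
    unfolding L2_of_def
    by (rule cinner_L2.abs_eq) (use assms in \<open>simp_all add: L2_rel_def sq_integrable_extend\<close>)
  also have "\<dots> = (LINT x|lebesgue. indicator I x *\<^sub>R (cnj (u x) * v x))"
    by (rule Bochner_Integration.integral_cong) auto
  finally show ?thesis
    using assms by (simp add: integral_restrict_space)
qed

section \<open>Local integrability and local absolute continuity\<close>

definition L1_loc :: "real set \<Rightarrow> (real \<Rightarrow> complex) \<Rightarrow> bool" where
  "L1_loc I f \<longleftrightarrow> (\<forall>c d. {c..d} \<subseteq> I \<longrightarrow> f absolutely_integrable_on {c..d})"

definition AC_on :: "real \<Rightarrow> real \<Rightarrow> (real \<Rightarrow> complex) \<Rightarrow> bool" where
  "AC_on c d f \<longleftrightarrow> (\<forall>\<epsilon>>0. \<exists>\<delta>>0. \<forall>D.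
     finite D \<and> (\<forall>(s, t)\<in>D. c \<le> s \<and> s \<le> t \<and> t \<le> d) \<and>
     disjoint_family_on (\<lambda>(s, t). {s<..<t}) D \<and> (\<Sum>(s, t)\<in>D. t - s) < \<delta> \<longrightarrow>
     (\<Sum>(s, t)\<in>D. cmod (f t - f s)) < \<epsilon>)"

definition AC_loc :: "real set \<Rightarrow> (real \<Rightarrow> complex) \<Rightarrow> bool" where
  "AC_loc I f \<longleftrightarrow> (\<forall>c d. {c..d} \<subseteq> I \<longrightarrow> AC_on c d f)"

section \<open>The differential expression and the operators it generates\<close>

text \<open>\<open>quasi_derivatives n p I u q\<close>: on the open interval \<open>I\<close>, the functions \<open>q k\<close> are the
  quasi-derivatives \<open>u\<^sup>[\<^sup>k\<^sup>]\<close> for \<open>0 \<le> k \<le> 2 n\<close>, those with \<open>k < 2 n\<close> being locally absolutely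
  continuous. The quasi-derivatives of positive order are defined only almost everywhere, so \<open>q k\<close>
  (for \<open>k < 2 n\<close>) is the locally absolutely continuous representative. All the derivatives occurring
  here are of locally absolutely continuous functions and therefore exist almost everywhere.\<close>

definition quasi_derivatives ::
    "nat \<Rightarrow> (nat \<Rightarrow> real \<Rightarrow> complex) \<Rightarrow> real set \<Rightarrow> (real \<Rightarrow> complex) \<Rightarrow> (nat \<Rightarrow> real \<Rightarrow> complex) \<Rightarrow> bool"
  where
  "quasi_derivatives n p I u q \<longleftrightarrow>
     (\<forall>k<2 * n. AC_loc I (q k)) \<and>
     (\<forall>x\<in>I. q 0 x = u x) \<and>
     (\<forall>k\<in>{1..<n}. AE x in lebesgue_on I. q k x = vector_derivative (q (k - 1)) (at x)) \<and>
     (AE x in lebesgue_on I. q n x = p 0 x * vector_derivative (q (n - 1)) (at x)) \<and>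
     (\<forall>k\<in>{1..n}. AE x in lebesgue_on I.
        q (n + k) x = p k x * q (n - k) x - vector_derivative (q (n + k - 1)) (at x))"

definition maximal_operator ::
    "nat \<Rightarrow> (nat \<Rightarrow> real \<Rightarrow> complex) \<Rightarrow> real set \<Rightarrow> (L2 \<times> L2) set" where
  "maximal_operator n p I =
     {(L2_of I u, L2_of I (q (2 * n))) | u q. quasi_derivatives n p I u q \<and>
        sq_integrable (lebesgue_on I) u \<and> sq_integrable (lebesgue_on I) (q (2 * n))}"

definition compactly_supported_in :: "real set \<Rightarrow> L2 \<Rightarrow> bool" where
  "compactly_supported_in I f \<longleftrightarrow> (\<exists>u K. sq_integrable (lebesgue_on I) u \<and> f = L2_of I u \<and>
     compact K \<and> K \<subseteq> I \<and> (\<forall>x\<in>I - K. u x = 0))"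

definition minimal_operator ::
    "nat \<Rightarrow> (nat \<Rightarrow> real \<Rightarrow> complex) \<Rightarrow> real set \<Rightarrow> (L2 \<times> L2) set" where
  "minimal_operator n p I =
     closure {(f, g) \<in> maximal_operator n p I. compactly_supported_in I f}"

definition is_solution ::
    "nat \<Rightarrow> (nat \<Rightarrow> real \<Rightarrow> complex) \<Rightarrow> real set \<Rightarrow> complex \<Rightarrow> (real \<Rightarrow> complex) \<Rightarrow> bool" where
  "is_solution n p I z y \<longleftrightarrow> (\<exists>q. quasi_derivatives n p I y q \<and>
     (AE x in lebesgue_on I. q (2 * n) x = z * y x))"

text \<open>The limit circle case at both endpoints of \<open>I\<close>.\<close>

definition limit_circle ::
    "nat \<Rightarrow> (nat \<Rightarrow> real \<Rightarrow> complex) \<Rightarrow> real set \<Rightarrow> bool" where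
  "limit_circle n p I \<longleftrightarrow> (\<exists>z y.
     (\<forall>j\<in>{1..2 * n}. is_solution n p I z (y j) \<and> sq_integrable (lebesgue_on I) (y j)) \<and>
     (\<forall>c. (\<forall>x\<in>I. (\<Sum>j=1..2 * n. c j * y j x) = 0) \<longrightarrow> (\<forall>j\<in>{1..2 * n}. c j = 0)))"

end

theory Submission imports Defs "HOL-Computational_Algebra.Fundamental_Theorem_Algebra" "Jordan_Normal_Form.Determinant"
begin

text \<open>
  The limit circle condition makes the minimal operator \<open>T\<close> so small that at one spectral point \<open>z\<close> everything can be computed.
  The quasi-derivatives of a function satisfy a first-order linear system with locally integrable coefficients. For two
  solutions at the same \<open>z\<close>, the Lagrange bracket is constant, so the inverse of a fundamental matrix is again
  built from the solutions and the constant inverse of their Gram matrix of brackets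
  (\<open>symplectic_completeness\<close>). Variation of parameters therefore uses square-integrable
  functions only: the equation for the maximal operator is solvable at \<open>z\<close> for every right-hand side, with a norm bound, and
  for compactly supported right-hand sides orthogonal to the conjugate solutions the result has compact support
  (\<open>solve_inhomogeneous\<close>). It follows that \<open>T - z\<close> is bounded below and that its range has
  codimension \<open>2 * n\<close>, the orthogonal complement being spanned by the conjugate solutions
  (\<open>minimal_operator_properties\<close>). Since the coefficients are real, the same holds at the conjugate of \<open>z\<close>.

  For a closed symmetric operator the codimension of the range of \<open>T - w\<close> is locally constant wherever \<open>T - w\<close> is bounded
  below, so it is \<open>2 * n\<close> at all non-real \<open>w\<close> (\<open>has_defect_half_plane\<close>). For the powers, factor
  \<open>T^m - w\<close> into \<open>T - z_j\<close> with \<open>z_j\<close> the roots of \<open>z^m = w\<close>, none of which is real. For densely defined closed operators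
  that are bounded below with range of finite codimension, the product is of the same kind and the codimensions add
  (\<open>regular_rel_comp\<close>), which gives \<open>2 * m * n\<close>, because a deficiency space is the orthogonal complement of such a range.

  The analytic foundation is the fundamental theorem of calculus for absolutely continuous functions in the epsilon-delta sense.
  It rests on Lebesgue's differentiation theorem, on the Jordan decomposition, and on the Radon--Nikodym theorem
  for the Stieltjes measures of the monotone parts.
\<close>

section \<open>Lebesgue differentiation on the line\<close>

text \<open>The points at which the difference quotient of the indefinite integral misses \<open>f\<close> by at least \<open>e\<close>
  along arbitrarily short intervals carry one such interval each, inside the gauge of Henstock's lemma.
  Vitali's covering lemma picks disjoint ones whose fivefold enlargements cover all the points, and
  Henstock's lemma bounds their total length.\<close>

lemma lebesgue_differentiation:
  fixes f :: "real \<Rightarrow> 'a::euclidean_space"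
  assumes f: "f integrable_on {a..b}"
  shows "negligible {x\<in>{a..b}. \<not> ((\<lambda>u. integral {a..u} f) has_vector_derivative f x) (at x within {a..b})}"
proof -
  define F where "F = (\<lambda>u. integral {a..u} f)"
  define E where "E = (\<lambda>e. {x\<in>{a..b}. \<forall>d>0. \<exists>y\<in>{a..b}. y \<noteq> x \<and> \<bar>y - x\<bar> < d \<and>
      norm (F y - F x - (y - x) *\<^sub>R f x) \<ge> e * \<bar>y - x\<bar>})"
  have F_diff: "F y - F x = integral {x..y} f" if "a \<le> x" "x \<le> y" "y \<le> b" for x y
  proof -
    have "integral {a..x} f + integral {x..y} f = integral {a..y} f"
      by (rule Henstock_Kurzweil_Integration.integral_combine)
         (use that f in \<open>auto intro: integrable_subinterval_real\<close>)
    then show ?thesis by (simp add: F_def algebra_simps)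
  qed
  have neg: "negligible (E e)" if "e > 0" for e
  proof (rule negligible_outer_le[THEN iffD2], intro allI impI)
    fix \<mu> :: real assume "\<mu> > 0"
    (* The factor 5 of the Vitali covering lemma is built into the bound. *)
    obtain \<gamma> where \<gamma>: "gauge \<gamma>"
      and hen: "\<And>p. \<lbrakk>p tagged_partial_division_of cbox a b; \<gamma> fine p\<rbrakk> \<Longrightarrow>
             sum (\<lambda>(x,k). norm(measure lborel k *\<^sub>R f x - integral k f)) p < e * \<mu> / 5"
      by (rule Henstock_lemma[of f a b "e * \<mu> / 5"]) (use f \<open>e > 0\<close> \<open>\<mu> > 0\<close> in auto)
    have "\<exists>y\<in>{a..b}. y \<noteq> x \<and> \<bar>y - x\<bar> < 1 \<and> closed_segment x y \<subseteq> \<gamma> x \<and>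
        norm (F y - F x - (y - x) *\<^sub>R f x) \<ge> e * \<bar>y - x\<bar>" if "x \<in> E e" for x
    proof -
      have "open (\<gamma> x)" "x \<in> \<gamma> x" using \<gamma> by (auto simp: gauge_def)
      then obtain d where "d > 0" and d: "ball x d \<subseteq> \<gamma> x"
        using open_contains_ball by blast
      from \<open>x \<in> E e\<close> have "\<exists>y\<in>{a..b}. y \<noteq> x \<and> \<bar>y - x\<bar> < min d 1 \<and>
          norm (F y - F x - (y - x) *\<^sub>R f x) \<ge> e * \<bar>y - x\<bar>"
        using \<open>d > 0\<close> unfolding E_def by (simp del: min_less_iff_conj)
      then obtain y where y: "y\<in>{a..b}" "y \<noteq> x" "\<bar>y - x\<bar> < d" "\<bar>y - x\<bar> < 1"
        "norm (F y - F x - (y - x) *\<^sub>R f x) \<ge> e * \<bar>y - x\<bar>" by auto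
      moreover have "closed_segment x y \<subseteq> ball x d"
        by (rule closed_segment_subset) (use y \<open>d > 0\<close> in \<open>auto simp: dist_real_def\<close>)
      ultimately show ?thesis using d by blast
    qed
    then obtain y where y: "\<And>x. x \<in> E e \<Longrightarrow> y x \<in> {a..b} \<and> y x \<noteq> x \<and> \<bar>y x - x\<bar> < 1 \<and>
        closed_segment x (y x) \<subseteq> \<gamma> x \<and> norm (F (y x) - F x - (y x - x) *\<^sub>R f x) \<ge> e * \<bar>y x - x\<bar>"
      by metis
    define m r where "m = (\<lambda>x. (x + y x) / 2)" and "r = (\<lambda>x. \<bar>y x - x\<bar> / 2)"
    have cb: "cball (m x) (r x) = closed_segment x (y x)" for x
      by (auto simp: m_def r_def cball_eq_atLeastAtMost closed_segment_eq_real_ivl field_simps abs_if)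
    have cb2: "closed_segment x (y x) = {min x (y x)..max x (y x)}" for x
      by (auto simp: closed_segment_eq_real_ivl)
    have x_in: "x \<in> cball (m x) (r x)" for x by (simp add: cb)
    obtain C where C: "countable C" "C \<subseteq> E e"
      and dis: "pairwise (\<lambda>i j. disjnt (cball (m i) (r i)) (cball (m j) (r j))) C"
      and cov: "E e \<subseteq> (\<Union>i\<in>C. cball (m i) (5 * r i))"
    proof (rule Vitali_covering_lemma_cballs[of "E e" m r "E e" 1])
      show "E e \<subseteq> (\<Union>i\<in>E e. cball (m i) (r i))" using x_in by blast
      show "0 < r i \<and> r i \<le> 1" if "i \<in> E e" for i using y[OF that] by (auto simp: r_def)
    qed auto
    have fin: "(\<Sum>i\<in>C'. 2 * r i) \<le> \<mu> / 5" if C': "C' \<subseteq> C" "finite C'" for C'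
    proof -
      let ?g = "\<lambda>x. (x, cball (m x) (r x))"
      define p where "p = ?g ` C'"
      have inj: "inj_on ?g C'" by (auto simp: inj_on_def)
      have inE: "i \<in> E e" if "i \<in> C'" for i using that C' C by auto
      have sub: "cball (m i) (r i) \<subseteq> {a..b}" if "i \<in> C'" for i
        using y[OF inE[OF that]] inE[OF that] unfolding cb cb2 E_def by auto
      have "p tagged_partial_division_of cbox a b"
        unfolding tagged_partial_division_of_def
      proof (intro conjI allI impI)
        show "finite p" using C' by (simp add: p_def)
        fix x K assume "(x, K) \<in> p"
        then have xK: "x \<in> C'" "K = cball (m x) (r x)" by (auto simp: p_def)
        show "x \<in> K" using x_in xK by simp
        show "K \<subseteq> cbox a b" using sub xK by simp
        show "\<exists>a b. K = cbox a b" unfolding xK cb cb2 by auto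
      next
        fix x K x' K' assume "(x, K) \<in> p \<and> (x', K') \<in> p \<and> (x, K) \<noteq> (x', K')"
        then have "x \<in> C'" "K = cball (m x) (r x)" "x' \<in> C'" "x' \<noteq> x" "K' = cball (m x') (r x')"
          by (auto simp: p_def)
        then have "disjnt K K'"
          using dis[unfolded pairwise_def, rule_format, of x x'] C' by auto
        then show "interior K \<inter> interior K' = {}"
          using interior_subset[of K] interior_subset[of K'] unfolding disjnt_def by blast
      qed
      moreover have "\<gamma> fine p"
        using y inE by (auto simp: fine_def p_def cb)
      ultimately have "sum (\<lambda>(x,k). norm(measure lborel k *\<^sub>R f x - integral k f)) p < e * \<mu> / 5"
        by (rule hen)
      then have *: "(\<Sum>x\<in>C'. norm (measure lborel (cball (m x) (r x)) *\<^sub>R f x - integral (cball (m x) (r x)) f)) < e * \<mu> / 5"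
        unfolding p_def by (subst (asm) sum.reindex[OF inj]) simp
      have "(\<Sum>x\<in>C'. e * (2 * r x)) \<le> (\<Sum>x\<in>C'. norm (measure lborel (cball (m x) (r x)) *\<^sub>R f x - integral (cball (m x) (r x)) f))"
      proof (rule sum_mono)
        fix x assume x: "x \<in> C'"
        have xab: "a \<le> x" "x \<le> b" using inE[OF x] by (auto simp: E_def)
        note yx = y[OF inE[OF x]]
        have "norm (measure lborel (cball (m x) (r x)) *\<^sub>R f x - integral (cball (m x) (r x)) f)
           = norm (F (y x) - F x - (y x - x) *\<^sub>R f x)"
        proof (cases "x \<le> y x")
          case True
          then show ?thesis using F_diff[of x "y x"] yx xab
            unfolding cb cb2 by (simp add: norm_minus_commute)
        next
          case False
          then have "norm (measure lborel (cball (m x) (r x)) *\<^sub>R f x - integral (cball (m x) (r x)) f) =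
             norm (- (F (y x) - F x - (y x - x) *\<^sub>R f x))"
            using F_diff[of "y x" x] yx xab unfolding cb cb2 
            by (simp add: norm_minus_commute algebra_simps)
          then show ?thesis by (simp only: norm_minus_cancel)
        qed
        then show "e * (2 * r x) \<le> norm (measure lborel (cball (m x) (r x)) *\<^sub>R f x - integral (cball (m x) (r x)) f)"
          using yx by (simp add: r_def)
      qed
      with * have "e * (\<Sum>x\<in>C'. 2 * r x) \<le> e * (\<mu> / 5)" by (simp add: sum_distrib_left)
      then show ?thesis using \<open>e > 0\<close> by simp
    qed
    let ?T = "\<Union>i\<in>C. cball (m i) (5 * r i)"
    have bd: "measure lebesgue (\<Union>i\<in>C'. cball (m i) (5 * r i)) \<le> \<mu>" if "C' \<subseteq> C" "finite C'" for C'
    proof -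
      have "measure lebesgue (\<Union>i\<in>C'. cball (m i) (5 * r i)) \<le> (\<Sum>i\<in>C'. measure lebesgue (cball (m i) (5 * r i)))"
        by (rule measure_UNION_le) (use that in auto)
      also have "\<dots> = (\<Sum>i\<in>C'. 5 * (2 * r i))"
        by (rule sum.cong) (auto simp: cball_eq_atLeastAtMost r_def)
      also have "\<dots> = 5 * (\<Sum>i\<in>C'. 2 * r i)" by (simp add: sum_distrib_left)
      also have "\<dots> \<le> \<mu>" using fin[OF that] by simp
      finally show ?thesis .
    qed
    have "?T \<in> lmeasurable" "measure lebesgue ?T \<le> \<mu>"
      using fmeasurable_UN_bound[OF C(1) _ bd] measure_UN_bound[OF C(1) _ bd] by auto
    with cov show "\<exists>T. E e \<subseteq> T \<and> T \<in> lmeasurable \<and> measure lebesgue T \<le> \<mu>" by blast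
  qed
  have "{x\<in>{a..b}. \<not> (F has_vector_derivative f x) (at x within {a..b})} \<subseteq> (\<Union>n. E (inverse (real (Suc n))))"
  proof safe
    fix x assume x: "x \<in> {a..b}" and nd: "\<not> (F has_vector_derivative f x) (at x within {a..b})"
    then obtain e where e: "e > 0" "\<And>d. d > 0 \<Longrightarrow> \<exists>y\<in>{a..b}. norm (y - x) < d \<and> 
       \<not> norm (F y - F x - (y - x) *\<^sub>R f x) \<le> e * norm (y - x)"
      unfolding has_vector_derivative_def has_derivative_within_alt
      by (auto simp: bounded_linear_scaleR_left)
    obtain n where n: "inverse (real (Suc n)) < e" using reals_Archimedean e by blast
    define k where "k = inverse (real (Suc n))"
    have "x \<in> E k"
      unfolding E_def
    proof (intro CollectI conjI allI impI x)
      fix d :: real assume "d > 0"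
      from e(2)[OF this] obtain y where y: "y\<in>{a..b}" "norm (y - x) < d"
         "\<not> norm (F y - F x - (y - x) *\<^sub>R f x) \<le> e * norm (y - x)" by blast
      then have "y \<noteq> x" by auto
      have "k * \<bar>y - x\<bar> \<le> e * \<bar>y - x\<bar>"
        using n by (intro mult_right_mono) (auto simp: k_def)
      with y have "k * \<bar>y - x\<bar> \<le> norm (F y - F x - (y - x) *\<^sub>R f x)" by simp
      with y \<open>y \<noteq> x\<close> show "\<exists>y\<in>{a..b}. y \<noteq> x \<and> \<bar>y - x\<bar> < d \<and>
        k * \<bar>y - x\<bar> \<le> norm (F y - F x - (y - x) *\<^sub>R f x)"
        by (intro bexI[of _ y]) auto
    qed
    then show "x \<in> (\<Union>n. E (inverse (real (Suc n))))" unfolding k_def by blast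
  qed
  moreover have "negligible (\<Union>n. E (inverse (real (Suc n))))"
    by (rule negligible_countable_Union) (auto intro!: neg)
  ultimately show ?thesis unfolding F_def by (rule negligible_subset[rotated])
qed

section \<open>Absolutely continuous functions are indefinite integrals\<close>

text \<open>Finite sets of intervals replace indexed families, so that the supremum defining the positive variation
  ranges over a set.\<close>

definition intervals_in :: "real \<Rightarrow> real \<Rightarrow> (real \<times> real) set set" where
  "intervals_in c d = {D. finite D \<and> (\<forall>(s, t)\<in>D. c \<le> s \<and> s < t \<and> t \<le> d) \<and>
     disjoint_family_on (\<lambda>(s, t). {s<..<t}) D}"

definition AC_real :: "real \<Rightarrow> real \<Rightarrow> (real \<Rightarrow> real) \<Rightarrow> bool" where
  "AC_real c d f \<longleftrightarrow> (\<forall>e>0. \<exists>\<delta>>0. \<forall>D\<in>intervals_in c d.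
     (\<Sum>(s, t)\<in>D. t - s) < \<delta> \<longrightarrow> (\<Sum>(s, t)\<in>D. \<bar>f t - f s\<bar>) < e)"

lemma AC_onI_cmod:
  assumes "AC_on c d f" and "\<And>s t. \<bar>h t - h s\<bar> \<le> cmod (f t - f s)"
  shows "AC_real c d h"
  unfolding AC_real_def
proof (intro allI impI)
  fix e :: real assume "e > 0"
  from assms(1)[unfolded AC_on_def, rule_format, OF this] obtain \<delta> where "\<delta> > 0"
    and \<delta>: "\<forall>D. finite D \<and> (\<forall>(s, t)\<in>D. c \<le> s \<and> s \<le> t \<and> t \<le> d) \<and>
     disjoint_family_on (\<lambda>(s, t). {s<..<t}) D \<and> (\<Sum>(s, t)\<in>D. t - s) < \<delta> \<longrightarrow>
     (\<Sum>(s, t)\<in>D. cmod (f t - f s)) < e" by (elim exE conjE)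
  have "(\<Sum>(s, t)\<in>D. \<bar>h t - h s\<bar>) < e" if "D \<in> intervals_in c d" "(\<Sum>(s, t)\<in>D. t - s) < \<delta>" for D
  proof -
    have "(\<Sum>(s, t)\<in>D. \<bar>h t - h s\<bar>) \<le> (\<Sum>(s, t)\<in>D. cmod (f t - f s))"
      by (rule sum_mono) (use assms(2) in auto)
    also have "\<dots> < e"
      by (rule \<delta>[rule_format]) (use that in \<open>fastforce simp: intervals_in_def\<close>)
    finally show ?thesis .
  qed
  with \<open>\<delta> > 0\<close> show "\<exists>\<delta>>0. \<forall>D\<in>intervals_in c d. (\<Sum>(s, t)\<in>D. t - s) < \<delta> \<longrightarrow>
     (\<Sum>(s, t)\<in>D. \<bar>h t - h s\<bar>) < e" by blast
qed

lemma intervals_in_disjoint: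
  assumes "D \<in> intervals_in c d" "p \<in> D" "q \<in> D" "fst p < x" "x < snd p" "fst q < x" "x < snd q"
  shows "p = q"
proof (rule ccontr)
  assume "p \<noteq> q"
  with assms(1-3) have "(case p of (s, t) \<Rightarrow> {s<..<t}) \<inter> (case q of (s, t) \<Rightarrow> {s<..<t}) = {}"
    by (auto simp: intervals_in_def disjoint_family_on_def)
  moreover have "x \<in> (case p of (s, t) \<Rightarrow> {s<..<t}) \<inter> (case q of (s, t) \<Rightarrow> {s<..<t})"
    using assms by (auto split: prod.splits)
  ultimately show False by blast
qed

lemma intervals_inI:
  assumes "finite D" "\<And>s t. (s, t) \<in> D \<Longrightarrow> c \<le> s \<and> s < t \<and> t \<le> d"
    and "\<And>s t s' t' x. (s, t) \<in> D \<Longrightarrow> (s', t') \<in> D \<Longrightarrow> s < x \<Longrightarrow> x < t \<Longrightarrow> s' < x \<Longrightarrow> x < t' \<Longrightarrow> s = s' \<and> t = t'"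
  shows "D \<in> intervals_in c d"
  unfolding intervals_in_def disjoint_family_on_def using assms by fastforce

lemma intervals_in_length:
  assumes "D \<in> intervals_in c d" "c \<le> d"
  shows "(\<Sum>(s, t)\<in>D. t - s) \<le> d - c"
proof -
  let ?A = "\<lambda>(s::real, t). {s<..<t}"
  have D: "finite D" "\<And>s t. (s, t) \<in> D \<Longrightarrow> c \<le> s \<and> s < t \<and> t \<le> d" "disjoint_family_on ?A D"
    using assms by (auto simp: intervals_in_def)
  have "measure lborel (\<Union>p\<in>D. ?A p) = (\<Sum>p\<in>D. measure lborel (?A p))"
  proof (rule measure_finite_Union)
    show "emeasure lborel (?A p) \<noteq> \<infinity>" for p
      using emeasure_lborel_Ioo[of "fst p" "snd p"] by (cases "fst p \<le> snd p"; cases p) auto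
  qed (use D in auto)
  also have "\<dots> = (\<Sum>(s, t)\<in>D. t - s)"
    using D(2) by (intro sum.cong) (auto simp: measure_lborel_Ioo less_imp_le)
  finally have "(\<Sum>(s, t)\<in>D. t - s) = measure lborel (\<Union>p\<in>D. ?A p)" ..
  also have "\<dots> \<le> measure lborel {c..d}"
    by (rule measure_mono_fmeasurable) (use D(1,2) in \<open>fastforce intro!: fmeasurable_compact\<close>)+
  finally show ?thesis using assms(2) by simp
qed

text \<open>Cutting the one interval that may contain the point \<open>y\<close> in two does not change the telescoping sum of increments,
  since \<open>f y\<close> cancels. This makes the positive variation additive.\<close>

lemma intervals_in_split:
  fixes f :: "real \<Rightarrow> real"
  assumes D: "D \<in> intervals_in x z" and xy: "x \<le> y" "y \<le> z"
  obtains D1 D2 where "D1 \<in> intervals_in x y" "D2 \<in> intervals_in y z"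
    "(\<Sum>(s, t)\<in>D. f t - f s) = (\<Sum>(s, t)\<in>D1. f t - f s) + (\<Sum>(s, t)\<in>D2. f t - f s)"
proof -
  let ?l = "\<lambda>(s, t). (s, min t y)" and ?r = "\<lambda>(s, t). (max s y, t)"
  define L R where "L = {p\<in>D. fst p < y}" and "R = {p\<in>D. y < snd p}"
  have fin: "finite D" and b: "\<And>s t. (s, t) \<in> D \<Longrightarrow> x \<le> s \<and> s < t \<and> t \<le> z"
    using D by (auto simp: intervals_in_def)
  note dis = intervals_in_disjoint[OF D]
  have injl: "inj_on ?l L"
  proof (rule inj_onI)
    fix p q assume pq: "p \<in> L" "q \<in> L" "?l p = ?l q"
    then have "p \<in> D" "q \<in> D" "fst p = fst q" "fst p < snd p" "fst q < snd q"
      using b[of "fst p" "snd p"] b[of "fst q" "snd q"] by (auto simp: L_def split: prod.splits)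
    then show "p = q" using dis[of p q "(fst p + min (snd p) (snd q)) / 2"] by (auto simp: min_def split: if_splits)
  qed
  have injr: "inj_on ?r R"
  proof (rule inj_onI)
    fix p q assume pq: "p \<in> R" "q \<in> R" "?r p = ?r q"
    then have "p \<in> D" "q \<in> D" "snd p = snd q" "fst p < snd p" "fst q < snd q"
      using b[of "fst p" "snd p"] b[of "fst q" "snd q"] by (auto simp: R_def split: prod.splits)
    then show "p = q" using dis[of p q "(snd p + max (fst p) (fst q)) / 2"] by (auto simp: max_def split: if_splits)
  qed
  show ?thesis
  proof (rule that[of "?l ` L" "?r ` R"])
    show "?l ` L \<in> intervals_in x y"
    proof (rule intervals_inI)
      fix s t s' t' u assume "(s, t) \<in> ?l ` L" "(s', t') \<in> ?l ` L" "s < u" "u < t" "s' < u" "u < t'"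
      then obtain w w' where "(s, w) \<in> D" "(s', w') \<in> D" "t = min w y" "t' = min w' y" "s < u" "u < w" "s' < u" "u < w'"
        by (auto simp: L_def)
      then show "s = s' \<and> t = t'" using dis[of "(s, w)" "(s', w')" u] by auto
    qed (use fin b xy in \<open>auto simp: L_def\<close>)
    show "?r ` R \<in> intervals_in y z"
    proof (rule intervals_inI)
      fix s t s' t' u assume "(s, t) \<in> ?r ` R" "(s', t') \<in> ?r ` R" "s < u" "u < t" "s' < u" "u < t'"
      then obtain w w' where "(w, t) \<in> D" "(w', t') \<in> D" "s = max w y" "s' = max w' y" "w < u" "u < t" "w' < u" "u < t'"
        by (auto simp: R_def)
      then show "s = s' \<and> t = t'" using dis[of "(w, t)" "(w', t')" u] by auto
    qed (use fin b xy in \<open>auto simp: R_def\<close>)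
    have "(\<Sum>(s, t)\<in>D. f t - f s) =
      (\<Sum>p\<in>D. (if fst p < y then f (min (snd p) y) - f (fst p) else 0) +
              (if y < snd p then f (snd p) - f (max (fst p) y) else 0))"
      using b by (intro sum.cong) (fastforce simp: min_def max_def)+
    also have "\<dots> = (\<Sum>p\<in>L. f (min (snd p) y) - f (fst p)) + (\<Sum>p\<in>R. f (snd p) - f (max (fst p) y))"
      using fin by (simp add: sum.distrib sum.inter_filter L_def R_def)
    also have "\<dots> = (\<Sum>(s, t)\<in>?l ` L. f t - f s) + (\<Sum>(s, t)\<in>?r ` R. f t - f s)"
      by (subst sum.reindex[OF injl], subst sum.reindex[OF injr]) (simp add: case_prod_unfold)
    finally show "(\<Sum>(s, t)\<in>D. f t - f s) = (\<Sum>(s, t)\<in>?l ` L. f t - f s) + (\<Sum>(s, t)\<in>?r ` R. f t - f s)" .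
  qed
qed

text \<open>An interval is cut into finitely many pieces shorter than the modulus of absolute continuity for
  \<open>1\<close>, and each piece contributes at most \<open>1\<close>.\<close>

lemma AC_real_variation_bounded:
  assumes f: "AC_real c d f" and "c \<le> d"
  obtains B where "\<And>D. D \<in> intervals_in c d \<Longrightarrow> (\<Sum>(s, t)\<in>D. f t - f s) \<le> B"
proof -
  obtain \<delta> where "\<delta> > 0" and \<delta>: "\<And>D. D \<in> intervals_in c d \<Longrightarrow> (\<Sum>(s, t)\<in>D. t - s) < \<delta> \<Longrightarrow>
      (\<Sum>(s, t)\<in>D. \<bar>f t - f s\<bar>) < 1"
    using f unfolding AC_real_def by (meson zero_less_one_class.zero_less_one)
  have step: "(\<Sum>(s, t)\<in>D. f t - f s) \<le> real k"
    if "c \<le> x" "x \<le> d" "d - x \<le> real k * (\<delta> / 2)" "D \<in> intervals_in x d" for k x D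
    using that
  proof (induction k arbitrary: x D)
    case 0
    then have "x = d" by auto
    have "D = {}"
    proof (rule ccontr)
      assume "D \<noteq> {}"
      then obtain s t where "(s, t) \<in> D" by auto
      then show False using 0(4) \<open>x = d\<close> by (auto simp: intervals_in_def)
    qed
    then show ?case by simp
  next
    case (Suc k)
    define y where "y = min d (x + \<delta> / 2)"
    have y: "x \<le> y" "y \<le> d" using Suc \<open>\<delta> > 0\<close> by (auto simp: y_def)
    obtain D1 D2 where D12: "D1 \<in> intervals_in x y" "D2 \<in> intervals_in y d"
      and sum: "(\<Sum>(s, t)\<in>D. f t - f s) = (\<Sum>(s, t)\<in>D1. f t - f s) + (\<Sum>(s, t)\<in>D2. f t - f s)"
      using intervals_in_split[OF Suc.prems(4) y] by blast
    have "(\<Sum>(s, t)\<in>D2. f t - f s) \<le> real k"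
    proof (rule Suc.IH[OF _ _ _ D12(2)])
      show "d - y \<le> real k * (\<delta> / 2)"
        using Suc.prems(3) \<open>\<delta> > 0\<close> by (auto simp: y_def min_def algebra_simps)
    qed (use y Suc in auto)
    moreover have "(\<Sum>(s, t)\<in>D1. f t - f s) \<le> (\<Sum>(s, t)\<in>D1. \<bar>f t - f s\<bar>)"
      by (rule sum_mono) auto
    moreover have "D1 \<in> intervals_in c d" using D12(1) y Suc.prems(1,2)
      unfolding intervals_in_def by fastforce
    then have "(\<Sum>(s, t)\<in>D1. \<bar>f t - f s\<bar>) < 1"
      by (rule \<delta>) (use intervals_in_length[OF D12(1) y(1)] \<open>\<delta> > 0\<close> in \<open>auto simp: y_def min_def split: if_splits\<close>)
    ultimately show ?case using sum by simp
  qed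
  obtain k :: nat where k: "(d - c) / (\<delta> / 2) < real k" using reals_Archimedean2 by blast
  then have "d - c \<le> real k * (\<delta> / 2)" using \<open>\<delta> > 0\<close> by (simp add: field_simps)
  then show ?thesis using step[of c k] \<open>c \<le> d\<close> that by blast
qed

text \<open>The supremum of the sums of signed increments over families of disjoint intervals; the empty family makes it
  nonnegative, and intervals on which the function decreases are left out.\<close>

definition positive_variation :: "(real \<Rightarrow> real) \<Rightarrow> real \<Rightarrow> real \<Rightarrow> real" where
  "positive_variation f c x = (SUP D\<in>intervals_in c x. \<Sum>(s, t)\<in>D. f t - f s)"

lemma empty_intervals_in [simp]: "{} \<in> intervals_in c d"
  by (simp add: intervals_in_def disjoint_family_on_def)

text \<open>The first claim makes the positive variation and its difference with the function monotone; the second holds because the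
  positive variation over a short family of intervals is approximated by increments of the function over a finer family inside it.\<close>

lemma
  assumes f: "AC_real c d f" 
  shows positive_variation_ge: "\<And>x y. c \<le> x \<Longrightarrow> x \<le> y \<Longrightarrow> y \<le> d \<Longrightarrow>
      max 0 (f y - f x) \<le> positive_variation f c y - positive_variation f c x" (is "\<And>x y. PROP ?ge x y")
    and AC_real_positive_variation: "AC_real c d (positive_variation f c)"
proof -
  let ?S = "\<lambda>D. \<Sum>(s, t)\<in>D. f t - f s"
  let ?P = "positive_variation f c"
  have mono: "intervals_in x y \<subseteq> intervals_in c d" if "c \<le> x" "y \<le> d" for x y
    using that unfolding intervals_in_def by fastforce
  have bdd: "bdd_above (?S ` intervals_in c x)" if "c \<le> d" "x \<le> d" for x
  proof -
    obtain B where "\<And>D. D \<in> intervals_in c d \<Longrightarrow> ?S D \<le> B"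
      using AC_real_variation_bounded[OF f \<open>c \<le> d\<close>] by blast
    then show ?thesis using mono[of c x] that by (intro bdd_aboveI2[where M = B]) auto
  qed
  have up: "?S D \<le> ?P x" if "D \<in> intervals_in c x" "c \<le> d" "x \<le> d" for D x
    unfolding positive_variation_def by (rule cSUP_upper[OF that(1) bdd[OF that(2,3)]])
  show ge: "max 0 (f y - f x) \<le> ?P y - ?P x" if xy: "c \<le> x" "x \<le> y" "y \<le> d" for x y
  proof -
    have "?P x \<le> ?P y - max 0 (f y - f x)"
      unfolding positive_variation_def[of f c x]
    proof (rule cSUP_least)
      fix D assume D: "D \<in> intervals_in c x"
      then have D': "D \<in> intervals_in c y" using xy unfolding intervals_in_def by fastforce
      have "?S D + (f y - f x) \<le> ?P y"
      proof (cases "x = y")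
        case False
        then have nin: "(x, y) \<notin> D" using D xy by (auto simp: intervals_in_def)
        have "insert (x, y) D \<in> intervals_in c y"
        proof (rule intervals_inI)
          fix s t s' t' u assume "(s, t) \<in> insert (x, y) D" "(s', t') \<in> insert (x, y) D"
            "s < u" "u < t" "s' < u" "u < t'"
          then show "s = s' \<and> t = t'"
            using intervals_in_disjoint[OF D, of "(s, t)" "(s', t')" u] D
            unfolding intervals_in_def by fastforce
        qed (use D xy False in \<open>auto simp: intervals_in_def\<close>)
        from up[OF this] show ?thesis using nin D xy by (simp add: intervals_in_def)
      qed (use up[OF D'] xy in simp)
      with up[OF D'] xy show "?S D \<le> ?P y - max 0 (f y - f x)" by (auto simp: max_def)
    qed (use empty_intervals_in in blast)
    then show ?thesis by linarith
  qed
  show "AC_real c d ?P"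
    unfolding AC_real_def
  proof (intro allI impI)
    fix e :: real assume "e > 0"
    then obtain \<delta> where "\<delta> > 0" and \<delta>: "\<And>D. D \<in> intervals_in c d \<Longrightarrow> (\<Sum>(s, t)\<in>D. t - s) < \<delta> \<Longrightarrow>
      (\<Sum>(s, t)\<in>D. \<bar>f t - f s\<bar>) < e / 2"
      using f unfolding AC_real_def by (meson half_gt_zero)
    have "(\<Sum>(s, t)\<in>E. \<bar>?P t - ?P s\<bar>) < e"
      if E: "E \<in> intervals_in c d" and len: "(\<Sum>(s, t)\<in>E. t - s) < \<delta>" for E
    proof -
      have finE: "finite E" using E by (simp add: intervals_in_def)
      have bE: "c \<le> fst p \<and> fst p < snd p \<and> snd p \<le> d" if "p \<in> E" for p
        using that E by (auto simp: intervals_in_def)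
      define \<eta> where "\<eta> = e / (2 * (real (card E) + 1))"
      have "\<eta> > 0" using \<open>e > 0\<close> by (auto simp: \<eta>_def)
      have "\<exists>D. D \<in> intervals_in (fst p) (snd p) \<and> ?P (snd p) - ?P (fst p) \<le> ?S D + \<eta>" if "p \<in> E" for p
      proof -
        note b = bE[OF that]
        have "\<exists>D\<in>intervals_in c (snd p). ?P (snd p) - \<eta> < ?S D"
        proof (rule ccontr)
          assume "\<not> ?thesis"
          then have le: "?S D \<le> ?P (snd p) - \<eta>" if "D \<in> intervals_in c (snd p)" for D
            using that by (meson not_less)
          have "(SUP D\<in>intervals_in c (snd p). ?S D) \<le> ?P (snd p) - \<eta>"
          proof (rule cSUP_least)
            show "intervals_in c (snd p) \<noteq> {}" using empty_intervals_in[of c "snd p"] by blast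
          qed (rule le)
          then have "?P (snd p) \<le> ?P (snd p) - \<eta>" by (simp add: positive_variation_def)
          with \<open>\<eta> > 0\<close> show False by simp
        qed
        then obtain D where D: "D \<in> intervals_in c (snd p)" "?P (snd p) - \<eta> < ?S D" by blast
        obtain D1 D2 where D12: "D1 \<in> intervals_in c (fst p)" "D2 \<in> intervals_in (fst p) (snd p)" "?S D = ?S D1 + ?S D2"
          using intervals_in_split[OF D(1), of "fst p"] b by (metis less_imp_le)
        have "?S D1 \<le> ?P (fst p)" by (rule up[OF D12(1)]) (use b in auto)
        then show ?thesis using D D12 by (intro exI[of _ D2]) auto
      qed
      then obtain W where W: "\<And>p. p \<in> E \<Longrightarrow> W p \<in> intervals_in (fst p) (snd p)"
        and WP: "\<And>p. p \<in> E \<Longrightarrow> ?P (snd p) - ?P (fst p) \<le> ?S (W p) + \<eta>" by metis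
      have finW: "finite (W p)" if "p \<in> E" for p using W[OF that] by (simp add: intervals_in_def)
      have bW: "fst p \<le> s \<and> s < t \<and> t \<le> snd p" if "p \<in> E" "(s, t) \<in> W p" for p s t
        using W[OF that(1)] that(2) by (auto simp: intervals_in_def)
      have same: "p = q" if "p \<in> E" "(s, t) \<in> W p" "q \<in> E" "(s', t') \<in> W q" "s < u" "u < t" "s' < u" "u < t'" for p q s t s' t' u
        using intervals_in_disjoint[OF E that(1,3), of u] bW[OF that(1,2)] bW[OF that(3,4)] that by linarith
      have disW: "W p \<inter> W q = {}" if "p \<in> E" "q \<in> E" "p \<noteq> q" for p q
      proof (rule ccontr)
        assume "W p \<inter> W q \<noteq> {}"
        then obtain s t where st: "(s, t) \<in> W p" "(s, t) \<in> W q" by auto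
        then show False using same[OF that(1) st(1) that(2) st(2), of "(s + t) / 2"] bW[OF that(1) st(1)] that(3) by simp
      qed
      have UW: "(\<Union>p\<in>E. W p) \<in> intervals_in c d"
      proof (rule intervals_inI)
        fix s t s' t' u assume st: "(s, t) \<in> (\<Union>p\<in>E. W p)" "(s', t') \<in> (\<Union>p\<in>E. W p)" "s < u" "u < t" "s' < u" "u < t'"
        then obtain p q where pq: "p \<in> E" "(s, t) \<in> W p" "q \<in> E" "(s', t') \<in> W q" by auto
        then have "p = q" using same st by blast
        then show "s = s' \<and> t = t'" using intervals_in_disjoint[OF W[OF pq(1)], of "(s, t)" "(s', t')" u] pq st by auto
      next
        fix s t assume "(s, t) \<in> (\<Union>p\<in>E. W p)"
        then obtain p where "p \<in> E" "(s, t) \<in> W p" by auto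
        then show "c \<le> s \<and> s < t \<and> t \<le> d" using bW bE by fastforce
      qed (use finE finW in auto)
      have sumW: "(\<Sum>(s, t)\<in>(\<Union>p\<in>E. W p). h s t) = (\<Sum>p\<in>E. \<Sum>(s, t)\<in>W p. h s t)" for h :: "real \<Rightarrow> real \<Rightarrow> real"
        by (rule sum.UNION_disjoint) (use finE finW disW in auto)
      have "(\<Sum>(s, t)\<in>(\<Union>p\<in>E. W p). t - s) \<le> (\<Sum>p\<in>E. snd p - fst p)"
        unfolding sumW
      proof (rule sum_mono)
        fix p assume "p \<in> E"
        then show "(\<Sum>(s, t)\<in>W p. t - s) \<le> snd p - fst p"
          using intervals_in_length[OF W[of p]] bE[of p] by simp
      qed
      also have "\<dots> < \<delta>" using len by (simp add: case_prod_unfold)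
      finally have "(\<Sum>(s, t)\<in>(\<Union>p\<in>E. W p). \<bar>f t - f s\<bar>) < e / 2" by (rule \<delta>[OF UW])
      moreover have "(\<Sum>p\<in>E. ?S (W p)) \<le> (\<Sum>(s, t)\<in>(\<Union>p\<in>E. W p). \<bar>f t - f s\<bar>)"
        unfolding sumW[of "\<lambda>s t. \<bar>f t - f s\<bar>"] by (intro sum_mono) auto
      moreover have "(\<Sum>(s, t)\<in>E. \<bar>?P t - ?P s\<bar>) \<le> (\<Sum>p\<in>E. ?S (W p) + \<eta>)"
      proof (rule sum_mono)
        fix p assume "p \<in> E"
        then show "(case p of (s, t) \<Rightarrow> \<bar>?P t - ?P s\<bar>) \<le> ?S (W p) + \<eta>"
          using WP[of p] ge[of "fst p" "snd p"] bE[of p] by (auto simp: case_prod_unfold)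
      qed
      moreover have "real (card E) * \<eta> < e / 2"
        using \<open>e > 0\<close> by (simp add: \<eta>_def field_simps)
      ultimately show ?thesis by (simp add: sum.distrib)
    qed
    with \<open>\<delta> > 0\<close> show "\<exists>\<delta>>0. \<forall>D\<in>intervals_in c d. (\<Sum>(s, t)\<in>D. t - s) < \<delta> \<longrightarrow>
      (\<Sum>(s, t)\<in>D. \<bar>?P t - ?P s\<bar>) < e" by blast
  qed
qed

lemma AC_real_sub:
  assumes "AC_real c d f" "AC_real c d g" shows "AC_real c d (\<lambda>x. f x - g x)"
  unfolding AC_real_def
proof (intro allI impI)
  fix e :: real assume "e > 0"
  then obtain d1 d2 where d: "d1 > 0" "d2 > 0"
    "\<And>D. D \<in> intervals_in c d \<Longrightarrow> (\<Sum>(s, t)\<in>D. t - s) < d1 \<Longrightarrow> (\<Sum>(s, t)\<in>D. \<bar>f t - f s\<bar>) < e / 2"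
    "\<And>D. D \<in> intervals_in c d \<Longrightarrow> (\<Sum>(s, t)\<in>D. t - s) < d2 \<Longrightarrow> (\<Sum>(s, t)\<in>D. \<bar>g t - g s\<bar>) < e / 2"
    using assms unfolding AC_real_def by (metis half_gt_zero)
  have "(\<Sum>(s, t)\<in>D. \<bar>f t - g t - (f s - g s)\<bar>) < e"
    if "D \<in> intervals_in c d" "(\<Sum>(s, t)\<in>D. t - s) < min d1 d2" for D
  proof -
    have "(\<Sum>(s, t)\<in>D. \<bar>f t - g t - (f s - g s)\<bar>) \<le> (\<Sum>(s, t)\<in>D. \<bar>f t - f s\<bar>) + (\<Sum>(s, t)\<in>D. \<bar>g t - g s\<bar>)"
      unfolding sum.distrib[symmetric] by (rule sum_mono) auto
    then show ?thesis using d(3,4)[of D] that by simp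
  qed
  then show "\<exists>\<delta>>0. \<forall>D\<in>intervals_in c d. (\<Sum>(s, t)\<in>D. t - s) < \<delta> \<longrightarrow>
     (\<Sum>(s, t)\<in>D. \<bar>f t - g t - (f s - g s)\<bar>) < e"
    using d(1,2) by (intro exI[of _ "min d1 d2"]) auto
qed

lemma AC_real_continuous_on:
  assumes "AC_real c d f"
  shows "continuous_on {c..d} f"
  unfolding continuous_on_iff
proof (intro ballI allI impI)
  fix x e :: real assume x: "x \<in> {c..d}" and "e > 0"
  then obtain \<delta> where "\<delta> > 0" and \<delta>: "\<And>D. D \<in> intervals_in c d \<Longrightarrow> (\<Sum>(s, t)\<in>D. t - s) < \<delta> \<Longrightarrow>
      (\<Sum>(s, t)\<in>D. \<bar>f t - f s\<bar>) < e"
    using assms unfolding AC_real_def by metis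
  have *: "\<bar>f t - f s\<bar> < e" if "c \<le> s" "s < t" "t \<le> d" "t - s < \<delta>" for s t
    using \<delta>[of "{(s, t)}"] that by (simp add: intervals_in_def disjoint_family_on_def)
  have "dist (f x') (f x) < e" if "x' \<in> {c..d}" "dist x' x < \<delta>" for x'
    using *[of x x'] *[of x' x] that x \<open>e > 0\<close> by (cases x x' rule: linorder_cases) (auto simp: dist_real_def)
  with \<open>\<delta> > 0\<close> show "\<exists>\<delta>>0. \<forall>x'\<in>{c..d}. dist x' x < \<delta> \<longrightarrow> dist (f x') (f x) < e" by blast
qed

text \<open>The increments of a monotone function define a Stieltjes measure. Absolute continuity of the function says that
  open sets of small length have small measure, so the measure is absolutely continuous with respect to
  Lebesgue measure and the Radon--Nikodym theorem supplies the density.\<close>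

lemma AC_real_mono_density:
  fixes F :: "real \<Rightarrow> real"
  assumes ac: "AC_real c d F" and mono: "\<And>x y. c \<le> x \<Longrightarrow> x \<le> y \<Longrightarrow> y \<le> d \<Longrightarrow> F x \<le> F y" and "c \<le> d"
  obtains g where "g absolutely_integrable_on {c..d}" "\<forall>x\<in>{c..d}. F x = F c + integral {c..x} g"
proof -
  define G where "G = (\<lambda>x. F (max c (min d x)))"
  define \<mu> where "\<mu> = interval_measure G"
  have Gmono: "\<And>x y. x \<le> y \<Longrightarrow> G x \<le> G y"
    unfolding G_def using \<open>c \<le> d\<close> by (intro mono) auto
  have Gcont: "continuous_on UNIV G"
    unfolding G_def
    by (rule continuous_on_compose2[OF AC_real_continuous_on[OF ac]])
       (use \<open>c \<le> d\<close> in \<open>auto intro!: continuous_intros\<close>)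
  have Gright: "\<And>a. continuous (at_right a) G"
    using Gcont by (auto simp: continuous_on_eq_continuous_within intro: continuous_within_subset)
  have Ioc: "emeasure \<mu> {s<..t} = ennreal (G t - G s)" if "s \<le> t" for s t
    unfolding \<mu>_def by (rule emeasure_interval_measure_Ioc[OF that Gmono Gright])
  have sets_\<mu> [simp, measurable_cong]: "sets \<mu> = sets borel" by (simp add: \<mu>_def)
  have ac\<mu>: "absolutely_continuous lborel \<mu>"
    unfolding absolutely_continuous_def
  proof safe
    fix N :: "real set" assume N: "N \<in> null_sets lborel"
    then have Nb: "N \<in> sets borel" by auto
    have low: "{..c} \<in> null_sets \<mu>"
    proof -
      have "{..c} = (\<Union>n::nat. {c - real (Suc n)<..c})"
      proof safe
        fix x assume "x \<le> c"
        obtain n where "c - x < real n" using reals_Archimedean2 by blast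
        then show "x \<in> (\<Union>n::nat. {c - real (Suc n)<..c})" using \<open>x \<le> c\<close> by (intro UN_I[of n]) auto
      qed auto
      moreover have "{c - real (Suc n)<..c} \<in> null_sets \<mu>" for n
        using \<open>c \<le> d\<close> by (intro null_setsI) (auto simp: Ioc G_def)
      ultimately show ?thesis by (auto intro!: null_sets_UN simp del: of_nat_Suc)
    qed
    have high: "{d..} \<in> null_sets \<mu>"
    proof -
      have eq: "{d..} = {d..d} \<union> (\<Union>n::nat. {d<..d + real (Suc n)})"
      proof safe
        fix x assume "x \<ge> d" and *: "x \<notin> (\<Union>n::nat. {d<..d + real (Suc n)})"
        obtain n where "x - d < real n" using reals_Archimedean2 by blast
        then show "x \<in> {d..d}" using \<open>x \<ge> d\<close> * by (cases "x = d") (auto dest!: spec[of _ n])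
      qed auto
      moreover have "{d<..d + real (Suc n)} \<in> null_sets \<mu>" for n
        using \<open>c \<le> d\<close> by (intro null_setsI) (auto simp: Ioc G_def)
      moreover have "{d..d} \<in> null_sets \<mu>"
        using emeasure_interval_measure_Icc[of d d G, OF _ Gmono Gcont]
        by (intro null_setsI) (auto simp: \<mu>_def[symmetric])
      ultimately show ?thesis unfolding eq by (intro null_sets.Un null_sets_UN)
    qed
    define M where "M = N \<inter> {c<..<d}"
    have Mb: "M \<in> sets borel" using Nb by (auto simp: M_def)
    have M0: "emeasure lborel M = 0"
      using N Nb unfolding M_def by (metis (no_types, lifting) Int_lower1 emeasure_eq_0 null_setsD1 null_setsD2)
    have "emeasure \<mu> M \<le> 0 + ennreal e" if "e > 0" for e
    proof -
      obtain \<delta> where "\<delta> > 0" and \<delta>: "\<And>D. D \<in> intervals_in c d \<Longrightarrow> (\<Sum>(s, t)\<in>D. t - s) < \<delta> \<Longrightarrow>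
        (\<Sum>(s, t)\<in>D. \<bar>F t - F s\<bar>) < e" using ac \<open>e > 0\<close> unfolding AC_real_def by metis
      obtain U0 where U0: "open U0" "M \<subseteq> U0" "emeasure lborel (U0 - M) < \<delta>"
        using outer_regular_lborel[OF Mb \<open>\<delta> > 0\<close>] by blast
      define U where "U = U0 \<inter> {c<..<d}"
      have U: "open U" "M \<subseteq> U" using U0 by (auto simp: U_def M_def)
      have Usub: "U \<subseteq> {c<..<d}" by (auto simp: U_def)
      have "emeasure lborel U \<le> emeasure lborel (U0 - M) + emeasure lborel M"
        using U0(1) Mb by (subst plus_emeasure) (auto intro!: emeasure_mono simp: U_def)
      then have lenU: "emeasure lborel U < \<delta>" using U0(3) M0 by simp
      have comp: "C = {Inf C<..<Sup C}" "Inf C < Sup C" "c \<le> Inf C" "Sup C \<le> d" if "C \<in> components U" for C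
      proof -
        have C: "open C" "connected C" "C \<noteq> {}" "C \<subseteq> {c<..<d}"
          using that U Usub in_components_subset in_components_nonempty in_components_connected open_components by blast+
        have bd: "bdd_above C" "bdd_below C" using C(4) by (auto intro!: bdd_aboveI[of _ d] bdd_belowI[of _ c])
        have ne: "Inf C \<notin> C" "Sup C \<notin> C"
        proof -
          show "Inf C \<notin> C"
          proof
            assume "Inf C \<in> C"
            then obtain r where "r > 0" "ball (Inf C) r \<subseteq> C" using C(1) open_contains_ball by blast
            then have "Inf C - r / 2 \<in> C" by (auto simp: dist_real_def subset_iff)
            then show False using cInf_lower[OF _ bd(2)] \<open>r > 0\<close> by fastforce
          qed
          show "Sup C \<notin> C"
          proof
            assume "Sup C \<in> C"
            then obtain r where "r > 0" "ball (Sup C) r \<subseteq> C" using C(1) open_contains_ball by blast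
            then have "Sup C + r / 2 \<in> C" by (auto simp: dist_real_def subset_iff)
            then show False using cSup_upper[OF _ bd(1)] \<open>r > 0\<close> by fastforce
          qed
        qed
        show eq: "C = {Inf C<..<Sup C}"
        proof safe
          fix x assume "x \<in> C"
          then show "x \<in> {Inf C<..<Sup C}"
            using cInf_lower[OF _ bd(2)] cSup_upper[OF _ bd(1)] ne by (metis greaterThanLessThan_iff order_le_less)
        next
          fix x assume x: "x \<in> {Inf C<..<Sup C}"
          then obtain y z where "y \<in> C" "y < x" "z \<in> C" "x < z"
            using cInf_lessD[OF C(3)] less_cSupD[OF C(3)] by (metis greaterThanLessThan_iff)
          then show "x \<in> C" using C(2) unfolding connected_iff_interval by (meson less_imp_le)
        qed
        show "Inf C < Sup C" using eq C(3) by force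
        have "c \<le> x" "x \<le> d" if "x \<in> C" for x
          using subsetD[OF C(4) that] by simp_all
        then show "c \<le> Inf C" "Sup C \<le> d"
          using cInf_greatest[OF C(3), of c] cSup_least[OF C(3), of d] by blast+
      qed
      have "pairwise disjnt (components U)"
        using pairwise_disjoint_components[of U] unfolding disjnt_def pairwise_def by blast
      then have "countable (components U)"
        using countable_disjoint_open_subsets open_components U(1) by blast
      have fin: "emeasure \<mu> (\<Union>\<C>) \<le> ennreal e" if \<C>: "finite \<C>" "\<C> \<subseteq> components U" for \<C>
      proof -
        let ?i = "\<lambda>C::real set. (Inf C, Sup C)"
        have inj: "inj_on ?i \<C>"
        proof (rule inj_onI)
          fix C C' assume "C \<in> \<C>" "C' \<in> \<C>" "?i C = ?i C'"
          then show "C = C'" using comp(1)[of C] comp(1)[of C'] \<C>(2) by (metis prod.inject subsetD)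
        qed
        have dis: "disjoint_family_on (\<lambda>C. C) \<C>"
          using pairwise_disjoint_components[of U] \<C>(2) unfolding disjoint_family_on_def pairwise_def by blast
        have D: "?i ` \<C> \<in> intervals_in c d"
        proof (rule intervals_inI)
          fix s t s' t' x assume "(s, t) \<in> ?i ` \<C>" "(s', t') \<in> ?i ` \<C>" and x: "s < x" "x < t" "s' < x" "x < t'"
          then obtain C C' where C: "C \<in> \<C>" "C' \<in> \<C>" "s = Inf C" "t = Sup C" "s' = Inf C'" "t' = Sup C'" by auto
          then have "C \<in> components U" "C' \<in> components U" using \<C>(2) by auto
          then have "x \<in> C" "x \<in> C'"
            using comp(1) C(3-6) x by (metis greaterThanLessThan_iff)+
          then have "C = C'" using dis C(1,2) unfolding disjoint_family_on_def by blast
          then show "s = s' \<and> t = t'" using C by simp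
        next
          fix s t assume "(s, t) \<in> ?i ` \<C>"
          then obtain C where "C \<in> components U" "s = Inf C" "t = Sup C" using \<C>(2) by auto
          then show "c \<le> s \<and> s < t \<and> t \<le> d" using comp(2-4)[of C] by simp
        qed (use \<C> in simp)
        have mC: "C \<in> sets borel" if "C \<in> \<C>" for C
          using that \<C>(2) open_components[OF U(1)] by (intro borel_open) blast
        have "ennreal (\<Sum>(s, t)\<in>?i ` \<C>. t - s) = (\<Sum>C\<in>\<C>. ennreal (Sup C - Inf C))"
          using comp(2) \<C>(2) by (subst sum.reindex[OF inj], subst sum_ennreal) (fastforce intro: less_imp_le)+
        also have "\<dots> = (\<Sum>C\<in>\<C>. emeasure lborel C)"
        proof (rule sum.cong[OF refl])
          fix C assume "C \<in> \<C>"
          then have "C = {Inf C<..<Sup C}" "Inf C \<le> Sup C" using comp(1,2)[of C] subsetD[OF \<C>(2)] by (blast intro: less_imp_le)+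
          then show "ennreal (Sup C - Inf C) = emeasure lborel C" by (metis emeasure_lborel_Ioo)
        qed
        also have "\<dots> = emeasure lborel (\<Union>C\<in>\<C>. C)"
          by (rule sum_emeasure) (use dis mC \<C>(1) in auto)
        also have "\<dots> \<le> emeasure lborel U"
        proof (rule emeasure_mono)
          show "(\<Union>C\<in>\<C>. C) \<subseteq> U"
            using \<C>(2) in_components_subset[of _ U] by (meson UN_least subsetD)
        qed (use U(1) in simp)
        also note lenU
        finally have "ennreal (\<Sum>(s, t)\<in>?i ` \<C>. t - s) < ennreal \<delta>" .
        then have "(\<Sum>(s, t)\<in>?i ` \<C>. t - s) < \<delta>" 
          using ennreal_leI[of \<delta>] by (metis not_less)
        then have "(\<Sum>(s, t)\<in>?i ` \<C>. \<bar>F t - F s\<bar>) < e" by (rule \<delta>[OF D])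
        then have *: "(\<Sum>C\<in>\<C>. \<bar>F (Sup C) - F (Inf C)\<bar>) < e" by (subst (asm) sum.reindex[OF inj]) simp
        have "emeasure \<mu> (\<Union>C\<in>\<C>. C) = (\<Sum>C\<in>\<C>. emeasure \<mu> C)"
          by (rule sum_emeasure[symmetric]) (use dis mC \<C>(1) in auto)
        also have "\<dots> \<le> (\<Sum>C\<in>\<C>. ennreal \<bar>F (Sup C) - F (Inf C)\<bar>)"
        proof (rule sum_mono)
          fix C assume "C \<in> \<C>"
          then have C: "C = {Inf C<..<Sup C}" "Inf C < Sup C" "c \<le> Inf C" "Sup C \<le> d" using comp[of C] subsetD[OF \<C>(2)] by blast+
          have "emeasure \<mu> C \<le> emeasure \<mu> {Inf C<..Sup C}"
            by (subst C(1)) (auto intro!: emeasure_mono)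
          also have "\<dots> = ennreal \<bar>F (Sup C) - F (Inf C)\<bar>"
          proof -
            have "G (Sup C) = F (Sup C)" "G (Inf C) = F (Inf C)" using C(2-4) by (auto simp: G_def)
            then show ?thesis using Ioc[of "Inf C" "Sup C"] mono[of "Inf C" "Sup C"] C(2-4) by simp
          qed
          finally show "emeasure \<mu> C \<le> ennreal \<bar>F (Sup C) - F (Inf C)\<bar>" .
        qed
        also have "\<dots> = ennreal (\<Sum>C\<in>\<C>. \<bar>F (Sup C) - F (Inf C)\<bar>)" by (rule sum_ennreal) auto
        also have "\<dots> \<le> ennreal e" using * by (intro ennreal_leI) simp
        finally show ?thesis by simp
      qed
      have "emeasure \<mu> U \<le> ennreal e"
      proof (cases "components U = {}")
        case True then show ?thesis by simp
      next
        case False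
        then obtain h :: "nat \<Rightarrow> real set" where h: "range h = components U"
          using \<open>countable (components U)\<close> range_from_nat_into by metis
        have mh: "h i \<in> sets borel" for i using h U open_components by (metis borel_open rangeI)
        have "U = (\<Union>n. \<Union>i<n. h i)"
        proof -
          have "U = \<Union>(range h)" using h Union_components by metis
          then show ?thesis by auto
        qed
        moreover have "(SUP n. emeasure \<mu> (\<Union>i<n. h i)) = emeasure \<mu> (\<Union>n. \<Union>i<n. h i)"
        proof (rule SUP_emeasure_incseq)
          show "incseq (\<lambda>n. \<Union>i<n. h i)"
            unfolding incseq_def by (auto intro: less_le_trans)
        qed (use mh in auto)
        moreover have "emeasure \<mu> (\<Union>i<n. h i) \<le> ennreal e" for n
          using fin[of "h ` {..<n}"] h by auto
        ultimately show ?thesis by (metis SUP_least)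
      qed
      then show ?thesis using emeasure_mono[OF U(2), of \<mu>] U(1) by (simp add: order_trans[of "emeasure \<mu> M"])
    qed
    then have "emeasure \<mu> M \<le> 0"
      by (rule ennreal_le_epsilon)
    then have "emeasure \<mu> M = 0" by simp
    then have "M \<in> null_sets \<mu>" using Mb by (intro null_setsI) auto
    then have "M \<union> ({..c} \<union> {d..}) \<in> null_sets \<mu>" using low high by blast
    moreover have "N \<subseteq> M \<union> ({..c} \<union> {d..})" by (auto simp: M_def)
    ultimately show "N \<in> null_sets \<mu>" using Nb by (auto intro: null_sets_subset)
  qed
  obtain h where h: "h \<in> borel_measurable lborel" "density lborel h = \<mu>"
    using sigma_finite_measure.Radon_Nikodym[OF sigma_finite_lborel ac\<mu>] by auto
  have h_int: "(\<integral>\<^sup>+x\<in>{c<..y}. h x \<partial>lborel) = ennreal (F y - F c)" if "y \<in> {c..d}" for y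
  proof -
    have "(\<integral>\<^sup>+x\<in>{c<..y}. h x \<partial>lborel) = emeasure \<mu> {c<..y}"
      unfolding h(2)[symmetric] using h(1) by (subst emeasure_density) (auto simp: mult.commute)
    also have "\<dots> = ennreal (F y - F c)" using that by (subst Ioc) (auto simp: G_def)
    finally show ?thesis .
  qed
  define g where "g = (\<lambda>x. enn2real (h x))"
  have hfin: "AE x in lborel. x \<in> {c<..d} \<longrightarrow> h x \<noteq> \<infinity>"
  proof -
    have "AE x in lborel. h x * indicator {c<..d} x \<noteq> \<infinity>"
      by (rule nn_integral_PInf_AE) (use h(1) h_int[of d] \<open>c \<le> d\<close> in auto)
    then show ?thesis by eventually_elim (auto simp: indicator_def)
  qed
  have g_int: "(\<integral>\<^sup>+x. ennreal (indicator {c<..y} x * g x) \<partial>lborel) = ennreal (F y - F c)" if "y \<in> {c..d}" for y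
  proof -
    have "(\<integral>\<^sup>+x. ennreal (indicator {c<..y} x * g x) \<partial>lborel) = (\<integral>\<^sup>+x\<in>{c<..y}. h x \<partial>lborel)"
    proof (rule nn_integral_cong_AE)
      show "AE x in lborel. ennreal (indicator {c<..y} x * g x) = h x * indicator {c<..y} x"
        using hfin by eventually_elim (use that in \<open>auto simp: indicator_def g_def less_top\<close>)
    qed
    with h_int[OF that] show ?thesis by simp
  qed
  have gm: "g \<in> borel_measurable borel" using h(1) by (simp add: g_def)
  have hbi: "has_bochner_integral lborel (\<lambda>x. indicator {c<..y} x * g x) (F y - F c)" if "y \<in> {c..d}" for y
    by (rule has_bochner_integral_nn_integral[OF _ _ _ g_int[OF that]])
       (use gm mono[of c y] that in \<open>auto simp: g_def\<close>)
  have habs: "set_integrable lborel {c<..y} g" "(LINT x:{c<..y}|lborel. g x) = F y - F c" if "y \<in> {c..d}" for y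
    using hbi[OF that] unfolding set_integrable_def set_lebesgue_integral_def has_bochner_integral_iff by auto
  have "g absolutely_integrable_on {c<..d}"
    using habs(1)[of d] \<open>c \<le> d\<close> gm unfolding set_integrable_def
    by (intro integrable_completion[THEN iffD2]) auto
  then have gabs: "g absolutely_integrable_on {c..d}"
    by (rule absolutely_integrable_spike_set) (auto intro!: negligible_subset[OF negligible_sing[of c]])
  moreover have "F x = F c + integral {c..x} g" if x: "x \<in> {c..d}" for x
  proof -
    have "integral {c..x} g = integral {c<..x} g"
      by (rule integral_spike_set) (auto intro!: negligible_subset[OF negligible_sing[of c]])
    also have "\<dots> = F x - F c"
      using set_borel_integral_eq_integral(2)[OF habs(1)[OF x]] habs(2)[OF x] by simp
    finally show ?thesis by simp
  qed
  ultimately show ?thesis by (intro that[of g] ballI)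
qed

text \<open>The positive variation and its difference with \<open>f\<close> are both monotone and absolutely continuous
  (Jordan decomposition), so the monotone case applies to each.\<close>

lemma AC_real_density:
  assumes f: "AC_real c d f" and "c \<le> d"
  obtains g where "g absolutely_integrable_on {c..d}" "\<forall>x\<in>{c..d}. f x = f c + integral {c..x} g"
proof -
  let ?P = "positive_variation f c"
  have P: "AC_real c d ?P" by (rule AC_real_positive_variation[OF f])
  have Pm: "?P x \<le> ?P y" "f y - f x \<le> ?P y - ?P x" if "c \<le> x" "x \<le> y" "y \<le> d" for x y
    using positive_variation_ge[OF f that] by linarith+
  obtain g where g: "g absolutely_integrable_on {c..d}" "\<forall>x\<in>{c..d}. ?P x = ?P c + integral {c..x} g"
    by (rule AC_real_mono_density[OF P Pm(1) \<open>c \<le> d\<close>]) (rule that | assumption)+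
  have mono: "?P x - f x \<le> ?P y - f y" if "c \<le> x" "x \<le> y" "y \<le> d" for x y
    using Pm(2)[OF that] by linarith
  obtain h where h: "h absolutely_integrable_on {c..d}"
    "\<forall>x\<in>{c..d}. ?P x - f x = ?P c - f c + integral {c..x} h"
    by (rule AC_real_mono_density[OF AC_real_sub[OF P f] mono \<open>c \<le> d\<close>]) (rule that | assumption)+
  show ?thesis
  proof (intro that ballI)
    show "(\<lambda>x. g x - h x) absolutely_integrable_on {c..d}" using g h by (intro set_integral_diff)
    fix x assume x: "x \<in> {c..d}"
    have "g integrable_on {c..x}" "h integrable_on {c..x}"
      using set_lebesgue_integral_eq_integral(1)[OF g(1)] set_lebesgue_integral_eq_integral(1)[OF h(1)] x
      by (auto intro: integrable_subinterval_real)
    then have "integral {c..x} (\<lambda>x. g x - h x) = integral {c..x} g - integral {c..x} h"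
      by (rule Henstock_Kurzweil_Integration.integral_diff)
    then show "f x = f c + integral {c..x} (\<lambda>x. g x - h x)" using bspec[OF g(2) x] bspec[OF h(2) x] by linarith
  qed
qed

lemma AC_on_density:
  assumes f: "AC_on c d f" and "c \<le> d"
  obtains g where "g absolutely_integrable_on {c..d}" "\<forall>x\<in>{c..d}. f x = f c + integral {c..x} g"
proof -
  have R: "AC_real c d (\<lambda>x. Re (f x))"
    by (rule AC_onI_cmod[OF f]) (use abs_Re_le_cmod[of "f _ - f _"] in simp)
  have I: "AC_real c d (\<lambda>x. Im (f x))"
    by (rule AC_onI_cmod[OF f]) (use abs_Im_le_cmod[of "f _ - f _"] in simp)
  obtain g where g: "g absolutely_integrable_on {c..d}" "\<forall>x\<in>{c..d}. Re (f x) = Re (f c) + integral {c..x} g"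
    using AC_real_density[OF R \<open>c \<le> d\<close>] by blast
  obtain h where h: "h absolutely_integrable_on {c..d}" "\<forall>x\<in>{c..d}. Im (f x) = Im (f c) + integral {c..x} h"
    using AC_real_density[OF I \<open>c \<le> d\<close>] by blast
  show ?thesis
  proof (intro that ballI)
    have "(\<lambda>x. complex_of_real (g x)) absolutely_integrable_on {c..d}"
      "(\<lambda>x. \<i> * complex_of_real (h x)) absolutely_integrable_on {c..d}"
      using absolutely_integrable_linear[OF g(1) bounded_linear_of_real[where 'a = complex]]
        absolutely_integrable_linear[OF h(1) bounded_linear_of_real[where 'a = complex]]
      by (simp_all add: o_def)
    then show "(\<lambda>x. complex_of_real (g x) + \<i> * complex_of_real (h x)) absolutely_integrable_on {c..d}"
      by (rule set_integral_add)
    fix x assume x: "x \<in> {c..d}"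
    have "(g has_integral integral {c..x} g) {c..x}" "(h has_integral integral {c..x} h) {c..x}"
      using set_lebesgue_integral_eq_integral(1)[OF g(1)] set_lebesgue_integral_eq_integral(1)[OF h(1)] x
      by (auto intro!: integrable_integral intro: integrable_subinterval_real)
    then have "((\<lambda>x. complex_of_real (g x) + \<i> * complex_of_real (h x)) has_integral
       (complex_of_real (integral {c..x} g) + \<i> * complex_of_real (integral {c..x} h))) {c..x}"
      by (intro has_integral_add has_integral_mult_right has_integral_of_real)
    then have "integral {c..x} (\<lambda>x. complex_of_real (g x) + \<i> * complex_of_real (h x)) =
       complex_of_real (integral {c..x} g) + \<i> * complex_of_real (integral {c..x} h)"
      by (rule integral_unique)
    moreover have "f x = f c + (complex_of_real (integral {c..x} g) + \<i> * complex_of_real (integral {c..x} h))"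
      by (rule complex_eqI) (simp_all add: bspec[OF g(2) x] bspec[OF h(2) x])
    ultimately show "f x = f c + integral {c..x} (\<lambda>x. complex_of_real (g x) + \<i> * complex_of_real (h x))"
      by metis
  qed
qed

section \<open>Calculus of absolutely continuous functions\<close>

lemma integral_increment:
  fixes g :: "real \<Rightarrow> 'a::euclidean_space"
  assumes "g integrable_on {c..d}" and "\<And>x. x \<in> {c..d} \<Longrightarrow> f x = C + integral {c..x} g"
    and "c \<le> s" "s \<le> t" "t \<le> d"
  shows "f t - f s = integral {s..t} g"
proof -
  have "integral {c..s} g + integral {s..t} g = integral {c..t} g"
    by (rule Henstock_Kurzweil_Integration.integral_combine)
       (use assms in \<open>auto intro: integrable_subinterval_real\<close>)
  then show ?thesis using assms by (simp add: algebra_simps)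
qed

lemma sum_integrals_disjoint_le:
  fixes k :: "real \<Rightarrow> real"
  assumes k: "k integrable_on {c..d}" "\<And>x. x \<in> {c..d} \<Longrightarrow> 0 \<le> k x"
    and D: "finite D" "\<And>s t. (s, t) \<in> D \<Longrightarrow> c \<le> s \<and> s \<le> t \<and> t \<le> d"
    and dis: "disjoint_family_on (\<lambda>(s, t). {s<..<t}) D"
  shows "(\<Sum>(s, t)\<in>D. integral {s..t} k) \<le> integral {c..d} k"
proof -
  let ?T = "\<lambda>p::real \<times> real. {fst p..snd p}"
  have sub: "?T p \<subseteq> {c..d}" if "p \<in> D" for p using D(2)[of "fst p" "snd p"] that by auto
  have "(k has_integral (\<Sum>p\<in>D. integral (?T p) k)) (\<Union>p\<in>D. ?T p)"
  proof (rule has_integral_UN[OF D(1)])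
    fix p assume "p \<in> D"
    then show "(k has_integral integral (?T p) k) (?T p)"
      by (intro integrable_integral integrable_subinterval_real[OF k(1)] sub)
  next
    show "pairwise (\<lambda>p q. negligible (?T p \<inter> ?T q)) D"
    proof (rule pairwiseI)
      fix p q assume "p \<in> D" "q \<in> D" "p \<noteq> q"
      then have "{fst p<..<snd p} \<inter> {fst q<..<snd q} = {}"
        using dis by (auto simp: disjoint_family_on_def case_prod_unfold)
      then have "?T p \<inter> ?T q \<subseteq> {fst p, snd p, fst q, snd q}" by force
      then show "negligible (?T p \<inter> ?T q)" by (rule negligible_subset[rotated]) simp
    qed
  qed
  moreover have "(\<Union>p\<in>D. ?T p) \<subseteq> {c..d}" using sub by (rule UN_least)
  ultimately have "(\<Sum>p\<in>D. integral (?T p) k) \<le> integral {c..d} k"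
    using has_integral_subset_le[OF _ _ integrable_integral[OF k(1)]] k(2) by blast
  then show ?thesis by (simp add: case_prod_unfold)
qed

text \<open>Absolute continuity of the integral: domination of the increments by integrals of one integrable
  function is a criterion that is easily checked for sums and products.\<close>

lemma AC_onI_dominated:
  assumes k: "k integrable_on {c..d}" "\<And>x. x \<in> {c..d} \<Longrightarrow> 0 \<le> k x"
    and le: "\<And>s t. c \<le> s \<Longrightarrow> s \<le> t \<Longrightarrow> t \<le> d \<Longrightarrow> cmod (f t - f s) \<le> integral {s..t} k"
  shows "AC_on c d f"
  unfolding AC_on_def
proof (intro allI impI)
  fix e :: real assume "e > 0"
  have kabs: "k absolutely_integrable_on {c..d}" using k by (rule nonnegative_absolutely_integrable_1)
  let ?k = "\<lambda>n x. min (k x) (real n)"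
  have kn: "?k n integrable_on {c..d}" for n
  proof -
    have "?k n absolutely_integrable_on {c..d}"
      by (rule absolutely_integrable_min_1[OF kabs]) (auto intro: absolutely_integrable_on_const)
    then show ?thesis using set_lebesgue_integral_eq_integral(1) by blast
  qed
  have "(\<lambda>n. integral {c..d} (?k n)) \<longlonglongrightarrow> integral {c..d} k"
  proof (rule dominated_convergence(2)[OF kn k(1)])
    fix x assume x: "x \<in> {c..d}"
    show "norm (?k n x) \<le> k x" for n using k(2)[OF x] by auto
    obtain n where "k x < real n" using reals_Archimedean2 by blast
    then have "eventually (\<lambda>n. ?k n x = k x) sequentially"
      by (intro eventually_sequentiallyI[of n]) auto
    then show "(\<lambda>n. ?k n x) \<longlonglongrightarrow> k x" by (rule tendsto_eventually)
  qed
  then obtain n where n: "\<bar>integral {c..d} (?k n) - integral {c..d} k\<bar> < e / 2"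
    using \<open>e > 0\<close> LIMSEQ_D[of _ _ "e / 2"] by (metis half_gt_zero order_refl real_norm_def)
  define \<delta> where "\<delta> = e / (2 * (real n + 1))"
  have "\<delta> > 0" using \<open>e > 0\<close> by (simp add: \<delta>_def)
  show "\<exists>\<delta>>0. \<forall>D. finite D \<and> (\<forall>(s, t)\<in>D. c \<le> s \<and> s \<le> t \<and> t \<le> d) \<and>
     disjoint_family_on (\<lambda>(s, t). {s<..<t}) D \<and> (\<Sum>(s, t)\<in>D. t - s) < \<delta> \<longrightarrow>
     (\<Sum>(s, t)\<in>D. cmod (f t - f s)) < e"
  proof (intro exI[of _ \<delta>] conjI allI impI \<open>\<delta> > 0\<close>)
    fix D assume *: "finite D \<and> (\<forall>(s, t)\<in>D. c \<le> s \<and> s \<le> t \<and> t \<le> d) \<and>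
     disjoint_family_on (\<lambda>(s, t). {s<..<t}) D \<and> (\<Sum>(s, t)\<in>D. t - s) < \<delta>"
    then have D: "finite D" "\<And>s t. (s, t) \<in> D \<Longrightarrow> c \<le> s \<and> s \<le> t \<and> t \<le> d" 
      "disjoint_family_on (\<lambda>(s, t). {s<..<t}) D" and len: "(\<Sum>(s, t)\<in>D. t - s) < \<delta>" by auto
    have "(\<Sum>(s, t)\<in>D. cmod (f t - f s)) \<le> (\<Sum>(s, t)\<in>D. integral {s..t} (\<lambda>x. k x - ?k n x) + real n * (t - s))"
    proof (rule sum_mono, clarify)
      fix s t assume "(s, t) \<in> D"
      then have st: "c \<le> s" "s \<le> t" "t \<le> d" using D(2) by auto
      have int: "k integrable_on {s..t}" "?k n integrable_on {s..t}"
        using st by (auto intro: integrable_subinterval_real[OF k(1)] integrable_subinterval_real[OF kn[of n]])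
      have "cmod (f t - f s) \<le> integral {s..t} k" by (rule le[OF st])
      also have "\<dots> = integral {s..t} (\<lambda>x. k x - ?k n x) + integral {s..t} (?k n)"
        using Henstock_Kurzweil_Integration.integral_diff[OF int] by simp
      also have "integral {s..t} (?k n) \<le> integral {s..t} (\<lambda>_. real n)"
        by (rule integral_le[OF int(2)]) auto
      also have "\<dots> = real n * (t - s)" using st by simp
      finally show "cmod (f t - f s) \<le> integral {s..t} (\<lambda>x. k x - ?k n x) + real n * (t - s)" by simp
    qed
    also have "\<dots> = (\<Sum>(s, t)\<in>D. integral {s..t} (\<lambda>x. k x - ?k n x)) + real n * (\<Sum>(s, t)\<in>D. t - s)"
      by (simp add: case_prod_unfold sum.distrib sum_distrib_left)
    also have "(\<Sum>(s, t)\<in>D. integral {s..t} (\<lambda>x. k x - ?k n x)) \<le> integral {c..d} (\<lambda>x. k x - ?k n x)"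
      by (rule sum_integrals_disjoint_le[OF _ _ D]) (use k(1) kn in \<open>auto intro: Henstock_Kurzweil_Integration.integrable_diff\<close>)
    also have "\<dots> = integral {c..d} k - integral {c..d} (?k n)"
      by (rule Henstock_Kurzweil_Integration.integral_diff[OF k(1) kn])
    also have "real n * (\<Sum>(s, t)\<in>D. t - s) \<le> real n * \<delta>" using len by (intro mult_left_mono) auto
    also have "real n * \<delta> < e / 2" using \<open>e > 0\<close> by (simp add: \<delta>_def field_simps)
    finally show "(\<Sum>(s, t)\<in>D. cmod (f t - f s)) < e" using n by linarith
  qed
qed

text \<open>The converse of the criterion, with the modulus of the density as the dominating function.\<close>

lemma AC_on_dominated:
  assumes "AC_on c d f" "c \<le> d"
  obtains k where "k integrable_on {c..d}" "\<And>x. 0 \<le> k x"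
    "\<And>s t. c \<le> s \<Longrightarrow> s \<le> t \<Longrightarrow> t \<le> d \<Longrightarrow> cmod (f t - f s) \<le> integral {s..t} k"
proof -
  obtain g where g: "g absolutely_integrable_on {c..d}" "\<forall>x\<in>{c..d}. f x = f c + integral {c..x} g"
    using AC_on_density[OF assms] by blast
  have gi: "g integrable_on {c..d}" "(\<lambda>x. cmod (g x)) integrable_on {c..d}"
    using g(1) by (auto simp: absolutely_integrable_on_def)
  show ?thesis
  proof (rule that[of "\<lambda>x. cmod (g x)"])
    fix s t assume st: "c \<le> s" "s \<le> t" "t \<le> d"
    have "cmod (f t - f s) = cmod (integral {s..t} g)"
      using integral_increment[of g c d f "f c", OF gi(1) bspec[OF g(2)] st] by simp
    also have "\<dots> \<le> integral {s..t} (\<lambda>x. cmod (g x))"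
      by (rule integral_norm_bound_integral) (use gi st in \<open>auto intro: integrable_subinterval_real\<close>)
    finally show "cmod (f t - f s) \<le> integral {s..t} (\<lambda>x. cmod (g x))" .
  qed (use gi in auto)
qed

lemma AC_on_integral:
  assumes "g absolutely_integrable_on {c..d}" and "\<And>x. x \<in> {c..d} \<Longrightarrow> f x = C + integral {c..x} g"
  shows "AC_on c d f"
proof (rule AC_onI_dominated)
  have gi: "g integrable_on {c..d}" "(\<lambda>x. cmod (g x)) integrable_on {c..d}"
    using assms(1) by (auto simp: absolutely_integrable_on_def)
  show "(\<lambda>x. cmod (g x)) integrable_on {c..d}" by (rule gi(2))
  fix s t assume st: "c \<le> s" "s \<le> t" "t \<le> d"
  have "cmod (f t - f s) = cmod (integral {s..t} g)"
    using integral_increment[of g c d f C, OF gi(1) assms(2) st] by simp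
  also have "\<dots> \<le> integral {s..t} (\<lambda>x. cmod (g x))"
    by (rule integral_norm_bound_integral) (use gi st in \<open>auto intro: integrable_subinterval_real\<close>)
  finally show "cmod (f t - f s) \<le> integral {s..t} (\<lambda>x. cmod (g x))" .
qed auto

lemma AC_on_continuous_on:
  assumes "AC_on c d f"
  shows "continuous_on {c..d} f"
proof (cases "c \<le> d")
  case True
  then obtain g where g: "g absolutely_integrable_on {c..d}" "\<forall>x\<in>{c..d}. f x = f c + integral {c..x} g"
    using AC_on_density[OF assms] by blast
  have "continuous_on {c..d} (\<lambda>x. f c + integral {c..x} g)"
    using g(1) by (intro continuous_intros indefinite_integral_continuous_1 set_lebesgue_integral_eq_integral(1))
  then show ?thesis by (subst continuous_on_cong[OF refl bspec[OF g(2)]])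
qed simp

text \<open>The fundamental theorem of calculus for absolutely continuous functions: the density is the derivative almost everywhere,
  by Lebesgue differentiation.\<close>

lemma
  assumes f: "AC_on c d f" and "c \<le> d"
  shows AC_on_has_vector_derivative: 
      "negligible {x\<in>{c..d}. \<not> (f has_vector_derivative vector_derivative f (at x)) (at x)}"
    and AC_on_absolutely_integrable: "(\<lambda>x. vector_derivative f (at x)) absolutely_integrable_on {c..d}"
    and AC_on_has_integral: "\<And>s t. c \<le> s \<Longrightarrow> s \<le> t \<Longrightarrow> t \<le> d \<Longrightarrow>
      ((\<lambda>x. vector_derivative f (at x)) has_integral (f t - f s)) {s..t}"
proof -
  let ?f' = "\<lambda>x. vector_derivative f (at x)"
  obtain g where g: "g absolutely_integrable_on {c..d}" "\<forall>x\<in>{c..d}. f x = f c + integral {c..x} g"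
    using AC_on_density[OF assms] by blast
  have gi: "g integrable_on {c..d}" by (rule set_lebesgue_integral_eq_integral(1)[OF g(1)])
  define N where "N = {x\<in>{c..d}. \<not> ((\<lambda>u. integral {c..u} g) has_vector_derivative g x) (at x within {c..d})} \<union> {c, d}"
  have N: "negligible N" unfolding N_def
    by (rule negligible_Un[OF lebesgue_differentiation[OF gi]]) simp
  have der: "(f has_vector_derivative g x) (at x)" if "x \<in> {c..d} - N" for x
  proof -
    have "x \<noteq> c" "x \<noteq> d" "c \<le> x" "x \<le> d" using that by (simp_all add: N_def)
    then have x: "x \<in> {c<..<d}" by simp
    have "((\<lambda>u. integral {c..u} g) has_vector_derivative g x) (at x within {c..d})"
      using that by (auto simp: N_def)
    from has_vector_derivative_add[OF has_vector_derivative_const[of "f c"] this]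
    have D: "((\<lambda>u. f c + integral {c..u} g) has_vector_derivative g x) (at x within {c..d})"
      unfolding add_0 .
    have "(f has_vector_derivative g x) (at x within {c..d})"
    proof (rule has_vector_derivative_transform[OF _ _ D])
      show "x \<in> {c..d}" using that by blast
      fix y assume "y \<in> {c..d}"
      then show "f y = f c + integral {c..y} g" by (rule bspec[OF g(2)])
    qed
    then have "(f has_vector_derivative g x) (at x within {c<..<d})"
      by (rule has_vector_derivative_within_subset) auto
    then show ?thesis unfolding at_within_open[OF x open_greaterThanLessThan] .
  qed
  have eq: "?f' x = g x" if "x \<in> {c..d} - N" for x
    by (rule vector_derivative_at[OF der[OF that]])
  show "negligible {x\<in>{c..d}. \<not> (f has_vector_derivative ?f' x) (at x)}"
  proof (rule negligible_subset[OF N], rule subsetI, rule ccontr)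
    fix x assume "x \<in> {x\<in>{c..d}. \<not> (f has_vector_derivative ?f' x) (at x)}" "x \<notin> N"
    then have x: "x \<in> {c..d} - N" and "\<not> (f has_vector_derivative ?f' x) (at x)" by blast+
    then show False unfolding eq[OF x] using der[OF x] by blast
  qed
  show "?f' absolutely_integrable_on {c..d}"
    by (rule absolutely_integrable_spike[OF g(1) N eq])
  fix s t assume st: "c \<le> s" "s \<le> t" "t \<le> d"
  have "(g has_integral (f t - f s)) {s..t}"
  proof -
    have "f t - f s = integral {s..t} g" 
      by (rule integral_increment[of g c d f "f c", OF gi bspec[OF g(2)] st])
    moreover have "g integrable_on {s..t}" by (rule integrable_subinterval_real[OF gi]) (use st in auto)
    ultimately show ?thesis by (simp only: integrable_integral)
  qed
  then show "(?f' has_integral (f t - f s)) {s..t}"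
  proof (rule has_integral_spike[OF N, rotated])
    fix x assume "x \<in> {s..t} - N"
    then show "?f' x = g x" using st by (intro eq) auto
  qed
qed

lemma AC_on_trivial: "\<not> c \<le> d \<Longrightarrow> AC_on c d f"
  unfolding AC_on_def
proof (intro allI impI exI[of _ 1] conjI)
  fix e :: real and D
  assume "\<not> c \<le> d" "e > 0" and D: "finite D \<and> (\<forall>(s, t)\<in>D. c \<le> s \<and> s \<le> t \<and> t \<le> d) \<and>
     disjoint_family_on (\<lambda>(s, t). {s<..<t}) D \<and> (\<Sum>(s, t)\<in>D. t - s) < 1"
  have "D = {}"
  proof (rule ccontr)
    assume "D \<noteq> {}"
    then obtain p where "p \<in> D" by blast
    with D have "c \<le> fst p \<and> fst p \<le> snd p \<and> snd p \<le> d" by (auto simp: case_prod_unfold)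
    with \<open>\<not> c \<le> d\<close> show False by linarith
  qed
  with \<open>e > 0\<close> show "(\<Sum>(s, t)\<in>D. cmod (f t - f s)) < e" by simp
qed simp

lemma AC_on_mult:
  assumes "AC_on c d f" "AC_on c d g"
  shows "AC_on c d (\<lambda>x. f x * g x)"
proof (cases "c \<le> d")
  case True
  obtain k where k: "k integrable_on {c..d}" "\<And>x. 0 \<le> k x"
    "\<And>s t. c \<le> s \<Longrightarrow> s \<le> t \<Longrightarrow> t \<le> d \<Longrightarrow> cmod (f t - f s) \<le> integral {s..t} k"
    using AC_on_dominated[OF assms(1) True] by blast
  obtain l where l: "l integrable_on {c..d}" "\<And>x. 0 \<le> l x"
    "\<And>s t. c \<le> s \<Longrightarrow> s \<le> t \<Longrightarrow> t \<le> d \<Longrightarrow> cmod (g t - g s) \<le> integral {s..t} l"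
    using AC_on_dominated[OF assms(2) True] by blast
  have "bounded (f ` {c..d})" "bounded (g ` {c..d})"
    using assms by (auto intro!: compact_imp_bounded compact_continuous_image AC_on_continuous_on)
  then obtain A B where AB: "\<And>x. x \<in> {c..d} \<Longrightarrow> cmod (f x) \<le> A" "\<And>x. x \<in> {c..d} \<Longrightarrow> cmod (g x) \<le> B"
    unfolding bounded_iff by blast
  have A0: "0 \<le> A" "0 \<le> B" 
    using AB(1)[of c] AB(2)[of c] True order_trans[OF norm_ge_zero] by auto
  show ?thesis
  proof (rule AC_onI_dominated)
    show "(\<lambda>x. A * l x + B * k x) integrable_on {c..d}"
      using k(1) l(1) by (intro integrable_add integrable_on_mult_right)
    show "0 \<le> A * l x + B * k x" for x using A0 k(2) l(2) by simp
    fix s t assume st: "c \<le> s" "s \<le> t" "t \<le> d"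
    have "f t * g t - f s * g s = f t * (g t - g s) + g s * (f t - f s)" by (simp add: algebra_simps)
    then have "cmod (f t * g t - f s * g s) \<le> cmod (f t) * cmod (g t - g s) + cmod (g s) * cmod (f t - f s)"
      by (metis norm_mult norm_triangle_ineq)
    also have "\<dots> \<le> A * integral {s..t} l + B * integral {s..t} k"
      using st AB A0 k(3) l(3) by (intro add_mono mult_mono) auto
    also have "\<dots> = integral {s..t} (\<lambda>x. A * l x + B * k x)"
    proof -
      have "l integrable_on {s..t}" "k integrable_on {s..t}" using k(1) l(1) st by (auto intro: integrable_subinterval_real)
      then have "((\<lambda>x. A * l x + B * k x) has_integral (A * integral {s..t} l + B * integral {s..t} k)) {s..t}"
        by (intro has_integral_add has_integral_mult_right integrable_integral)
      then show ?thesis by (simp add: integral_unique)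
    qed
    finally show "cmod (f t * g t - f s * g s) \<le> integral {s..t} (\<lambda>x. A * l x + B * k x)" .
  qed
qed (rule AC_on_trivial)

lemma AC_on_add:
  assumes "AC_on c d f" "AC_on c d g"
  shows "AC_on c d (\<lambda>x. f x + g x)"
proof (cases "c \<le> d")
  case True
  obtain k where k: "k integrable_on {c..d}" "\<And>x. 0 \<le> k x"
    "\<And>s t. c \<le> s \<Longrightarrow> s \<le> t \<Longrightarrow> t \<le> d \<Longrightarrow> cmod (f t - f s) \<le> integral {s..t} k"
    using AC_on_dominated[OF assms(1) True] by blast
  obtain l where l: "l integrable_on {c..d}" "\<And>x. 0 \<le> l x"
    "\<And>s t. c \<le> s \<Longrightarrow> s \<le> t \<Longrightarrow> t \<le> d \<Longrightarrow> cmod (g t - g s) \<le> integral {s..t} l"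
    using AC_on_dominated[OF assms(2) True] by blast
  show ?thesis
  proof (rule AC_onI_dominated)
    show "(\<lambda>x. k x + l x) integrable_on {c..d}" using k(1) l(1) by (intro integrable_add)
    show "0 \<le> k x + l x" for x using k(2) l(2) by simp
    fix s t assume st: "c \<le> s" "s \<le> t" "t \<le> d"
    have "cmod (f t + g t - (f s + g s)) \<le> cmod (f t - f s) + cmod (g t - g s)"
      by (metis add_diff_add norm_triangle_ineq)
    also have "\<dots> \<le> integral {s..t} k + integral {s..t} l" using k(3)[OF st] l(3)[OF st] by simp
    also have "\<dots> = integral {s..t} (\<lambda>x. k x + l x)"
      by (rule Henstock_Kurzweil_Integration.integral_add[symmetric]) (use k(1) l(1) st in \<open>auto intro: integrable_subinterval_real\<close>)
    finally show "cmod (f t + g t - (f s + g s)) \<le> integral {s..t} (\<lambda>x. k x + l x)" .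
  qed
qed (rule AC_on_trivial)

lemma AC_on_const: "AC_on c d (\<lambda>_. z)"
  by (rule AC_onI_dominated[of "\<lambda>_. 0"]) auto

lemma AC_on_sum: "(\<And>i. i \<in> A \<Longrightarrow> AC_on c d (f i)) \<Longrightarrow> AC_on c d (\<lambda>x. \<Sum>i\<in>A. f i x)"
  by (induction A rule: infinite_finite_induct) (auto intro: AC_on_const AC_on_add)

lemma AC_on_cnj: "AC_on c d f \<Longrightarrow> AC_on c d (\<lambda>x. cnj (f x))"
  unfolding AC_on_def complex_cnj_diff[symmetric] complex_mod_cnj .

section \<open>Complex Hilbert spaces\<close>

lemma cinner_scaleC_left: "cinner (c *C x) y = cnj c * cinner x y" for x y :: "'a::complex_inner"
  by (metis cinner_commute cinner_scaleC_right complex_cnj_mult)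

lemma cinner_add_left: "cinner (x + y) z = cinner x z + cinner y z" for x y :: "'a::complex_inner"
  by (metis cinner_commute cinner_add_right complex_cnj_add)

lemma scaleC_minus1: "(-1) *C x = - x" for x :: "'a::complex_inner"
  using scaleR_scaleC[of "-1" x] by simp

lemma scaleC_zero [simp]: "c *C 0 = 0" "0 *C x = 0" for x :: "'a::complex_inner"
  using scaleR_scaleC[of 0 x] scaleC_scaleC[of c 0 "0::'a"] scaleR_scaleC[of 0 "0::'a"] by simp_all

lemma cinner_zero [simp]: "cinner x 0 = 0" "cinner 0 x = 0" for x :: "'a::complex_inner"
  using cinner_scaleC_right[of x 0 "0::'a"] cinner_scaleC_left[of 0 "0::'a" x] by simp_all

lemma cinner_minus [simp]: "cinner x (- y) = - cinner x y" "cinner (- x) y = - cinner x y" for x :: "'a::complex_inner"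
  using cinner_scaleC_right[of x "-1" y] cinner_scaleC_left[of "-1" x y] by (simp_all add: scaleC_minus1)

lemma cinner_diff_right: "cinner x (y - z) = cinner x y - cinner x z" for x :: "'a::complex_inner"
  using cinner_add_right[of x y "- z"] by simp

lemma cinner_diff_left: "cinner (x - y) z = cinner x z - cinner y z" for x :: "'a::complex_inner"
  using cinner_add_left[of x "- y" z] by simp

lemma cinner_eq_0_commute: "cinner x y = 0 \<longleftrightarrow> cinner y x = 0" for x :: "'a::complex_inner"
  by (metis cinner_commute complex_cnj_zero)

lemma cinner_self: "cinner x x = complex_of_real ((norm x)\<^sup>2)" for x :: "'a::complex_inner"
proof (rule complex_eqI)
  show "Re (cinner x x) = Re (complex_of_real ((norm x)\<^sup>2))"
    using inner_eq_Re_cinner[of x x] by (simp add: power2_norm_eq_inner)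
  show "Im (cinner x x) = Im (complex_of_real ((norm x)\<^sup>2))"
    using cinner_commute[of x x] by (simp add: complex_eq_iff)
qed

lemma cinner_self_eq_0 [simp]: "cinner x x = 0 \<longleftrightarrow> x = 0" for x :: "'a::complex_inner"
  by (simp add: cinner_self)

lemma norm_scaleC [simp]: "norm (c *C x) = cmod c * norm x" for x :: "'a::complex_inner"
proof -
  have "cinner (c *C x) (c *C x) = (cnj c * c) * cinner x x"
    by (simp add: cinner_scaleC_left cinner_scaleC_right)
  also have "\<dots> = complex_of_real ((cmod c)\<^sup>2) * complex_of_real ((norm x)\<^sup>2)"
    by (metis cinner_self complex_norm_square mult.commute)
  finally have "complex_of_real ((norm (c *C x))\<^sup>2) = complex_of_real ((cmod c * norm x)\<^sup>2)"
    by (simp add: cinner_self power_mult_distrib)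
  then have "(norm (c *C x))\<^sup>2 = (cmod c * norm x)\<^sup>2" by (simp only: of_real_eq_iff)
  then show ?thesis by (simp add: power2_eq_iff_nonneg)
qed

text \<open>The Cauchy--Schwarz inequality for the complex inner product, from the real one after rotating the phase of one vector.\<close>

lemma cmod_cinner_le: "cmod (cinner x y) \<le> norm x * norm y" for x y :: "'a::complex_inner"
proof (cases "cinner x y = 0")
  case False
  define u where "u = cnj (cinner x y) / cmod (cinner x y)"
  have u: "cmod u = 1" using False by (simp add: u_def norm_divide)
  have "cinner x (u *C y) = complex_of_real (cmod (cinner x y))"
    using False complex_norm_square[of "cinner x y"]
    by (simp add: u_def cinner_scaleC_right mult.commute power2_eq_square divide_eq_eq)
  then have "cmod (cinner x y) = inner x (u *C y)" by (simp add: inner_eq_Re_cinner)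
  also have "\<dots> \<le> norm x * norm (u *C y)" by (rule norm_cauchy_schwarz)
  finally show ?thesis using u by simp
qed simp

lemma bounded_bilinear_cinner: "bounded_bilinear (cinner :: 'a::complex_inner \<Rightarrow> _)"
proof
  show "cinner (r *\<^sub>R x) y = r *\<^sub>R cinner x y" "cinner x (r *\<^sub>R y) = r *\<^sub>R cinner x y" for r and x y :: 'a
    by (simp_all add: scaleR_scaleC cinner_scaleC_left cinner_scaleC_right scaleR_conv_of_real)
  show "\<exists>K. \<forall>x y::'a. norm (cinner x y) \<le> norm x * norm y * K"
    using cmod_cinner_le by (intro exI[of _ 1]) auto
qed (simp_all add: cinner_add_left cinner_add_right)

lemmas tendsto_cinner [tendsto_intros] = bounded_bilinear.tendsto[OF bounded_bilinear_cinner]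

lemma tendsto_scaleC [tendsto_intros]:
  "(f \<longlongrightarrow> l) F \<Longrightarrow> ((\<lambda>x. c *C f x) \<longlongrightarrow> c *C l) F" for l :: "'a::complex_inner"
proof -
  have "bounded_linear (\<lambda>x::'a. c *C x)"
  proof
    show "c *C (r *\<^sub>R x) = r *\<^sub>R (c *C x)" for r and x :: 'a
      by (simp add: scaleR_scaleC scaleC_scaleC mult.commute)
    show "\<exists>K. \<forall>x::'a. norm (c *C x) \<le> norm x * K"
      by (intro exI[of _ "cmod c"]) (simp add: mult.commute)
  qed (rule scaleC_add_right)
  then show "(f \<longlongrightarrow> l) F \<Longrightarrow> ((\<lambda>x. c *C f x) \<longlongrightarrow> c *C l) F" by (rule bounded_linear.tendsto)
qed

lemma csubspaceI:
  assumes "0 \<in> V" "\<And>x y c. x \<in> V \<Longrightarrow> y \<in> V \<Longrightarrow> x + c *C y \<in> V"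
  shows "csubspace V"
  unfolding complex_vector.subspace_def
proof (intro conjI ballI allI assms(1))
  fix x y c assume "x \<in> V" "y \<in> V"
  then show "x + y \<in> V" using assms(2)[of x y 1] by (simp add: scaleC_one)
next
  fix c x assume "x \<in> V"
  then show "c *C x \<in> V" using assms(2)[of 0 x c] assms(1) by simp
qed

lemmas csubspace_0 = complex_vector.subspace_0
  and csubspace_add = complex_vector.subspace_add
  and csubspace_diff = complex_vector.subspace_diff
  and csubspace_scale = complex_vector.subspace_scale

definition orthocomp :: "'a::complex_inner set \<Rightarrow> 'a set" where
  "orthocomp V = {x. \<forall>v\<in>V. cinner v x = 0}"

lemma csubspace_orthocomp: "csubspace (orthocomp V)"
  by (rule csubspaceI) (auto simp: orthocomp_def cinner_add_right cinner_scaleC_right)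

lemma closed_orthocomp: "closed (orthocomp V)" for V :: "'a::complex_inner set"
proof -
  have "closed {x. cinner v x = 0}" for v :: 'a
  proof -
    have "continuous_on UNIV (\<lambda>x. cinner v x)"
      using bounded_bilinear.continuous_on[OF bounded_bilinear_cinner continuous_on_const[of UNIV v] continuous_on_id] by simp
    then show ?thesis using closed_Collect_eq[OF _ continuous_on_const[of UNIV 0]] by blast
  qed
  then have "closed (\<Inter>v\<in>V. {x. cinner v x = 0})" by blast
  moreover have "(\<Inter>v\<in>V. {x. cinner v x = 0}) = orthocomp V" by (auto simp: orthocomp_def)
  ultimately show ?thesis by simp
qed

lemma orthocomp_closure: "orthocomp (closure V) = orthocomp V" for V :: "'a::complex_inner set"
proof
  show "orthocomp V \<subseteq> orthocomp (closure V)"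
  proof
    fix x assume "x \<in> orthocomp V"
    then have "V \<subseteq> orthocomp {x}"
      by (auto simp: orthocomp_def cinner_eq_0_commute[of _ x])
    then have "closure V \<subseteq> orthocomp {x}" by (rule closure_minimal[OF _ closed_orthocomp])
    then show "x \<in> orthocomp (closure V)"
      by (auto simp: orthocomp_def cinner_eq_0_commute[of _ x])
  qed
  show "orthocomp (closure V) \<subseteq> orthocomp V"
    using closure_subset by (auto simp: orthocomp_def)
qed

text \<open>The projection theorem. A sequence in \<open>V\<close> that minimises the distance to \<open>x\<close> is Cauchy by the
  parallelogram law, and the difference between \<open>x\<close> and its limit is orthogonal to \<open>V\<close>.\<close>

lemma orthogonal_decomposition:
  fixes V :: "'a::{complex_inner, complete_space} set"
  assumes V: "csubspace V" "closed V"
  obtains v w where "v \<in> V" "w \<in> orthocomp V" "x = v + w"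
proof -
  define d where "d = (INF v\<in>V. (norm (x - v))\<^sup>2)"
  have V0: "0 \<in> V" by (rule csubspace_0[OF V(1)])
  have bdd: "bdd_below ((\<lambda>v. (norm (x - v))\<^sup>2) ` V)" by (rule bdd_belowI[of _ 0]) auto
  have d_le: "d \<le> (norm (x - v))\<^sup>2" if "v \<in> V" for v
    unfolding d_def by (rule cINF_lower[OF bdd that])
  have "\<exists>v\<in>V. (norm (x - v))\<^sup>2 < d + 1 / real (Suc n)" for n
  proof (rule ccontr)
    assume "\<not> ?thesis"
    then have "d + 1 / real (Suc n) \<le> d"
      unfolding d_def[symmetric] by (subst (2) d_def, intro cINF_greatest) (use V0 in \<open>auto simp: not_less\<close>)
    then show False by (simp del: of_nat_Suc)
  qed
  then obtain f where f: "\<And>n. f n \<in> V" "\<And>n. (norm (x - f n))\<^sup>2 < d + 1 / real (Suc n)" by metis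
  have par: "(norm (f m - f n))\<^sup>2 \<le> 2 * (1 / real (Suc m)) + 2 * (1 / real (Suc n))" for m n
  proof -
    have mid: "(1/2) *\<^sub>R (f m + f n) \<in> V"
      unfolding scaleR_scaleC by (intro csubspace_scale[OF V(1)] csubspace_add[OF V(1)] f)
    have "(norm (f m - f n))\<^sup>2 + (norm ((x - f m) + (x - f n)))\<^sup>2 = 2 * (norm (x - f m))\<^sup>2 + 2 * (norm (x - f n))\<^sup>2"
      by (simp add: power2_norm_eq_inner inner_simps inner_commute algebra_simps)
    moreover have "(x - f m) + (x - f n) = 2 *\<^sub>R (x - (1/2) *\<^sub>R (f m + f n))"
      by (simp add: algebra_simps scaleR_2)
    then have "(norm ((x - f m) + (x - f n)))\<^sup>2 = 4 * (norm (x - (1/2) *\<^sub>R (f m + f n)))\<^sup>2"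
      by (simp only: norm_scaleR power_mult_distrib) simp
    ultimately show ?thesis using d_le[OF mid] f(2)[of m] f(2)[of n] by linarith
  qed
  have "Cauchy f"
  proof (rule CauchyI)
    fix e :: real assume "e > 0"
    obtain N where N: "4 / e\<^sup>2 < real N" using reals_Archimedean2 by blast
    have "norm (f m - f n) < e" if "m \<ge> N" "n \<ge> N" for m n
    proof -
      have e2: "e\<^sup>2 > 0" using \<open>e > 0\<close> by simp
      have "4 < real N * e\<^sup>2" using N e2 by (simp add: field_simps)
      then have "1 / real (Suc k) < e\<^sup>2 / 4" if "k \<ge> N" for k
      proof -
        have "real N * e\<^sup>2 \<le> real (Suc k) * e\<^sup>2" using that e2 by (intro mult_right_mono) auto
        with \<open>4 < real N * e\<^sup>2\<close> show ?thesis by (simp add: field_simps)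
      qed
      from this[OF that(1)] this[OF that(2)] par[of m n] have "(norm (f m - f n))\<^sup>2 < e\<^sup>2" by linarith
      then show ?thesis using \<open>e > 0\<close> by (simp add: power2_less_imp_less)
    qed
    then show "\<exists>M. \<forall>m\<ge>M. \<forall>n\<ge>M. norm (f m - f n) < e" by blast
  qed
  then obtain v where v: "f \<longlonglongrightarrow> v" using Cauchy_convergent convergent_def by blast
  have vV: "v \<in> V" using closed_sequentially[OF V(2)] f(1) v by blast
  have "(\<lambda>n. (norm (x - f n))\<^sup>2) \<longlonglongrightarrow> (norm (x - v))\<^sup>2" by (intro tendsto_intros v)
  moreover have "(\<lambda>n. d + 1 / real (Suc n)) \<longlonglongrightarrow> d + 0"
    by (intro tendsto_intros LIMSEQ_Suc[OF lim_inverse_n'])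
  ultimately have "(norm (x - v))\<^sup>2 \<le> d + 0"
    by (rule LIMSEQ_le) (use f(2) less_imp_le in blast)
  then have min: "(norm (x - v))\<^sup>2 \<le> (norm (x - u))\<^sup>2" if "u \<in> V" for u
    using d_le[OF that] by linarith
  have "x - v \<in> orthocomp V"
    unfolding orthocomp_def
  proof (intro CollectI ballI)
    fix u assume u: "u \<in> V"
    show "cinner u (x - v) = 0"
    proof (cases "u = 0")
      case False
      define c where "c = cinner u (x - v) / cinner u u"
      have ne: "cinner u u \<noteq> 0" using False by simp
      have orth: "cinner u (x - v - c *C u) = 0"
        using ne by (simp add: cinner_diff_right cinner_scaleC_right c_def)
      then have "inner (c *C u) (x - v - c *C u) = 0"
        by (simp add: inner_eq_Re_cinner cinner_scaleC_left)
      then have orth': "inner (x - v - c *C u) (c *C u) = 0" by (metis inner_commute)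
      have "(norm (x - v))\<^sup>2 = (norm (x - v - c *C u + c *C u))\<^sup>2" by simp
      also have "\<dots> = (norm (x - v - c *C u))\<^sup>2 + (norm (c *C u))\<^sup>2"
        using orth' by (simp only: power2_norm_eq_inner inner_add_left inner_add_right inner_commute[of "c *C u" "x - v - c *C u"])
      finally have "(norm (c *C u))\<^sup>2 \<le> 0"
        using min[of "v + c *C u"] vV u V(1) by (simp add: csubspace_add csubspace_scale diff_diff_eq)
      then have "c = 0" using False by simp
      then show ?thesis using ne by (simp add: c_def)
    qed simp
  qed
  then show ?thesis using that[OF vV] by (metis add.commute diff_add_cancel)
qed

section \<open>Subspaces of finite codimension\<close>

definition lin_indep_seq :: "nat \<Rightarrow> (nat \<Rightarrow> 'a::complex_inner) \<Rightarrow> bool" where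
  "lin_indep_seq m e \<longleftrightarrow> (\<forall>c. (\<Sum>i<m. c i *C e i) = 0 \<longrightarrow> (\<forall>i<m. c i = 0))"

text \<open>Bases are finite sequences rather than sets, so that combinations are sums over an initial segment of the naturals
  and repeated vectors need no separate treatment.\<close>

definition is_basis :: "'a::complex_inner set \<Rightarrow> nat \<Rightarrow> (nat \<Rightarrow> 'a) \<Rightarrow> bool" where
  "is_basis V m e \<longleftrightarrow> (\<forall>i<m. e i \<in> V) \<and> lin_indep_seq m e \<and> (\<forall>x\<in>V. \<exists>c. x = (\<Sum>i<m. c i *C e i))"

lemma cinner_sum_right: "cinner x (\<Sum>i\<in>A. f i) = (\<Sum>i\<in>A. cinner x (f i))" for x :: "'a::complex_inner"
  by (induction A rule: infinite_finite_induct) (auto simp: cinner_add_right)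

lemma cinner_sum_left: "cinner (\<Sum>i\<in>A. f i) x = (\<Sum>i\<in>A. cinner (f i) x)" for x :: "'a::complex_inner"
  by (induction A rule: infinite_finite_induct) (auto simp: cinner_add_left)

lemma csubspace_sum: "csubspace V \<Longrightarrow> (\<And>i. i \<in> A \<Longrightarrow> f i \<in> V) \<Longrightarrow> (\<Sum>i\<in>A. c i *C f i) \<in> V"
  by (induction A rule: infinite_finite_induct) (auto simp: csubspace_0 csubspace_add csubspace_scale)

lemma lin_indep_seq_set:
  assumes "lin_indep_seq m e"
  shows "inj_on e {..<m}" "complex_vector.independent (e ` {..<m})"
proof -
  show inj: "inj_on e {..<m}"
  proof (rule inj_onI, rule ccontr)
    fix i j assume ij: "i \<in> {..<m}" "j \<in> {..<m}" "e i = e j" "i \<noteq> j"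
    define c where "c = (\<lambda>k. if k = i then 1 else if k = j then -1 else 0 :: complex)"
    have "(\<Sum>k<m. c k *C e k) = (\<Sum>k\<in>{i, j}. c k *C e k)"
      by (rule sum.mono_neutral_right) (use ij in \<open>auto simp: c_def\<close>)
    also have "\<dots> = 0" using ij by (simp add: c_def scaleC_one scaleC_minus1)
    finally have "c i = 0" using assms ij by (auto simp: lin_indep_seq_def)
    then show False by (simp add: c_def)
  qed
  show "complex_vector.independent (e ` {..<m})"
  proof (subst complex_vector.independent_explicit_finite_subsets, intro allI impI ballI)
    fix A u v assume A: "A \<subseteq> e ` {..<m}" "finite A" "(\<Sum>v\<in>A. u v *C v) = 0" "v \<in> A"
    define c where "c = (\<lambda>k. if e k \<in> A then u (e k) else 0)"
    have "(\<Sum>k<m. c k *C e k) = (\<Sum>k\<in>{k\<in>{..<m}. e k \<in> A}. u (e k) *C e k)"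
      by (rule sum.mono_neutral_cong_right) (auto simp: c_def)
    also have "\<dots> = (\<Sum>v\<in>A. u v *C v)"
      by (rule sum.reindex_cong[symmetric, where l = e]) (use A(1) inj in \<open>auto simp: inj_on_def\<close>)
    finally have "(\<Sum>k<m. c k *C e k) = 0" using A(3) by simp
    then have c0: "\<forall>i<m. c i = 0" using assms unfolding lin_indep_seq_def by blast
    obtain k where "k < m" "v = e k" using A(1,4) by auto
    then show "u v = 0" using c0[rule_format, of k] A(4) by (simp add: c_def)
  qed
qed

lemma is_basis_span:
  assumes "is_basis V m e"
  shows "V \<subseteq> cspan (e ` {..<m})"
proof
  fix x assume "x \<in> V"
  then obtain c where "x = (\<Sum>i<m. c i *C e i)" using assms by (auto simp: is_basis_def)
  moreover have "(\<Sum>i<m. c i *C e i) \<in> cspan (e ` {..<m})"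
    by (intro complex_vector.span_sum complex_vector.span_scale complex_vector.span_base imageI)
  ultimately show "x \<in> cspan (e ` {..<m})" by (simp only:)
qed

lemma ecdim_is_basis:
  assumes "is_basis V m e"
  shows "ecdim V = enat m"
proof -
  have ind: "lin_indep_seq m e" and sub: "e ` {..<m} \<subseteq> V" using assms by (auto simp: is_basis_def)
  have "cdim V = m"
    by (rule complex_vector.dim_unique[OF sub is_basis_span[OF assms] lin_indep_seq_set(2)[OF ind]])
       (simp add: card_image lin_indep_seq_set(1)[OF ind])
  moreover have "\<exists>B. finite B \<and> V \<subseteq> cspan B" using is_basis_span[OF assms] by blast
  ultimately show ?thesis by (simp add: ecdim_def)
qed

lemma lin_indep_seq_le:
  assumes "lin_indep_seq m f" "\<And>i. i < m \<Longrightarrow> f i \<in> V" "is_basis V d e"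
  shows "m \<le> d"
proof -
  have "f ` {..<m} \<subseteq> cspan (e ` {..<d})" using is_basis_span[OF assms(3)] assms(2) by auto
  from complex_vector.independent_span_bound[OF _ lin_indep_seq_set(2)[OF assms(1)] this]
  have "card (f ` {..<m}) \<le> card (e ` {..<d})" by simp
  also have "\<dots> \<le> d" using card_image_le[of "{..<d}" e] by simp
  finally show ?thesis by (simp add: card_image lin_indep_seq_set(1)[OF assms(1)])
qed

lemma exists_basis:
  assumes V: "csubspace V" and bd: "\<And>m f. lin_indep_seq m f \<Longrightarrow> (\<forall>i<m. f i \<in> V) \<Longrightarrow> m \<le> d"
  obtains m e where "m \<le> d" "is_basis V m e"
proof -
  let ?Q = "\<lambda>m. \<exists>f. lin_indep_seq m f \<and> (\<forall>i<m. f i \<in> V)"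
  have Q0: "?Q 0" by (auto simp: lin_indep_seq_def)
  define m where "m = (GREATEST m. ?Q m)"
  have Qm: "?Q m" unfolding m_def by (rule GreatestI_nat[where P = ?Q, OF Q0, of d]) (use bd in blast)
  have max: "k \<le> m" if "?Q k" for k unfolding m_def by (rule Greatest_le_nat[where P = ?Q, OF that, of d]) (use bd in blast)
  obtain e where e: "lin_indep_seq m e" "\<forall>i<m. e i \<in> V" using Qm by blast
  have "\<exists>c. x = (\<Sum>i<m. c i *C e i)" if x: "x \<in> V" for x
  proof -
    have "\<not> lin_indep_seq (Suc m) (e(m := x))"
    proof
      assume "lin_indep_seq (Suc m) (e(m := x))"
      moreover have "\<forall>i<Suc m. (e(m := x)) i \<in> V" using e(2) x by (auto simp: less_Suc_eq)
      ultimately have "?Q (Suc m)" by blast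
      from max[OF this] show False by simp
    qed
    then obtain c i where c: "(\<Sum>i<Suc m. c i *C (e(m := x)) i) = 0" "i < Suc m" "c i \<noteq> 0"
      by (auto simp: lin_indep_seq_def)
    have s: "(\<Sum>i<m. c i *C e i) + c m *C x = 0"
    proof -
      have "(\<Sum>i<m. c i *C (e(m := x)) i) = (\<Sum>i<m. c i *C e i)" by (rule sum.cong) auto
      then show ?thesis using c(1) by simp
    qed
    have "c m \<noteq> 0"
    proof
      assume "c m = 0"
      then have "(\<Sum>i<m. c i *C e i) = 0" using s by simp
      then have "\<forall>i<m. c i = 0" using e(1) unfolding lin_indep_seq_def by blast
      then show False using c(2,3) \<open>c m = 0\<close> by (auto simp: less_Suc_eq)
    qed
    have "c m *C x = - (\<Sum>i<m. c i *C e i)" using s by (metis add_eq_0_iff)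
    then have "(1 / c m) *C c m *C x = (1 / c m) *C ((-1) *C (\<Sum>i<m. c i *C e i))" by (simp only: scaleC_minus1)
    then have "x = (\<Sum>i<m. (- c i / c m) *C e i)"
      using \<open>c m \<noteq> 0\<close> by (simp add: scaleC_scaleC scaleC_one complex_vector.scale_sum_right)
    then show ?thesis by (rule exI[of _ "\<lambda>i. - c i / c m"])
  qed
  then have "is_basis V m e" using e by (auto simp: is_basis_def)
  moreover have "m \<le> d" using bd e by blast
  ultimately show ?thesis using that by blast
qed

text \<open>Independent functionals on \<open>D\<close> have a dual system inside \<open>D\<close>; this is what allows corrections to be
  made with vectors of a prescribed, merely dense subspace.\<close>

lemma dual_system:
  assumes D: "csubspace D" and w: "lin_indep_seq d w"
    and sep: "\<And>c. (\<forall>x\<in>D. cinner (\<Sum>i<d. c i *C w i) x = 0) \<Longrightarrow> (\<Sum>i<d. c i *C w i) = 0"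
  shows "\<exists>x. (\<forall>j<d. x j \<in> D) \<and> (\<forall>i<d. \<forall>j<d. cinner (w i) (x j) = (if i = j then 1 else 0))"
  using w sep
proof (induction d)
  case (Suc d)
  have w': "lin_indep_seq d w"
    unfolding lin_indep_seq_def
  proof (intro allI impI)
    fix c :: "nat \<Rightarrow> complex" and i assume "(\<Sum>i<d. c i *C w i) = 0" "i < d"
    then have "(\<Sum>i<Suc d. (c(d := 0)) i *C w i) = 0" by simp
    then show "c i = 0" using Suc.prems(1) \<open>i < d\<close> unfolding lin_indep_seq_def
      by (metis fun_upd_other less_Suc_eq less_irrefl)
  qed
  have sep': "(\<Sum>i<d. c i *C w i) = 0" if "\<forall>x\<in>D. cinner (\<Sum>i<d. c i *C w i) x = 0" for c
    using Suc.prems(2)[of "c(d := 0)"] that by simp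
  obtain x where x: "\<And>j. j < d \<Longrightarrow> x j \<in> D"
    "\<And>i j. i < d \<Longrightarrow> j < d \<Longrightarrow> cinner (w i) (x j) = (if i = j then 1 else 0)"
    using Suc.IH[OF w' sep'] by blast
  define c where "c = (\<lambda>j. if j = d then 1 else - cnj (cinner (w d) (x j)))"
  define w1 where "w1 = (\<Sum>j<Suc d. c j *C w j)"
  have w1: "w1 = w d + (\<Sum>j<d. c j *C w j)" by (simp add: w1_def c_def scaleC_one add.commute)
  have w1x: "cinner w1 (x j) = 0" if "j < d" for j
  proof -
    have "cinner w1 (x j) = cinner (w d) (x j) + (\<Sum>i<d. cnj (c i) * (if i = j then 1 else 0))"
      using x(2)[OF _ that] by (simp add: w1 cinner_add_left cinner_sum_left cinner_scaleC_left)
    also have "(\<Sum>i<d. cnj (c i) * (if i = j then 1 else 0)) = cnj (c j)"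
      using that by (subst sum.cong[OF refl, where h = "\<lambda>i. if i = j then cnj (c j) else 0"]) auto
    finally show ?thesis using that by (simp add: c_def)
  qed
  have "\<exists>y\<in>D. cinner w1 y \<noteq> 0"
  proof (rule ccontr)
    assume "\<not> ?thesis"
    then have "(\<Sum>j<Suc d. c j *C w j) = 0" using Suc.prems(2)[of c] unfolding w1_def[symmetric] by blast
    then have "c d = 0" using Suc.prems(1) by (auto simp: lin_indep_seq_def)
    then show False by (simp add: c_def)
  qed
  then obtain y where y: "y \<in> D" "cinner w1 y \<noteq> 0" by blast
  define y1 where "y1 = y - (\<Sum>j<d. cinner (w j) y *C x j)"
  have y1D: "y1 \<in> D" unfolding y1_def using y(1) x(1) D by (intro csubspace_diff csubspace_sum) auto
  have wy1: "cinner (w i) y1 = 0" if "i < d" for i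
  proof -
    have "cinner (w i) (\<Sum>j<d. cinner (w j) y *C x j) = (\<Sum>j<d. cinner (w j) y * (if i = j then 1 else 0))"
      using x(2)[OF that] by (simp add: cinner_sum_right cinner_scaleC_right)
    also have "\<dots> = cinner (w i) y"
      using that by (subst sum.cong[OF refl, where h = "\<lambda>j. if i = j then cinner (w i) y else 0"]) auto
    finally show ?thesis by (simp add: y1_def cinner_diff_right)
  qed
  have "cinner w1 y1 = cinner w1 y"
    using w1x by (simp add: y1_def cinner_diff_right cinner_sum_right cinner_scaleC_right)
  moreover have "cinner w1 y1 = cinner (w d) y1"
    using wy1 by (simp add: w1 cinner_add_left cinner_sum_left cinner_scaleC_left)
  ultimately have ne: "cinner (w d) y1 \<noteq> 0" using y(2) by simp
  define u where "u = (1 / cinner (w d) y1) *C y1"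
  have uD: "u \<in> D" using y1D D by (simp add: u_def csubspace_scale)
  have wdu: "cinner (w d) u = 1" using ne by (simp add: u_def cinner_scaleC_right)
  have wu: "cinner (w i) u = 0" if "i < d" for i using wy1[OF that] by (simp add: u_def cinner_scaleC_right)
  define x' where "x' = (\<lambda>j. if j = d then u else x j - cinner (w d) (x j) *C u)"
  show ?case
  proof (intro exI[of _ x'] conjI allI impI)
    fix j assume "j < Suc d"
    then show "x' j \<in> D" using x(1) uD D by (auto simp: x'_def less_Suc_eq csubspace_diff csubspace_scale)
  next
    fix i j assume "i < Suc d" "j < Suc d"
    then show "cinner (w i) (x' j) = (if i = j then 1 else 0)"
      using x(2) wu wdu by (auto simp: x'_def less_Suc_eq cinner_diff_right cinner_scaleC_right)
  qed
qed simp

text \<open>A dense subspace meets a subspace of finite codimension densely: subtracting the combination of a dual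
  system of vectors in \<open>D\<close> moves an approximating sequence into the orthogonal complement of \<open>W\<close>, and
  the correction tends to zero.\<close>

lemma dense_subspace_finite_codim:
  fixes H :: "'a::{complex_inner, complete_space} set"
  assumes H: "csubspace H" and D: "csubspace D" "D \<subseteq> H" "H \<subseteq> closure D"
    and w: "is_basis W d w" "W \<subseteq> H"
  shows "\<exists>x. (\<forall>j<d. x j \<in> D) \<and>
    (\<forall>y\<in>H. y - (\<Sum>j<d. cinner (w j) y *C x j) \<in> H \<inter> orthocomp W) \<and>
    H \<inter> orthocomp W \<subseteq> closure (D \<inter> orthocomp W) \<and>
    (\<forall>c. \<forall>i<d. cinner (w i) (\<Sum>j<d. c j *C x j) = c i)"
proof -
  have wi: "lin_indep_seq d w" and wW: "\<And>i. i < d \<Longrightarrow> w i \<in> W" using w by (auto simp: is_basis_def)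
  have sep: "(\<Sum>i<d. c i *C w i) = 0" if "\<forall>x\<in>D. cinner (\<Sum>i<d. c i *C w i) x = 0" for c
  proof -
    let ?s = "\<Sum>i<d. c i *C w i"
    have "?s \<in> H" using H wW w(2) by (intro csubspace_sum) auto
    then have "?s \<in> closure D" using D(3) by blast
    moreover have "D \<subseteq> orthocomp {?s}" using that by (auto simp: orthocomp_def)
    then have "closure D \<subseteq> orthocomp {?s}" by (rule closure_minimal[OF _ closed_orthocomp])
    ultimately show ?thesis by (auto simp: orthocomp_def)
  qed
  obtain x where x: "\<And>j. j < d \<Longrightarrow> x j \<in> D"
    "\<And>i j. i < d \<Longrightarrow> j < d \<Longrightarrow> cinner (w i) (x j) = (if i = j then 1 else 0)"
    using dual_system[OF D(1) wi sep] by blast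
  have dual: "cinner (w i) (\<Sum>j<d. c j *C x j) = c i" if "i < d" for c i
  proof -
    have "cinner (w i) (\<Sum>j<d. c j *C x j) = (\<Sum>j<d. c j * (if i = j then 1 else 0))"
      using x(2)[OF that] by (simp add: cinner_sum_right cinner_scaleC_right)
    also have "\<dots> = c i" using that by (subst sum.cong[OF refl, where h = "\<lambda>j. if i = j then c i else 0"]) auto
    finally show ?thesis .
  qed
  have perp: "y \<in> orthocomp W" if "\<And>i. i < d \<Longrightarrow> cinner (w i) y = 0" for y
    unfolding orthocomp_def
  proof (intro CollectI ballI)
    fix v assume "v \<in> W"
    then obtain c where "v = (\<Sum>i<d. c i *C w i)" using w by (auto simp: is_basis_def)
    then show "cinner v y = 0" using that by (simp add: cinner_sum_left cinner_scaleC_left)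
  qed
  define Q where "Q = (\<lambda>y. y - (\<Sum>j<d. cinner (w j) y *C x j))"
  have QW: "Q y \<in> orthocomp W" for y
    by (rule perp) (simp add: Q_def cinner_diff_right dual)
  have QD: "Q y \<in> D" if "y \<in> D" for y
    unfolding Q_def using that x(1) D(1) by (intro csubspace_diff csubspace_sum) auto
  have QH: "Q y \<in> H" if "y \<in> H" for y
    unfolding Q_def using that x(1) D(2) H by (intro csubspace_diff csubspace_sum) auto
  show ?thesis
  proof (intro exI[of _ x] conjI allI impI ballI)
    show "y - (\<Sum>j<d. cinner (w j) y *C x j) \<in> H \<inter> orthocomp W" if "y \<in> H" for y
      using QW[of y] QH[OF that] by (simp only: Q_def Int_iff)
    show "H \<inter> orthocomp W \<subseteq> closure (D \<inter> orthocomp W)"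
    proof
      fix y assume y: "y \<in> H \<inter> orthocomp W"
      then have "y \<in> closure D" using D(3) by blast
      then obtain s where s: "\<And>n. s n \<in> D" "s \<longlonglongrightarrow> y" unfolding closure_sequential by blast
      have "bounded_linear (\<lambda>a::complex. a *C x j)" for j
      proof
        show "(r *\<^sub>R a) *C x j = r *\<^sub>R (a *C x j)" for r a
          by (simp add: scaleR_scaleC scaleC_scaleC scaleR_conv_of_real)
        show "\<exists>K. \<forall>a. norm (a *C x j) \<le> norm a * K" by (intro exI[of _ "norm (x j)"]) simp
      qed (rule scaleC_add_left)
      note lim = bounded_linear.tendsto[OF this]
      have "(\<lambda>n. Q (s n)) \<longlonglongrightarrow> Q y"
        unfolding Q_def by (intro tendsto_intros s(2) lim)
      moreover have "Q y = y"
        using y wW by (auto simp: Q_def orthocomp_def intro!: sum.neutral)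
      ultimately show "y \<in> closure (D \<inter> orthocomp W)"
        unfolding closure_sequential using QD[OF s(1)] QW by (intro exI[of _ "\<lambda>n. Q (s n)"]) auto
    qed
  qed (use x(1) dual in auto)
qed

text \<open>If neither of two closed subspaces contains a nonzero vector orthogonal to the other, the projections between
  their orthogonal complements are injective in both directions, hence the complements have the same dimension.\<close>

lemma basis_lengths_eq:
  fixes R R' :: "'a::{complex_inner, complete_space} set"
  assumes H: "csubspace H" "closed H" and R: "csubspace R" "closed R" "R \<subseteq> H"
    and R': "csubspace R'" "closed R'" "R' \<subseteq> H"
    and tr: "\<And>v. v \<in> R \<Longrightarrow> v \<in> orthocomp R' \<Longrightarrow> v = 0" "\<And>v. v \<in> R' \<Longrightarrow> v \<in> orthocomp R \<Longrightarrow> v = 0"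
    and e: "is_basis (H \<inter> orthocomp R) d e"
  shows "\<exists>e'. is_basis (H \<inter> orthocomp R') d e'"
proof -
  have le: "m \<le> k"
    if A: "csubspace A" "closed A" "A \<subseteq> H" and tr: "\<And>v. v \<in> A \<Longrightarrow> v \<in> orthocomp B \<Longrightarrow> v = 0"
      and b: "is_basis (H \<inter> orthocomp A) k b" and f: "lin_indep_seq m f" "\<And>i. i < m \<Longrightarrow> f i \<in> H \<inter> orthocomp B"
    for A B :: "'a set" and k b and m :: nat and f
  proof -
    let ?W = "H \<inter> orthocomp A"
    have "\<exists>p. p \<in> ?W \<and> x - p \<in> A" if "x \<in> H" for x
    proof -
      obtain v w where vw: "v \<in> A" "w \<in> orthocomp A" "x = v + w"
        using orthogonal_decomposition[OF A(1,2)] by blast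
      then have "w = x - v" by simp
      then have "w \<in> H" using that A(3) vw(1) H(1) by (auto intro: csubspace_diff)
      with vw show ?thesis by (intro exI[of _ w]) auto
    qed
    then obtain P where P: "\<And>x. x \<in> H \<Longrightarrow> P x \<in> ?W \<and> x - P x \<in> A" by metis
    have "lin_indep_seq m (\<lambda>i. P (f i))"
      unfolding lin_indep_seq_def
    proof (intro allI impI)
      fix c i assume c: "(\<Sum>i<m. c i *C P (f i)) = 0" and i: "i < m"
      have "(\<Sum>i<m. c i *C f i) = (\<Sum>i<m. c i *C (f i - P (f i))) + (\<Sum>i<m. c i *C P (f i))"
        unfolding sum.distrib[symmetric] complex_vector.scale_right_distrib[symmetric] by simp
      then have "(\<Sum>i<m. c i *C f i) = (\<Sum>i<m. c i *C (f i - P (f i)))" using c by simp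
      moreover have "(\<Sum>i<m. c i *C (f i - P (f i))) \<in> A"
        using P f(2) A(1) by (intro csubspace_sum) auto
      moreover have "(\<Sum>i<m. c i *C f i) \<in> orthocomp B"
        using f(2) by (intro csubspace_sum csubspace_orthocomp) auto
      ultimately have "(\<Sum>i<m. c i *C f i) = 0" using tr by metis
      then show "c i = 0" using f(1) i by (auto simp: lin_indep_seq_def)
    qed
    then show ?thesis by (rule lin_indep_seq_le[OF _ _ b]) (use P f(2) in auto)
  qed
  have sub: "csubspace (H \<inter> orthocomp R')" by (intro complex_vector.subspace_inter H csubspace_orthocomp)
  obtain k e' where k: "k \<le> d" and e': "is_basis (H \<inter> orthocomp R') k e'"
    using exists_basis[OF sub, of d] le[OF R tr(1) e] by (metis (no_types, lifting))
  have "d \<le> k"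
    by (rule le[OF R' tr(2) e']) (use e in \<open>auto simp: is_basis_def\<close>)
  then show ?thesis using k e' by auto
qed

section \<open>Codimension of the range along the spectral parameter\<close>

text \<open>The relation \<open>S - z\<close>. Operators are treated as linear relations, which have ranges, compositions and closures without
  any side condition on domains.\<close>

definition shift :: "('a::complex_inner \<times> 'a) set \<Rightarrow> complex \<Rightarrow> ('a \<times> 'a) set" where
  "shift S z = (\<lambda>(f, g). (f, g - z *C f)) ` S"

lemma mem_shift: "(f, h) \<in> shift S z \<longleftrightarrow> (f, h + z *C f) \<in> S"
proof
  assume "(f, h + z *C f) \<in> S"
  then have "(\<lambda>(f, g). (f, g - z *C f)) (f, h + z *C f) \<in> shift S z" unfolding shift_def by (rule imageI)
  then show "(f, h) \<in> shift S z" by simp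
qed (auto simp: shift_def)

definition linrel :: "'a::complex_inner set \<Rightarrow> ('a \<times> 'a) set \<Rightarrow> bool" where
  "linrel H T \<longleftrightarrow> T \<subseteq> H \<times> H \<and> (0, 0) \<in> T \<and>
     (\<forall>f f' g g' c. (f, f') \<in> T \<longrightarrow> (g, g') \<in> T \<longrightarrow> (f + c *C g, f' + c *C g') \<in> T)"

definition bounded_below :: "real \<Rightarrow> ('a::complex_inner \<times> 'a) set \<Rightarrow> bool" where
  "bounded_below C T \<longleftrightarrow> (\<forall>(f, g)\<in>T. norm f \<le> C * norm g)"

lemma linrel_diff: "linrel H T \<Longrightarrow> (f, f') \<in> T \<Longrightarrow> (g, g') \<in> T \<Longrightarrow> (f - g, f' - g') \<in> T"
  unfolding linrel_def by (metis scaleC_minus1 uminus_add_conv_diff add.commute)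

lemma linrel_sum: 
  assumes T: "linrel H T" and "\<And>i. i \<in> A \<Longrightarrow> (f i, g i) \<in> T"
  shows "((\<Sum>i\<in>A. c i *C f i), (\<Sum>i\<in>A. c i *C g i)) \<in> T"
  using assms(2)
proof (induction A rule: infinite_finite_induct)
  case (insert i A)
  have "((\<Sum>i\<in>A. c i *C f i) + c i *C f i, (\<Sum>i\<in>A. c i *C g i) + c i *C g i) \<in> T"
    using T insert unfolding linrel_def by blast
  then show ?case using insert by (simp add: add.commute)
qed (use T in \<open>auto simp: linrel_def\<close>)

lemma csubspace_Domain: "linrel H T \<Longrightarrow> csubspace (Domain T)"
  unfolding linrel_def by (rule csubspaceI) blast+

lemma csubspace_Range: "linrel H T \<Longrightarrow> csubspace (Range T)"
  unfolding linrel_def by (rule csubspaceI) blast+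

lemma linrel_shift:
  assumes "linrel H T" "csubspace H" shows "linrel H (shift T z)"
  unfolding linrel_def
proof (intro conjI allI impI)
  show "shift T z \<subseteq> H \<times> H"
    using assms by (auto simp: shift_def linrel_def intro!: csubspace_diff csubspace_scale)
  show "(0, 0) \<in> shift T z" using assms(1) by (simp add: mem_shift linrel_def)
  fix f f' g g' c assume "(f, f') \<in> shift T z" "(g, g') \<in> shift T z"
  then have "(f + c *C g, (f' + z *C f) + c *C (g' + z *C g)) \<in> T"
    using assms(1) by (simp add: mem_shift linrel_def)
  then show "(f + c *C g, f' + c *C g') \<in> shift T z"
    by (simp add: mem_shift scaleC_add_right scaleC_scaleC mult.commute add_ac)
qed

lemma closed_shift:
  fixes T :: "('a::complex_inner \<times> 'a) set"
  assumes "closed T" shows "closed (shift T z)"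
  unfolding closed_sequential_limits
proof (intro allI impI, elim conjE)
  fix x l assume x: "\<forall>n. x n \<in> shift T z" "x \<longlonglongrightarrow> l"
  have in_T: "(fst (x n), snd (x n) + z *C fst (x n)) \<in> T" for n
    using x(1)[rule_format, of n] mem_shift[of "fst (x n)" "snd (x n)" T z] by simp
  have lim: "(\<lambda>n. (fst (x n), snd (x n) + z *C fst (x n))) \<longlonglongrightarrow> (fst l, snd l + z *C fst l)"
    by (intro tendsto_intros x(2))
  have "(fst l, snd l + z *C fst l) \<in> T" by (rule closed_sequentially[OF assms in_T lim])
  then show "l \<in> shift T z" using mem_shift[of "fst l" "snd l" T z] by simp
qed

lemma shift_shift: "shift (shift T z) w = shift T (z + w)"
  by (auto simp: mem_shift set_eq_iff scaleC_add_left add_ac)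

lemma Domain_shift [simp]: "Domain (shift T z) = Domain T"
  by (force simp: shift_def)

lemma bounded_below_Cauchy:
  assumes T: "linrel H T" "bounded_below C T" and fg: "\<And>n. (f n, g n) \<in> T" and g: "Cauchy g"
  shows "Cauchy f"
proof (rule CauchyI)
  fix e :: real assume "e > 0"
  define K where "K = \<bar>C\<bar> + 1"
  have "K > 0" by (simp add: K_def)
  then obtain N where N: "\<And>m n. m \<ge> N \<Longrightarrow> n \<ge> N \<Longrightarrow> norm (g m - g n) < e / K"
    using CauchyD[OF g, of "e / K"] \<open>e > 0\<close> by auto
  have "norm (f m - f n) < e" if "m \<ge> N" "n \<ge> N" for m n
  proof -
    have "norm (f m - f n) \<le> C * norm (g m - g n)"
      using linrel_diff[OF T(1) fg fg, of m n] T(2) by (auto simp: bounded_below_def)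
    also have "\<dots> \<le> K * norm (g m - g n)" by (intro mult_right_mono) (auto simp: K_def)
    also have "\<dots> < K * (e / K)" using N[OF that] \<open>K > 0\<close> by (intro mult_strict_left_mono)
    finally show ?thesis using \<open>K > 0\<close> by simp
  qed
  then show "\<exists>M. \<forall>m\<ge>M. \<forall>n\<ge>M. norm (f m - f n) < e" by blast
qed

text \<open>Preimages of a convergent sequence form a Cauchy sequence because of the lower bound, so the limit has a preimage.\<close>

lemma closed_Range:
  fixes T :: "('a::{complex_inner, complete_space} \<times> 'a) set"
  assumes T: "linrel H T" "bounded_below C T" "closed T"
  shows "closed (Range T)"
  unfolding closed_sequential_limits
proof (intro allI impI, elim conjE)
  fix g l assume g: "\<forall>n. g n \<in> Range T" "g \<longlonglongrightarrow> l"
  have "\<forall>n. \<exists>f. (f, g n) \<in> T" using g(1) by blast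
  then obtain f where f: "\<And>n. (f n, g n) \<in> T" by metis
  have "Cauchy f" by (rule bounded_below_Cauchy[OF T(1,2) f LIMSEQ_imp_Cauchy[OF g(2)]])
  then obtain k where "f \<longlonglongrightarrow> k" using Cauchy_convergent convergent_def by blast
  then have "(\<lambda>n. (f n, g n)) \<longlonglongrightarrow> (k, l)" using g(2) by (intro tendsto_Pair)
  then have "(k, l) \<in> T" by (rule closed_sequentially[OF T(3) f])
  then show "l \<in> Range T" by blast
qed

text \<open>The codimension of the range is measured by the dimension of its orthogonal complement, which is the eigenspace of the adjoint.\<close>

definition has_defect :: "'a::complex_inner set \<Rightarrow> nat \<Rightarrow> ('a \<times> 'a) set \<Rightarrow> bool" where
  "has_defect H d T \<longleftrightarrow> (\<exists>e. is_basis (H \<inter> orthocomp (Range T)) d e)"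

text \<open>Stability of the codimension. If \<open>v = (S - z) f\<close> were orthogonal to the range of \<open>S - w\<close>, then
  \<open>v\<close> would be orthogonal to \<open>v + (z - w) f\<close>, and the lower bound makes the second summand strictly shorter than \<open>v\<close>.\<close>

lemma has_defect_perturb:
  fixes H :: "'a::{complex_inner, complete_space} set"
  assumes H: "csubspace H" "closed H" and S: "linrel H S" "closed S"
    and bz: "bounded_below C (shift S z)" and bw: "bounded_below C (shift S w)"
    and C: "C * cmod (w - z) < 1" and d: "has_defect H d (shift S z)"
  shows "has_defect H d (shift S w)"
proof -
  note lz = linrel_shift[OF S(1) H(1), of z] and lw = linrel_shift[OF S(1) H(1), of w]
  have tr: "v = 0" if b: "bounded_below C (shift S z)" and C: "C * cmod (w - z) < 1"
    and v: "v \<in> Range (shift S z)" "v \<in> orthocomp (Range (shift S w))" for v z w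
  proof (rule ccontr)
    assume "v \<noteq> 0"
    obtain f where f: "(f, v) \<in> shift S z" using v(1) by blast
    then have "(f, v + (z - w) *C f) \<in> shift S w"
      by (simp add: mem_shift scaleC_add_left[symmetric] add.assoc)
    then have "cinner (v + (z - w) *C f) v = 0" using v(2) by (auto simp: orthocomp_def)
    then have "cinner v v + cnj (z - w) * cinner f v = 0" by (simp only: cinner_add_left cinner_scaleC_left)
    then have "cnj (z - w) * cinner f v = - complex_of_real ((norm v)\<^sup>2)"
      by (simp only: cinner_self add_eq_0_iff)
    then have "cmod (cnj (z - w) * cinner f v) = cmod (complex_of_real ((norm v)\<^sup>2))"
      by (simp only: norm_minus_cancel)
    then have "(norm v)\<^sup>2 = cmod (cnj (z - w)) * cmod (cinner f v)"
      by (simp only: norm_mult norm_of_real) simp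
    also have "cmod (cnj (z - w)) = cmod (w - z)" by (metis complex_mod_cnj norm_minus_commute)
    finally have "(norm v)\<^sup>2 = cmod (w - z) * cmod (cinner f v)" .
    also have "\<dots> \<le> cmod (w - z) * (norm f * norm v)" by (intro mult_left_mono cmod_cinner_le) simp
    also have "\<dots> \<le> cmod (w - z) * (C * norm v * norm v)"
      using b f by (intro mult_left_mono mult_right_mono) (auto simp: bounded_below_def)
    also have "\<dots> = (C * cmod (w - z)) * (norm v)\<^sup>2" by (simp add: power2_eq_square)
    also have "\<dots> < 1 * (norm v)\<^sup>2" using C \<open>v \<noteq> 0\<close> by (intro mult_strict_right_mono) auto
    finally show False by simp
  qed
  have sub: "Range (shift S z) \<subseteq> H" "Range (shift S w) \<subseteq> H" using lz lw by (auto simp: linrel_def)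
  have cl: "closed (Range (shift S z))" "closed (Range (shift S w))"
    using closed_Range[OF lz bz] closed_Range[OF lw bw] closed_shift[OF S(2)] by auto
  obtain e where e: "is_basis (H \<inter> orthocomp (Range (shift S z))) d e" using d by (auto simp: has_defect_def)
  show ?thesis
    unfolding has_defect_def
  proof (rule basis_lengths_eq[OF H csubspace_Range[OF lz] cl(1) sub(1) csubspace_Range[OF lw] cl(2) sub(2) _ _ e])
    show "v = 0" if "v \<in> Range (shift S z)" "v \<in> orthocomp (Range (shift S w))" for v
      by (rule tr[OF bz C that])
    show "v = 0" if "v \<in> Range (shift S w)" "v \<in> orthocomp (Range (shift S z))" for v
      by (rule tr[OF bw _ that]) (use C in \<open>simp add: norm_minus_commute\<close>)
  qed
qed

lemma bounded_below_mono: "bounded_below C T \<Longrightarrow> C \<le> D \<Longrightarrow> bounded_below D T"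
  unfolding bounded_below_def by (fastforce intro: order_trans mult_right_mono)

text \<open>The quadratic form of a symmetric relation is real, so the imaginary part of the form of \<open>S - z\<close> is \<open>-Im z\<close> times the squared norm.\<close>

lemma bounded_below_symmetric:
  assumes S: "\<And>f f' g g'. (f, f') \<in> S \<Longrightarrow> (g, g') \<in> S \<Longrightarrow> cinner f' g = cinner f g'" and z: "Im z \<noteq> 0"
  shows "bounded_below (1 / \<bar>Im z\<bar>) (shift S z)"
  unfolding bounded_below_def
proof clarify
  fix f h assume "(f, h) \<in> shift S z"
  then have fh: "(f, h + z *C f) \<in> S" by (simp add: mem_shift)
  have "cinner (h + z *C f) f = cinner f (h + z *C f)" by (rule S[OF fh fh])
  then have "cinner h f + cnj z * complex_of_real ((norm f)\<^sup>2) = cnj (cinner h f) + z * complex_of_real ((norm f)\<^sup>2)"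
    by (simp add: cinner_add_left cinner_add_right cinner_scaleC_left cinner_scaleC_right cinner_self flip: cinner_commute)
  then have "Im (cinner h f + cnj z * complex_of_real ((norm f)\<^sup>2)) = Im (cnj (cinner h f) + z * complex_of_real ((norm f)\<^sup>2))"
    by (rule arg_cong)
  then have "Im (cinner h f) = Im z * (norm f)\<^sup>2" by simp
  then have "\<bar>Im z\<bar> * (norm f)\<^sup>2 = \<bar>Im (cinner h f)\<bar>" by (simp add: abs_mult)
  also have "\<dots> \<le> norm h * norm f" using abs_Im_le_cmod cmod_cinner_le order_trans by blast
  finally have "norm f * (\<bar>Im z\<bar> * norm f) \<le> norm f * norm h" by (simp add: power2_eq_square mult_ac)
  then have "\<bar>Im z\<bar> * norm f \<le> norm h \<or> f = 0" by (cases "f = 0") simp_all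
  then show "norm f \<le> 1 / \<bar>Im z\<bar> * norm h" using z by (auto simp: field_simps)
qed

text \<open>The codimension is locally constant, hence constant on a connected half plane. The starting point may lie on the boundary line,
  where symmetry gives no lower bound; there the bound is a hypothesis, and one perturbation step leads into the half plane.\<close>

lemma has_defect_half_plane:
  fixes H :: "'a::{complex_inner, complete_space} set"
  assumes H: "csubspace H" "closed H" and S: "linrel H S" "closed S"
    and sym: "\<And>f f' g g'. (f, f') \<in> S \<Longrightarrow> (g, g') \<in> S \<Longrightarrow> cinner f' g = cinner f g'"
    and s: "s = 1 \<or> s = -1" and z0: "s * Im z0 \<ge> 0" "bounded_below C (shift S z0)" "has_defect H d (shift S z0)"
    and z: "s * Im z > 0"
  shows "has_defect H d (shift S z)"
proof -
  let ?U = "{z. s * Im z > 0}"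
  have "?U = {z. inner (complex_of_real s * \<i>) z > 0}" by (auto simp: inner_complex_def)
  then have "convex ?U" by (simp add: convex_halfspace_gt)
  then have conn: "connected ?U" by (rule convex_connected)
  have "open ?U" using s by (auto intro!: open_Collect_less continuous_intros)
  have loc: "has_defect H d (shift S w')" if w: "w \<in> ?U" and d: "has_defect H d (shift S w)" "cmod (w' - w) < \<bar>Im w\<bar> / 2" for w w'
  (* Within half the distance to the real axis one lower bound serves both points. *)
  proof (rule has_defect_perturb[OF H S _ _ _ d(1), of "2 / \<bar>Im w\<bar>"])
    have nz: "Im w \<noteq> 0" using w by auto
    have "\<bar>Im w' - Im w\<bar> \<le> cmod (w' - w)" using abs_Im_le_cmod[of "w' - w"] by simp
    then have ge: "\<bar>Im w'\<bar> \<ge> \<bar>Im w\<bar> / 2" "Im w' \<noteq> 0" using d(2) nz by linarith+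
    show "bounded_below (2 / \<bar>Im w\<bar>) (shift S w)"
      by (rule bounded_below_mono[OF bounded_below_symmetric[OF sym nz]]) (auto intro: divide_right_mono)
    show "bounded_below (2 / \<bar>Im w\<bar>) (shift S w')"
      by (rule bounded_below_mono[OF bounded_below_symmetric[OF sym ge(2)]])
         (use ge nz in \<open>auto simp: field_simps\<close>)
    show "2 / \<bar>Im w\<bar> * cmod (w' - w) < 1" using d(2) nz by (simp add: field_simps)
  qed
  have const: "has_defect H d (shift S z)" if w: "w \<in> ?U" "has_defect H d (shift S w)" for w
  proof -
    let ?Q = "\<lambda>z. has_defect H d (shift S z)"
    let ?A = "{z\<in>?U. ?Q z}" and ?B = "{z\<in>?U. \<not> ?Q z}"
    have nbh: "\<exists>e>0. \<forall>y\<in>ball x e. y \<in> ?U \<and> (?Q x \<longleftrightarrow> ?Q y)" if x: "x \<in> ?U" for x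
    proof -
      obtain e where e: "e > 0" "ball x e \<subseteq> ?U" using \<open>open ?U\<close> x open_contains_ball by blast
      have pos: "\<bar>Im x\<bar> > 0" using x by auto
      have "y \<in> ?U \<and> (?Q x \<longleftrightarrow> ?Q y)" if y: "y \<in> ball x (min e (\<bar>Im x\<bar> / 4))" for y
      proof -
        have yU: "y \<in> ?U" using y e(2) by auto
        have dy: "cmod (y - x) < \<bar>Im x\<bar> / 4" using y by (simp add: dist_norm norm_minus_commute)
        then have "\<bar>Im y\<bar> \<ge> 3 / 4 * \<bar>Im x\<bar>" using abs_Im_le_cmod[of "y - x"] by simp
        then have "cmod (x - y) < \<bar>Im y\<bar> / 2" using dy pos by (simp add: norm_minus_commute)
        moreover have "cmod (y - x) < \<bar>Im x\<bar> / 2" using dy pos by simp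
        ultimately show ?thesis using loc[OF x, of y] loc[OF yU, of x] yU by blast
      qed
      then show ?thesis using e(1) pos by (intro exI[of _ "min e (\<bar>Im x\<bar> / 4)"]) auto
    qed
    have "open ?A" unfolding open_contains_ball using nbh by blast
    moreover have "open ?B" unfolding open_contains_ball using nbh by blast
    moreover have "?A \<inter> ?B \<inter> ?U = {}" "?U \<subseteq> ?A \<union> ?B" by auto
    ultimately have "?A \<inter> ?U = {} \<or> ?B \<inter> ?U = {}" using conn unfolding connected_def by blast
    then show ?thesis using w z by blast
  qed
  define K where "K = 2 * \<bar>C\<bar> + 1"
  have K: "K > 0" by (simp add: K_def)
  define w where "w = z0 + complex_of_real (s / (2 * K)) * \<i>"
  have dist: "cmod (w - z0) = 1 / (2 * K)" using s K by (auto simp: w_def norm_mult norm_divide)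
  have wU: "w \<in> ?U"
  proof -
    have "s * Im w = s * Im z0 + (s * s) / (2 * K)" by (simp add: w_def algebra_simps)
    moreover have "s * s = 1" using s by auto
    ultimately show ?thesis using z0(1) K by (simp add: add_nonneg_pos)
  qed
  have "bounded_below K (shift S w)"
    unfolding bounded_below_def
  proof clarify
    fix f h assume "(f, h) \<in> shift S w"
    then have "(f, h + (w - z0) *C f) \<in> shift S z0"
      by (simp add: mem_shift scaleC_add_left[symmetric] add.assoc)
    then have "norm f \<le> C * norm (h + (w - z0) *C f)" using z0(2) by (auto simp: bounded_below_def)
    also have "\<dots> \<le> (K / 2) * (norm h + norm ((w - z0) *C f))"
      by (intro mult_mono norm_triangle_ineq) (auto simp: K_def)
    also have "norm ((w - z0) *C f) = norm f / (2 * K)" by (simp only: norm_scaleC dist) simp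
    also have "(K / 2) * (norm h + norm f / (2 * K)) = (K / 2) * norm h + norm f / 4"
      using K by (simp add: field_simps)
    finally have "norm f \<le> (K / 2) * norm h + norm f / 4" .
    moreover have "0 \<le> K * norm h" using K by simp
    ultimately show "norm f \<le> K * norm h" by simp
  qed
  moreover have "bounded_below K (shift S z0)" by (rule bounded_below_mono[OF z0(2)]) (simp add: K_def)
  ultimately have "has_defect H d (shift S w)"
    using has_defect_perturb[OF H S _ _ _ z0(3), of K w] K dist by simp
  then show ?thesis using const wU by blast
qed

section \<open>Products of regular relations and powers\<close>

text \<open>This class of relations is stable under composition, with additive codimension, which is all that powers require.\<close>

definition regular_rel :: "'a::complex_inner set \<Rightarrow> nat \<Rightarrow> ('a \<times> 'a) set \<Rightarrow> bool" where
  "regular_rel H d T \<longleftrightarrow> linrel H T \<and> closed T \<and> (\<exists>C. bounded_below C T) \<and>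
     H \<subseteq> closure (Domain T) \<and> has_defect H d T"

text \<open>An algebraic complement of the range has the same dimension as the orthogonal one: project its basis to the orthogonal complement.\<close>

lemma has_defectI:
  fixes H :: "'a::{complex_inner, complete_space} set"
  assumes H: "csubspace H" and R: "csubspace (Range T)" "closed (Range T)" "Range T \<subseteq> H"
    and e: "\<And>i. i < d \<Longrightarrow> e i \<in> H"
    and cover: "\<And>x. x \<in> H \<Longrightarrow> \<exists>c. x - (\<Sum>i<d. c i *C e i) \<in> Range T"
    and indep: "\<And>c. (\<Sum>i<d. c i *C e i) \<in> Range T \<Longrightarrow> \<forall>i<d. c i = 0"
  shows "has_defect H d T"
proof -
  let ?W = "H \<inter> orthocomp (Range T)"
  have "\<exists>p. p \<in> ?W \<and> x - p \<in> Range T" if "x \<in> H" for x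
  proof -
    obtain v w where vw: "v \<in> Range T" "w \<in> orthocomp (Range T)" "x = v + w"
      using orthogonal_decomposition[OF R(1,2)] by blast
    then have "w = x - v" by simp
    then have "w \<in> H" using that R(3) vw(1) H by (auto intro: csubspace_diff)
    with vw show ?thesis by (intro exI[of _ w]) auto
  qed
  then obtain P where P: "\<And>x. x \<in> H \<Longrightarrow> P x \<in> ?W \<and> x - P x \<in> Range T" by metis
  have diff: "(\<Sum>i<d. c i *C e i) - (\<Sum>i<d. c i *C P (e i)) \<in> Range T" for c
    unfolding sum_subtractf[symmetric] complex_vector.scale_right_diff_distrib[symmetric]
    using P e R(1) by (intro csubspace_sum) auto
  have "is_basis ?W d (\<lambda>i. P (e i))"
    unfolding is_basis_def
  proof (intro conjI allI impI ballI)
    show "P (e i) \<in> H \<inter> orthocomp (Range T)" if "i < d" for i using P e that by blast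
    show "lin_indep_seq d (\<lambda>i. P (e i))"
      unfolding lin_indep_seq_def
    proof (intro allI impI)
      fix c i assume "(\<Sum>i<d. c i *C P (e i)) = 0" "i < d"
      then show "c i = 0" using diff[of c] indep[of c] by simp
    qed
    fix x assume x: "x \<in> ?W"
    then obtain c where c: "x - (\<Sum>i<d. c i *C e i) \<in> Range T" using cover by blast
    define u where "u = x - (\<Sum>i<d. c i *C P (e i))"
    have u: "u = (x - (\<Sum>i<d. c i *C e i)) + ((\<Sum>i<d. c i *C e i) - (\<Sum>i<d. c i *C P (e i)))"
      by (simp add: u_def)
    have "u \<in> Range T" unfolding u by (rule csubspace_add[OF R(1) c diff])
    moreover have "u \<in> orthocomp (Range T)"
      unfolding u_def using x P e by (intro csubspace_diff csubspace_sum csubspace_orthocomp) auto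
    ultimately have "cinner u u = 0" by (auto simp: orthocomp_def)
    then show "\<exists>c. x = (\<Sum>i<d. c i *C P (e i))" by (intro exI[of _ c]) (simp add: u_def)
  qed
  then show ?thesis by (auto simp: has_defect_def)
qed

text \<open>Codimensions of ranges add under composition. By density, the domain of \<open>A\<close> contains vectors dual to a basis of the
  orthogonal complement of the range of \<open>B\<close>. Their images under \<open>A\<close> span a complement of the range of the composition
  inside the range of \<open>A\<close>, to which the orthogonal complement of the range of \<open>A\<close> is added. The same density shows
  that the composition is densely defined.\<close>

lemma regular_rel_comp:
  fixes H :: "'a::{complex_inner, complete_space} set"
  assumes H: "csubspace H" "closed H" and A: "regular_rel H d A" and B: "regular_rel H k B"
  shows "regular_rel H (d + k) (B O A)"
proof -
  obtain CA CB where bA: "bounded_below CA A" and bB: "bounded_below CB B"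
    using A B by (auto simp: regular_rel_def)
  have lA: "linrel H A" and lB: "linrel H B" and cA: "closed A" and cB: "closed B"
    and dA: "H \<subseteq> closure (Domain A)" and dB: "H \<subseteq> closure (Domain B)"
    using A B by (auto simp: regular_rel_def)
  obtain eA w where eA: "is_basis (H \<inter> orthocomp (Range A)) d eA"
    and w: "is_basis (H \<inter> orthocomp (Range B)) k w"
    using A B by (auto simp: regular_rel_def has_defect_def)
  have RA: "csubspace (Range A)" "closed (Range A)" "Range A \<subseteq> H"
    using csubspace_Range[OF lA] closed_Range[OF lA bA cA] lA by (auto simp: linrel_def)
  have RB: "csubspace (Range B)" "closed (Range B)" "Range B \<subseteq> H"
    using csubspace_Range[OF lB] closed_Range[OF lB bB cB] lB by (auto simp: linrel_def)
  have inj: "x = y" if "(x, u) \<in> A" "(y, u) \<in> A" for x y u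
    using linrel_diff[OF lA that] bA by (auto simp: bounded_below_def)
  have RB_eq: "y \<in> Range B" if "y \<in> H" "y \<in> orthocomp (H \<inter> orthocomp (Range B))" for y
  proof -
    obtain v u where vu: "v \<in> Range B" "u \<in> orthocomp (Range B)" "y = v + u"
      using orthogonal_decomposition[OF RB(1,2)] by blast
    have "u = y - v" using vu(3) by simp
    then have "u \<in> H" using that(1) vu(1) RB(3) H(1) by (auto intro: csubspace_diff)
    then have "cinner u y = 0" using that(2) vu(2) by (auto simp: orthocomp_def)
    moreover have "cinner u v = 0" using vu(1,2) by (auto simp: orthocomp_def cinner_eq_0_commute[of u])
    ultimately have "cinner u u = 0" by (simp add: vu(3) cinner_add_right)
    then show ?thesis using vu by simp
  qed
  have RB_perp: "y \<in> orthocomp (H \<inter> orthocomp (Range B))" if "y \<in> Range B" for y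
    using that by (auto simp: orthocomp_def cinner_eq_0_commute[of _ y])
  have subA: "Domain A \<subseteq> H" using lA by (auto simp: linrel_def)
  have "H \<inter> orthocomp (Range B) \<subseteq> H" by blast
  from dense_subspace_finite_codim[OF H(1) csubspace_Domain[OF lA] subA dA w this]
  obtain x where x: "\<forall>j<k. x j \<in> Domain A"
    "\<forall>y\<in>H. y - (\<Sum>j<k. cinner (w j) y *C x j) \<in> H \<inter> orthocomp (H \<inter> orthocomp (Range B))"
    "H \<inter> orthocomp (H \<inter> orthocomp (Range B)) \<subseteq> closure (Domain A \<inter> orthocomp (H \<inter> orthocomp (Range B)))"
    "\<forall>c. \<forall>i<k. cinner (w i) (\<Sum>j<k. c j *C x j) = c i"
    by (elim exE conjE)
  have denseAB: "Range B \<subseteq> closure (Domain A \<inter> Range B)"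
  proof -
    have "Range B \<subseteq> H \<inter> orthocomp (H \<inter> orthocomp (Range B))" using RB(3) RB_perp by blast
    moreover have "Domain A \<inter> orthocomp (H \<inter> orthocomp (Range B)) \<subseteq> Domain A \<inter> Range B"
      using RB_eq subA by blast
    ultimately show ?thesis using x(3) closure_mono[of "Domain A \<inter> orthocomp (H \<inter> orthocomp (Range B))" "Domain A \<inter> Range B"]
      by (meson subset_trans)
  qed
  have "\<forall>j. \<exists>y. j < k \<longrightarrow> (x j, y) \<in> A" using x(1) by blast
  then obtain y where y: "\<And>j. j < k \<Longrightarrow> (x j, y j) \<in> A" by metis
  have lin: "linrel H (B O A)"
    unfolding linrel_def
  proof (intro conjI allI impI)
    show "B O A \<subseteq> H \<times> H" "(0, 0) \<in> B O A" using lA lB by (auto simp: linrel_def)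
    fix f f' g g' c assume "(f, f') \<in> B O A" "(g, g') \<in> B O A"
    then obtain u v where "(f, u) \<in> B" "(u, f') \<in> A" "(g, v) \<in> B" "(v, g') \<in> A" by blast
    then have "(f + c *C g, u + c *C v) \<in> B" "(u + c *C v, f' + c *C g') \<in> A"
      using lA lB by (auto simp: linrel_def)
    then show "(f + c *C g, f' + c *C g') \<in> B O A" by blast
  qed
  have bdd: "bounded_below (\<bar>CB\<bar> * \<bar>CA\<bar>) (B O A)"
    unfolding bounded_below_def
  proof clarify
    fix f u g assume "(f, u) \<in> B" "(u, g) \<in> A"
    then have f: "norm f \<le> CB * norm u" and u: "norm u \<le> CA * norm g"
      using bA bB by (auto simp: bounded_below_def)
    have "norm u \<le> \<bar>CA\<bar> * norm g" using u mult_right_mono[OF abs_ge_self[of CA] norm_ge_zero[of g]] by linarith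
    then have "\<bar>CB\<bar> * norm u \<le> \<bar>CB\<bar> * (\<bar>CA\<bar> * norm g)" by (rule mult_left_mono) simp
    moreover have "norm f \<le> \<bar>CB\<bar> * norm u" using f mult_right_mono[OF abs_ge_self[of CB] norm_ge_zero[of u]] by linarith
    ultimately show "norm f \<le> \<bar>CB\<bar> * \<bar>CA\<bar> * norm g" by (simp add: mult.assoc)
  qed
  have cl: "closed (B O A)"
    unfolding closed_sequential_limits
  proof (intro allI impI, elim conjE)
    fix s l assume s: "\<forall>n. s n \<in> B O A" "s \<longlonglongrightarrow> l"
    have "\<forall>n. \<exists>u. (fst (s n), u) \<in> B \<and> (u, snd (s n)) \<in> A"
    proof
      fix n
      have "(fst (s n), snd (s n)) \<in> B O A" using s(1) by simp
      then show "\<exists>u. (fst (s n), u) \<in> B \<and> (u, snd (s n)) \<in> A" by blast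
    qed
    then obtain u where u: "\<And>n. (fst (s n), u n) \<in> B" "\<And>n. (u n, snd (s n)) \<in> A" by metis
    have l1: "(\<lambda>n. fst (s n)) \<longlonglongrightarrow> fst l" and l2: "(\<lambda>n. snd (s n)) \<longlonglongrightarrow> snd l"
      by (intro tendsto_intros s(2))+
    have "Cauchy u" by (rule bounded_below_Cauchy[OF lA bA u(2) LIMSEQ_imp_Cauchy[OF l2]])
    then obtain m where m: "u \<longlonglongrightarrow> m" using Cauchy_convergent convergent_def by blast
    have "(fst l, m) \<in> B" by (rule closed_sequentially[OF cB u(1) tendsto_Pair[OF l1 m]])
    moreover have "(m, snd l) \<in> A" by (rule closed_sequentially[OF cA u(2) tendsto_Pair[OF m l2]])
    ultimately have "(fst l, snd l) \<in> B O A" by blast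
    then show "l \<in> B O A" by simp
  qed
  have dense: "H \<subseteq> closure (Domain (B O A))"
  proof -
    have "Domain B \<subseteq> closure (Domain (B O A))"
    proof
      fix f assume "f \<in> Domain B"
      then obtain g where fg: "(f, g) \<in> B" by blast
      then have "g \<in> closure (Domain A \<inter> Range B)" using denseAB by blast
      then obtain s where s: "\<And>n. s n \<in> Domain A \<inter> Range B" "s \<longlonglongrightarrow> g" unfolding closure_sequential by blast
      have "\<forall>n. \<exists>h. (h, s n) \<in> B" using s(1) by blast
      then obtain h where h: "\<And>n. (h n, s n) \<in> B" by metis
      have le: "norm (h n - f) \<le> \<bar>CB\<bar> * norm (s n - g)" for n
      proof -
        have "norm (h n - f) \<le> CB * norm (s n - g)"
          using bspec[OF bB[unfolded bounded_below_def] linrel_diff[OF lB h fg, of n]] by simp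
        also have "\<dots> \<le> \<bar>CB\<bar> * norm (s n - g)" by (rule mult_right_mono) simp_all
        finally show ?thesis .
      qed
      have "(\<lambda>n. \<bar>CB\<bar> * norm (s n - g)) \<longlonglongrightarrow> \<bar>CB\<bar> * norm (g - g)"
        by (intro tendsto_intros s(2))
      then have lim: "(\<lambda>n. \<bar>CB\<bar> * norm (s n - g)) \<longlonglongrightarrow> 0" by simp
      have "(\<lambda>n. h n - f) \<longlonglongrightarrow> 0"
        by (rule Lim_null_comparison[OF always_eventually lim]) (rule allI, rule le)
      then have "h \<longlonglongrightarrow> f" by (rule LIM_zero_cancel)
      moreover have "h n \<in> Domain (B O A)" for n using h[of n] s(1)[of n] by blast
      ultimately show "f \<in> closure (Domain (B O A))"
        unfolding closure_sequential by (intro exI[of _ h] conjI allI)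
    qed
    then have "closure (Domain B) \<subseteq> closure (Domain (B O A))" by (rule closure_minimal) simp
    then show ?thesis using dB by blast
  qed
  define e where "e = (\<lambda>i. if i < d then eA i else y (i - d))"
  have split: "(\<Sum>i<d + k. c i *C e i) = (\<Sum>i<d. c i *C eA i) + (\<Sum>j<k. c (d + j) *C y j)" for c
  proof -
    have "(\<Sum>i<d + k. c i *C e i) = (\<Sum>i<d. c i *C e i) + (\<Sum>j<k. c (d + j) *C e (d + j))"
      by (induction k) (auto simp: add.assoc)
    then show ?thesis by (simp add: e_def)
  qed
  have "has_defect H (d + k) (B O A)"
  proof (rule has_defectI[OF H(1) csubspace_Range[OF lin] closed_Range[OF lin bdd cl], of _ e])
    show "Range (B O A) \<subseteq> H" using lin by (auto simp: linrel_def)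
    show "e i \<in> H" if "i < d + k" for i
    proof (cases "i < d")
      case True
      then show ?thesis using eA by (auto simp: e_def is_basis_def)
    next
      case False
      then have "(x (i - d), y (i - d)) \<in> A" using y that by simp
      then show ?thesis using False lA by (auto simp: e_def linrel_def)
    qed
    show "\<exists>c. u - (\<Sum>i<d + k. c i *C e i) \<in> Range (B O A)" if u: "u \<in> H" for u
    proof -
      obtain v r where vr: "v \<in> Range A" "r \<in> orthocomp (Range A)" "u = v + r"
        using orthogonal_decomposition[OF RA(1,2)] by blast
      have "r = u - v" using vr(3) by simp
      then have "r \<in> H" using u vr(1) RA(3) H(1) by (auto intro: csubspace_diff)
      then obtain c1 where c1: "r = (\<Sum>i<d. c1 i *C eA i)" using eA vr(2) by (auto simp: is_basis_def)
      obtain q where q: "(q, v) \<in> A" using vr(1) by blast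
      then have qH: "q \<in> H" using subA by blast
      define c2 where "c2 = (\<lambda>j. cinner (w j) q)"
      define q' where "q' = q - (\<Sum>j<k. c2 j *C x j)"
      have "q' \<in> H \<inter> orthocomp (H \<inter> orthocomp (Range B))"
        unfolding q'_def c2_def by (rule x(2)[rule_format, OF qH])
      then have "q' \<in> Range B" using RB_eq[of q'] by blast
      moreover have xyA: "((\<Sum>j<k. c2 j *C x j), (\<Sum>j<k. c2 j *C y j)) \<in> A" by (rule linrel_sum[OF lA]) (use y in auto)
      have "(q', v - (\<Sum>j<k. c2 j *C y j)) \<in> A" unfolding q'_def by (rule linrel_diff[OF lA q xyA])
      ultimately have mem: "v - (\<Sum>j<k. c2 j *C y j) \<in> Range (B O A)" by blast
      let ?c = "\<lambda>i. if i < d then c1 i else c2 (i - d)"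
      have "(\<Sum>i<d. ?c i *C eA i) = r" unfolding c1 by (rule sum.cong) auto
      then have "u - (\<Sum>i<d + k. ?c i *C e i) = v - (\<Sum>j<k. c2 j *C y j)"
        unfolding split vr(3) by simp
      with mem show ?thesis by (intro exI[of _ ?c]) simp
    qed
    show "\<forall>i<d + k. c i = 0" if c: "(\<Sum>i<d + k. c i *C e i) \<in> Range (B O A)" for c
    proof -
      define r where "r = (\<Sum>i<d. c i *C eA i)"
      have rW: "r \<in> orthocomp (Range A)" unfolding r_def
        using eA by (intro csubspace_sum csubspace_orthocomp) (auto simp: is_basis_def)
      have xy: "((\<Sum>j<k. c (d + j) *C x j), (\<Sum>j<k. c (d + j) *C y j)) \<in> A" by (rule linrel_sum[OF lA]) (use y in auto)
      have "r + (\<Sum>j<k. c (d + j) *C y j) \<in> Range (B O A)" using c by (simp add: split r_def)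
      then obtain f g where fg: "(f, g) \<in> B" "(g, r + (\<Sum>j<k. c (d + j) *C y j)) \<in> A" by blast
      have "(g - (\<Sum>j<k. c (d + j) *C x j), r) \<in> A" using linrel_diff[OF lA fg(2) xy] by simp
      then have "cinner r r = 0" using rW unfolding orthocomp_def by blast
      then have r0: "r = 0" by simp
      moreover have "lin_indep_seq d eA" using eA unfolding is_basis_def by blast
      ultimately have "\<forall>i<d. c i = 0" unfolding r_def lin_indep_seq_def by blast
      moreover have "c (d + j) = 0" if j: "j < k" for j
      proof -
        have gx: "g = (\<Sum>j<k. c (d + j) *C x j)"
          by (rule inj[OF fg(2)[unfolded r0 add_0] xy])
        have "cinner (w j) g = c (d + j)"
          unfolding gx by (rule x(4)[THEN spec, of "\<lambda>j. c (d + j)", rule_format, OF j])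
        moreover have "w j \<in> orthocomp (Range B)" using w j unfolding is_basis_def by blast
        then have "cinner g (w j) = 0" using fg(1) unfolding orthocomp_def by blast
        then have "cinner (w j) g = 0" using cinner_eq_0_commute by blast
        ultimately show ?thesis by simp
      qed
      ultimately show ?thesis
      proof (intro allI impI)
        fix i assume *: "\<forall>i<d. c i = 0" "\<And>j. j < k \<Longrightarrow> c (d + j) = 0" "i < d + k"
        show "c i = 0"
        proof (cases "i < d")
          case False
          with *(2)[of "i - d"] *(3) show ?thesis by simp
        qed (use *(1) in blast)
      qed
    qed
  qed
  then show ?thesis using lin bdd cl dense by (auto simp: regular_rel_def)
qed

lemma regular_rel_Id:
  assumes "csubspace H" "closed H" shows "regular_rel H 0 (Id_on H)"
  unfolding regular_rel_def
proof (intro conjI)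
  show "linrel H (Id_on H)"
    using assms(1) by (auto simp: linrel_def csubspace_0 csubspace_add csubspace_scale)
  have "Id_on H = {p. fst p = snd p} \<inter> fst -` H" by (auto simp: Id_on_def)
  moreover have "closed {p::'a \<times> 'a. fst p = snd p}" by (intro closed_Collect_eq continuous_intros)
  moreover have "closed (fst -` H :: ('a \<times> 'a) set)" by (intro closed_vimage assms continuous_intros)
  ultimately show "closed (Id_on H)" by auto
  show "\<exists>C. bounded_below C (Id_on H)" by (intro exI[of _ 1]) (auto simp: bounded_below_def)
  have "Domain (Id_on H) = H" by auto
  then show "H \<subseteq> closure (Domain (Id_on H))" using closure_subset by auto
  have "x = 0" if "x \<in> H" "\<forall>v\<in>H. cinner v x = 0" for x :: 'a using that by force
  then show "has_defect H 0 (Id_on H)"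
    by (auto simp: has_defect_def is_basis_def orthocomp_def lin_indep_seq_def)
qed

text \<open>The polynomial \<open>q\<close> in \<open>S\<close>, with the iterates of \<open>S\<close> recorded in the sequence \<open>F\<close>. The natural domain of the leading power
  is the domain of the whole.\<close>

definition poly_rel :: "'a::complex_inner set \<Rightarrow> ('a \<times> 'a) set \<Rightarrow> complex poly \<Rightarrow> ('a \<times> 'a) set" where
  "poly_rel H S q = {(F 0, \<Sum>i\<le>degree q. coeff q i *C F i) | F. F 0 \<in> H \<and> (\<forall>i<degree q. (F i, F (Suc i)) \<in> S)}"

text \<open>If \<open>q(S) f\<close> lies in the domain of \<open>S\<close>, then so does the last iterate of \<open>f\<close> occurring in it: its coefficient is one, and
  all lower iterates lie in the domain anyway. Hence the product has the natural domain of a polynomial of higher degree.\<close>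

lemma poly_rel_linear_factor:
  assumes S: "linrel H S" "single_valued S" and q: "lead_coeff q = 1"
  shows "poly_rel H S ([:- z, 1:] * q) = poly_rel H S q O shift S z"
proof -
  let ?m = "degree q"
  have "q \<noteq> 0" using q by auto
  have deg: "degree ([:- z, 1:] * q) = Suc ?m"
    using \<open>q \<noteq> 0\<close> by (subst degree_mult_eq) auto
  have co: "coeff ([:- z, 1:] * q) i = - z * coeff q i + (if i = 0 then 0 else coeff q (i - 1))" for i
    by (cases i) (auto simp: mult_pCons_left coeff_pCons)
  have sum: "(\<Sum>i\<le>Suc ?m. coeff ([:- z, 1:] * q) i *C F i) =
     (\<Sum>i\<le>?m. coeff q i *C F (Suc i)) - z *C (\<Sum>i\<le>?m. coeff q i *C F i)" for F :: "nat \<Rightarrow> 'a"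
  proof -
    have "(\<Sum>i\<le>Suc ?m. coeff ([:- z, 1:] * q) i *C F i) =
       (\<Sum>i\<le>Suc ?m. (- z * coeff q i) *C F i) + (\<Sum>i\<le>Suc ?m. (if i = 0 then 0 else coeff q (i - 1)) *C F i)"
      unfolding co scaleC_add_left sum.distrib ..
    also have "(\<Sum>i\<le>Suc ?m. (if i = 0 then 0 else coeff q (i - 1)) *C F i) = (\<Sum>i\<le>?m. coeff q i *C F (Suc i))"
      by (subst sum.atMost_Suc_shift) simp
    also have "(\<Sum>i\<le>Suc ?m. (- z * coeff q i) *C F i) = (\<Sum>i\<le>?m. (- z * coeff q i) *C F i)"
      by (simp add: coeff_eq_0)
    also have "\<dots> = (-1) *C z *C (\<Sum>i\<le>?m. coeff q i *C F i)"
      by (simp add: complex_vector.scale_sum_right scaleC_scaleC)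
    finally show ?thesis by (simp add: scaleC_minus1)
  qed
  show ?thesis
  proof (intro equalityI subsetI)
    fix p assume "p \<in> poly_rel H S ([:- z, 1:] * q)"
    then obtain F where F: "F 0 \<in> H" "\<And>i. i < Suc ?m \<Longrightarrow> (F i, F (Suc i)) \<in> S"
      and p: "p = (F 0, \<Sum>i\<le>Suc ?m. coeff ([:- z, 1:] * q) i *C F i)"
      unfolding poly_rel_def deg by blast
    have "(F 0, \<Sum>i\<le>?m. coeff q i *C F i) \<in> poly_rel H S q" unfolding poly_rel_def using F by auto
    moreover have "((\<Sum>i\<le>?m. coeff q i *C F i), (\<Sum>i\<le>?m. coeff q i *C F (Suc i))) \<in> S"
      by (rule linrel_sum[OF S(1)]) (use F(2) in auto)
    then have "((\<Sum>i\<le>?m. coeff q i *C F i), snd p) \<in> shift S z" by (simp only: mem_shift p sum snd_conv) simp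
    ultimately show "p \<in> poly_rel H S q O shift S z" unfolding p by auto
  next
    fix p assume "p \<in> poly_rel H S q O shift S z"
    then obtain F h where F: "F 0 \<in> H" "\<And>i. i < ?m \<Longrightarrow> (F i, F (Suc i)) \<in> S"
      and p: "p = (F 0, h)" "((\<Sum>i\<le>?m. coeff q i *C F i), h) \<in> shift S z"
      unfolding poly_rel_def by fastforce
    let ?g = "\<Sum>i\<le>?m. coeff q i *C F i"
    have gS: "(?g, h + z *C ?g) \<in> S" using p(2) by (simp add: mem_shift)
    have g: "?g = (\<Sum>i<?m. coeff q i *C F i) + F ?m"
      using q by (simp add: lessThan_Suc_atMost[symmetric] scaleC_one)
    have "((\<Sum>i<?m. coeff q i *C F i), (\<Sum>i<?m. coeff q i *C F (Suc i))) \<in> S"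
      by (rule linrel_sum[OF S(1)]) (use F(2) in auto)
    from linrel_diff[OF S(1) gS this]
    obtain t where t: "(F ?m, t) \<in> S" by (simp add: g)
    define F' where "F' = F(Suc ?m := t)"
    have F'F: "F' i = F i" if "i \<le> ?m" for i using that by (simp add: F'_def)
    have F'S: "(F' i, F' (Suc i)) \<in> S" if "i < Suc ?m" for i
      using that F(2) t by (cases "i = ?m") (auto simp: F'_def)
    have g': "?g = (\<Sum>i\<le>?m. coeff q i *C F' i)" by (rule sum.cong) (use F'F in auto)
    have "(?g, (\<Sum>i\<le>?m. coeff q i *C F' (Suc i))) \<in> S"
      unfolding g' by (rule linrel_sum[OF S(1)]) (use F'S in auto)
    then have "h + z *C ?g = (\<Sum>i\<le>?m. coeff q i *C F' (Suc i))" using gS S(2) by (meson single_valuedD)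
    then have "h = (\<Sum>i\<le>?m. coeff q i *C F' (Suc i)) - z *C (\<Sum>i\<le>?m. coeff q i *C F' i)"
      unfolding g' by (metis add_diff_cancel_right')
    then have "p = (F' 0, \<Sum>i\<le>Suc ?m. coeff ([:- z, 1:] * q) i *C F' i)" by (simp only: p sum) (simp add: F'F)
    moreover have "F' 0 \<in> H" using F(1) F'F[of 0] by simp
    ultimately show "p \<in> poly_rel H S ([:- z, 1:] * q)"
      unfolding poly_rel_def deg using F'S by auto
  qed
qed

lemma poly_rel_regular:
  fixes H :: "'a::{complex_inner, complete_space} set"
  assumes H: "csubspace H" "closed H" and S: "linrel H S" "single_valued S"
    and reg: "\<And>z. z \<in> set zs \<Longrightarrow> regular_rel H d (shift S z)"
  shows "regular_rel H (d * length zs) (poly_rel H S (\<Prod>z\<leftarrow>zs. [:- z, 1:]))"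
  using reg
proof (induction zs)
  case Nil
  have "poly_rel H S 1 = Id_on H" unfolding poly_rel_def by (auto simp: scaleC_one)
  then show ?case using regular_rel_Id[OF H] by simp
next
  case (Cons z zs)
  have lc: "lead_coeff (\<Prod>z\<leftarrow>zs. [:- z, 1:]) = (1::complex)" by (induction zs) (auto simp: lead_coeff_mult simp del: mult_pCons_left)
  have "regular_rel H (d + d * length zs) (poly_rel H S (\<Prod>z\<leftarrow>zs. [:- z, 1:]) O shift S z)"
    by (rule regular_rel_comp[OF H]) (use Cons in auto)
  then show ?case using poly_rel_linear_factor[OF S lc, of z] by simp
qed

lemma relpow_chain: "(f, g) \<in> S ^^ m \<longleftrightarrow> (\<exists>F. F 0 = f \<and> F m = g \<and> (\<forall>i<m. (F i, F (Suc i)) \<in> S))"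
  by (rule relpow_fun_conv)

text \<open>The polynomial \<open>x^m - z\<close> splits into linear factors, and none of its roots is real because a real root would
  make \<open>z\<close> real. Thus \<open>S^m - z\<close> is a product of \<open>m\<close> regular relations.\<close>

lemma power_shift_regular:
  fixes H :: "'a::{complex_inner, complete_space} set"
  assumes H: "csubspace H" "closed H" and S: "linrel H S" "single_valued S"
    and reg: "\<And>z. Im z \<noteq> 0 \<Longrightarrow> regular_rel H d (shift S z)" and m: "m \<ge> 1" and z: "Im z \<noteq> 0"
  shows "regular_rel H (d * m) (shift (S ^^ m) z)"
proof -
  define p where "p = monom 1 m + [:- z:]"
  have deg: "degree p = m"
    unfolding p_def using m by (subst degree_add_eq_left) (auto simp: degree_monom_eq)
  have co: "coeff p i = (if i = m then 1 else if i = 0 then - z else 0)" for i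
    using m by (auto simp: p_def coeff_pCons split: nat.splits)
  have lc: "lead_coeff p = 1" unfolding deg co by simp
  have "p \<noteq> 0" using lc by auto
  then obtain A where A: "size A = degree p" "p = Polynomial.smult (lead_coeff p) (\<Prod>x\<in>#A. [:-x, 1:])"
    using alg_closed_imp_factorization by blast
  obtain zs where zs: "mset zs = A" using ex_mset by blast
  have "(\<Prod>x\<in>#mset ws. [:-x, 1:]) = (\<Prod>z\<leftarrow>ws. [:- z, 1:])" for ws :: "complex list"
    by (induction ws) simp_all
  then have p_eq: "p = (\<Prod>z\<leftarrow>zs. [:- z, 1:])" using A(2) unfolding lc zs[symmetric] by simp
  have len: "length zs = m" using A(1) zs deg by auto
  have "Im x \<noteq> 0" if "x \<in> set zs" for x
  proof
    assume "Im x = 0"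
    have "poly p x = 0" unfolding p_eq using that by (induction zs) auto
    then have "z = x ^ m" by (simp add: p_def poly_monom add_eq_0_iff)
    moreover have "x \<in> \<real>" using \<open>Im x = 0\<close> by (simp add: complex_is_Real_iff)
    then have "x ^ m \<in> \<real>" by (rule Reals_power)
    ultimately show False using z by (simp add: complex_is_Real_iff)
  qed
  then have "regular_rel H (d * length zs) (poly_rel H S (\<Prod>z\<leftarrow>zs. [:- z, 1:]))"
    by (intro poly_rel_regular[OF H S] reg)
  moreover have "poly_rel H S p = shift (S ^^ m) z"
  proof -
    have sum: "(\<Sum>i\<le>m. coeff p i *C F i) = F m - z *C F 0" for F :: "nat \<Rightarrow> 'a"
    proof -
      have "(\<Sum>i\<le>m. coeff p i *C F i) = (\<Sum>i\<in>{0, m}. coeff p i *C F i)"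
        by (rule sum.mono_neutral_right) (auto simp: co)
      then show ?thesis using m by (simp add: co scaleC_one)
    qed
    have "F 0 \<in> H" if "\<forall>i<m. (F i, F (Suc i)) \<in> S" for F
      using that m S(1) by (auto simp: linrel_def dest!: spec[of _ 0])
    then have "poly_rel H S p = {(F 0, F m - z *C F 0) | F. \<forall>i<m. (F i, F (Suc i)) \<in> S}"
      unfolding poly_rel_def deg sum by blast
    also have "\<dots> = shift (S ^^ m) z"
    proof (intro equalityI subsetI)
      fix u assume "u \<in> {(F 0, F m - z *C F 0) | F. \<forall>i<m. (F i, F (Suc i)) \<in> S}"
      then obtain F where F: "u = (F 0, F m - z *C F 0)" "\<forall>i<m. (F i, F (Suc i)) \<in> S" by blast
      then have "(F 0, F m) \<in> S ^^ m" unfolding relpow_chain by blast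
      then show "u \<in> shift (S ^^ m) z" unfolding F(1) mem_shift by simp
    next
      fix u assume "u \<in> shift (S ^^ m) z"
      then obtain f g where u: "u = (f, g - z *C f)" and "(f, g) \<in> S ^^ m" unfolding shift_def by fastforce
      then obtain F where "F 0 = f" "F m = g" "\<forall>i<m. (F i, F (Suc i)) \<in> S" unfolding relpow_chain by blast
      then show "u \<in> {(F 0, F m - z *C F 0) | F. \<forall>i<m. (F i, F (Suc i)) \<in> S}" unfolding u by blast
    qed
    finally show ?thesis .
  qed
  ultimately show ?thesis using len p_eq by simp
qed

section \<open>The space of square-integrable functions\<close>

lemma L2_of_UNIV: "L2_of I u = L2_of UNIV (\<lambda>x. if x \<in> I then u x else 0)"
  by (simp add: L2_of_def)

lemma lebesgue_on_UNIV_eq [simp]: "lebesgue_on UNIV = (lebesgue :: 'a::euclidean_space measure)"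
proof (rule measure_eqI)
  show "sets (lebesgue_on UNIV) = sets (lebesgue :: 'a measure)"
    unfolding sets_restrict_space by (simp add: image_def)
  fix A :: "'a set"
  assume "A \<in> sets (lebesgue_on UNIV)"
  show "emeasure (lebesgue_on UNIV) A = emeasure lebesgue A"
    by (rule emeasure_restrict_space) simp_all
qed

lemma L2_rel_refl: "sq_integrable lebesgue f \<Longrightarrow> L2_rel f f"
  by (simp add: L2_rel_def)

lemma L2_of_lincomb:
  assumes I: "I \<in> sets lebesgue" and u: "sq_integrable (lebesgue_on I) u" and v: "sq_integrable (lebesgue_on I) v"
  shows "L2_of I (\<lambda>x. u x + c * v x) = L2_of I u + c *C L2_of I v"
proof -
  let ?u = "\<lambda>x. if x \<in> I then u x else 0" and ?v = "\<lambda>x. if x \<in> I then v x else 0"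
  have su: "sq_integrable lebesgue ?u" and sv: "sq_integrable lebesgue ?v"
    using u v by (simp_all add: sq_integrable_extend[OF I])
  have "L2_of I u + c *C L2_of I v = abs_L2 (\<lambda>x. ?u x + c * ?v x)"
    unfolding L2_of_def
    by (simp add: scaleC_L2.abs_eq L2_rel_refl plus_L2.abs_eq su sv sq_integrable_scale)
  also have "(\<lambda>x. ?u x + c * ?v x) = (\<lambda>x. if x \<in> I then u x + c * v x else 0)" by auto
  finally show ?thesis by (simp add: L2_of_def)
qed

lemma L2_of_zero: "L2_of I (\<lambda>_. 0) = 0"
  by (simp add: L2_of_def zero_L2_def)

lemma L2_of_scale:
  assumes I: "I \<in> sets lebesgue" and v: "sq_integrable (lebesgue_on I) v"
  shows "L2_of I (\<lambda>x. c * v x) = c *C L2_of I v"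
  using L2_of_lincomb[OF I _ v, of "\<lambda>_. 0" c] by (simp add: L2_of_zero sq_integrable_def)

lemma L2_of_diff:
  assumes I: "I \<in> sets lebesgue" and u: "sq_integrable (lebesgue_on I) u" and v: "sq_integrable (lebesgue_on I) v"
  shows "L2_of I (\<lambda>x. u x - v x) = L2_of I u - L2_of I v"
  using L2_of_lincomb[OF I u v, of "-1"] by (simp add: scaleC_minus1)

lemma norm_L2_of:
  assumes I: "I \<in> sets lebesgue" and u: "sq_integrable (lebesgue_on I) u"
  shows "(norm (L2_of I u))\<^sup>2 = (LINT x|lebesgue_on I. (cmod (u x))\<^sup>2)"
proof -
  have "complex_of_real ((norm (L2_of I u))\<^sup>2) = (LINT x|lebesgue_on I. cnj (u x) * u x)"
    by (simp only: cinner_self[symmetric] cinner_L2_of[OF I u u])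
  also have "\<dots> = (LINT x|lebesgue_on I. complex_of_real ((cmod (u x))\<^sup>2))"
    by (simp only: complex_norm_square mult.commute)
  also have "\<dots> = complex_of_real (LINT x|lebesgue_on I. (cmod (u x))\<^sup>2)"
    by (rule integral_complex_of_real)
  finally show ?thesis by (simp only: of_real_eq_iff)
qed

lemma L2_cases:
  obtains u where "sq_integrable lebesgue u" "F = L2_of UNIV u"
proof -
  have "sq_integrable lebesgue (rep_L2 F)"
    using Quotient3_rep_reflp[OF Quotient3_L2, of F] by (simp add: L2_rel_def)
  moreover have "F = L2_of UNIV (rep_L2 F)" by (simp add: L2_of_def Quotient3_abs_rep[OF Quotient3_L2])
  ultimately show ?thesis using that by blast
qed

lemma sq_integrable_diff:
  "sq_integrable M f \<Longrightarrow> sq_integrable M g \<Longrightarrow> sq_integrable M (\<lambda>x. f x - g x)"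
  using sq_integrable_add[of M f "\<lambda>x. (-1) * g x"] sq_integrable_scale[of M g "-1"] by simp

lemma nn_integral_sq_norm:
  assumes "sq_integrable lebesgue u" "sq_integrable lebesgue v"
  shows "(\<integral>\<^sup>+x. ennreal ((cmod (u x - v x))\<^sup>2) \<partial>lebesgue) = ennreal ((norm (L2_of UNIV u - L2_of UNIV v))\<^sup>2)"
proof -
  have d: "sq_integrable lebesgue (\<lambda>x. u x - v x)" by (rule sq_integrable_diff[OF assms])
  have "(norm (L2_of UNIV u - L2_of UNIV v))\<^sup>2 = (LINT x|lebesgue. (cmod (u x - v x))\<^sup>2)"
    using norm_L2_of[of UNIV "\<lambda>x. u x - v x"] L2_of_diff[of UNIV u v] assms d by simp
  moreover have "(\<integral>\<^sup>+x. ennreal ((cmod (u x - v x))\<^sup>2) \<partial>lebesgue) = ennreal (LINT x|lebesgue. (cmod (u x - v x))\<^sup>2)"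
    by (rule nn_integral_eq_integral) (use d in \<open>auto simp: sq_integrable_def\<close>)
  ultimately show ?thesis by simp
qed

text \<open>Comparison with the geometric weights turns a rate of convergence in the mean into pointwise summability.\<close>

lemma summable_of_weighted_squares:
  fixes a :: "nat \<Rightarrow> real"
  assumes "(\<Sum>k. ennreal (2 ^ k * (a k)\<^sup>2)) \<noteq> \<infinity>" and a: "\<And>k. 0 \<le> a k"
  shows "summable a"
proof -
  obtain C where C: "(\<Sum>k. ennreal (2 ^ k * (a k)\<^sup>2)) = ennreal C" "0 \<le> C"
    using assms(1) by (cases "\<Sum>k. ennreal (2 ^ k * (a k)\<^sup>2)") (auto simp only: infinity_ennreal_def)
  have le: "a k \<le> sqrt C * (sqrt (1/2)) ^ k" for k
  proof -
    have "(\<Sum>i\<in>{k}. ennreal (2 ^ i * (a i)\<^sup>2)) \<le> (\<Sum>i. ennreal (2 ^ i * (a i)\<^sup>2))"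
      by (rule sum_le_suminf) auto
    then have "ennreal (2 ^ k * (a k)\<^sup>2) \<le> ennreal C" unfolding C(1) by (simp only: sum.insert sum.empty finite.emptyI empty_iff not_False_eq_True add_0_right)
    then have "2 ^ k * (a k)\<^sup>2 \<le> C" unfolding ennreal_le_iff[OF C(2)] .
    then have "(a k)\<^sup>2 \<le> C * (1/2) ^ k" by (simp add: power_one_over field_simps)
    then have "sqrt ((a k)\<^sup>2) \<le> sqrt (C * (1/2) ^ k)" by (rule real_sqrt_le_mono)
    then show ?thesis using a[of k] by (simp add: real_sqrt_mult real_sqrt_power)
  qed
  have "summable (\<lambda>k. sqrt C * (sqrt (1/2)) ^ k)"
    by (intro summable_mult summable_geometric) simp
  then show ?thesis
  proof (rule summable_comparison_test'[where N = 0])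
    show "norm (a k) \<le> sqrt C * sqrt (1/2) ^ k" for k using le[of k] a[of k] by simp
  qed
qed

text \<open>Riesz--Fischer: a subsequence with geometrically small increments converges almost everywhere by summability of the
  weighted squares, and Fatou gives convergence in norm.\<close>

instance L2 :: complete_space
proof
  fix X :: "nat \<Rightarrow> L2" assume "Cauchy X"
  then have "\<exists>N. \<forall>m\<ge>N. \<forall>n\<ge>N. norm (X m - X n) < (1/2) ^ k" for k
    by (rule CauchyD) simp
  then obtain N where N: "\<And>k m n. m \<ge> N k \<Longrightarrow> n \<ge> N k \<Longrightarrow> norm (X m - X n) < (1/2) ^ k" by metis
  define r where "r = (\<lambda>k. \<Sum>i\<le>k. N i)"
  have rN: "N k \<le> r j" if "k \<le> j" for k j
  proof -
    have "N k \<le> (\<Sum>i\<le>j. N i)" by (rule member_le_sum) (use that in auto)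
    then show ?thesis by (simp add: r_def)
  qed
  have "\<exists>u. sq_integrable lebesgue u \<and> X (r k) = L2_of UNIV u" for k
    by (rule L2_cases[of "X (r k)"]) blast
  then obtain f where f: "\<And>k. sq_integrable lebesgue (f k)" "\<And>k. X (r k) = L2_of UNIV (f k)" by metis
  have fm [measurable]: "f k \<in> borel_measurable lebesgue" for k using f(1)[of k] by (simp add: sq_integrable_def)
  have fd: "(\<integral>\<^sup>+x. ennreal ((cmod (f j x - f k x))\<^sup>2) \<partial>lebesgue) \<le> ennreal ((1/4) ^ k)" if "k \<le> j" for j k
  proof -
    have "norm (X (r j) - X (r k)) < (1/2) ^ k" by (rule N) (use rN that in auto)
    then have "(norm (X (r j) - X (r k)))\<^sup>2 \<le> ((1/2) ^ k)\<^sup>2" by (intro power_mono) auto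
    also have "((1/2) ^ k)\<^sup>2 = (1/4 :: real) ^ k" by (simp add: power2_eq_square flip: power_mult_distrib)
    finally show ?thesis using nn_integral_sq_norm[OF f(1) f(1), of j k] by (simp add: f(2) ennreal_leI)
  qed
  have "(\<integral>\<^sup>+x. (\<Sum>k. ennreal (2 ^ k * (cmod (f (Suc k) x - f k x))\<^sup>2)) \<partial>lebesgue)
      = (\<Sum>k. \<integral>\<^sup>+x. ennreal (2 ^ k * (cmod (f (Suc k) x - f k x))\<^sup>2) \<partial>lebesgue)"
    by (rule nn_integral_suminf) measurable
  also have "\<dots> \<le> (\<Sum>k. ennreal ((1/2) ^ k))"
  proof (rule suminf_le)
    fix k
    have "(\<integral>\<^sup>+x. ennreal (2 ^ k * (cmod (f (Suc k) x - f k x))\<^sup>2) \<partial>lebesgue)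
        = ennreal (2 ^ k) * (\<integral>\<^sup>+x. ennreal ((cmod (f (Suc k) x - f k x))\<^sup>2) \<partial>lebesgue)"
      by (subst nn_integral_cmult[symmetric]) (auto simp: ennreal_mult)
    also have "\<dots> \<le> ennreal (2 ^ k) * ennreal ((1/4) ^ k)" by (intro mult_left_mono fd) auto
    also have "\<dots> = ennreal ((1/2) ^ k)" by (simp add: ennreal_mult[symmetric] power_mult_distrib[symmetric])
    finally show "(\<integral>\<^sup>+x. ennreal (2 ^ k * (cmod (f (Suc k) x - f k x))\<^sup>2) \<partial>lebesgue) \<le> ennreal ((1/2) ^ k)" .
  qed auto
  also have "\<dots> = ennreal (\<Sum>k. (1/2) ^ k)" by (rule suminf_ennreal2) (auto intro: summable_geometric)
  finally have fin: "(\<integral>\<^sup>+x. (\<Sum>k. ennreal (2 ^ k * (cmod (f (Suc k) x - f k x))\<^sup>2)) \<partial>lebesgue) \<noteq> \<infinity>"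
    by (auto simp: top_unique)
  have "AE x in lebesgue. (\<Sum>k. ennreal (2 ^ k * (cmod (f (Suc k) x - f k x))\<^sup>2)) \<noteq> \<infinity>"
    by (rule nn_integral_PInf_AE[OF _ fin]) measurable
  then have conv: "AE x in lebesgue. (\<lambda>k. f k x) \<longlonglongrightarrow> lim (\<lambda>k. f k x)"
  proof eventually_elim
    fix x assume "(\<Sum>k. ennreal (2 ^ k * (cmod (f (Suc k) x - f k x))\<^sup>2)) \<noteq> \<infinity>"
    then have "summable (\<lambda>k. cmod (f (Suc k) x - f k x))" by (rule summable_of_weighted_squares) simp
    then have "summable (\<lambda>k. f (Suc k) x - f k x)" by (rule summable_norm_cancel)
    then have "convergent (\<lambda>n. \<Sum>k<n. f (Suc k) x - f k x)" by (simp add: summable_iff_convergent)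
    then have "convergent (\<lambda>n. f n x - f 0 x)" 
      unfolding sum_lessThan_telescope[of "\<lambda>n. f n x"] .
    then have "convergent (\<lambda>n. f n x - f 0 x + f 0 x)" by (intro convergent_add convergent_const)
    then show "(\<lambda>k. f k x) \<longlonglongrightarrow> lim (\<lambda>k. f k x)" by (simp add: convergent_LIMSEQ_iff)
  qed
  define g where "g = (\<lambda>x. lim (\<lambda>k. f k x))"
  have gm [measurable]: "g \<in> borel_measurable lebesgue" unfolding g_def by (rule borel_measurable_lim_metric) measurable
  have gd: "(\<integral>\<^sup>+x. ennreal ((cmod (g x - f k x))\<^sup>2) \<partial>lebesgue) \<le> ennreal ((1/4) ^ k)" for k
  proof -
    have "(\<integral>\<^sup>+x. ennreal ((cmod (g x - f k x))\<^sup>2) \<partial>lebesgue) =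
        (\<integral>\<^sup>+x. liminf (\<lambda>j. ennreal ((cmod (f j x - f k x))\<^sup>2)) \<partial>lebesgue)"
    proof (rule nn_integral_cong_AE)
      show "AE x in lebesgue. ennreal ((cmod (g x - f k x))\<^sup>2) = liminf (\<lambda>j. ennreal ((cmod (f j x - f k x))\<^sup>2))"
        using conv
      proof eventually_elim
        fix x assume "(\<lambda>k. f k x) \<longlonglongrightarrow> lim (\<lambda>k. f k x)"
        then have "(\<lambda>j. ennreal ((cmod (f j x - f k x))\<^sup>2)) \<longlonglongrightarrow> ennreal ((cmod (g x - f k x))\<^sup>2)"
          unfolding g_def by (intro tendsto_intros)
        then show "ennreal ((cmod (g x - f k x))\<^sup>2) = liminf (\<lambda>j. ennreal ((cmod (f j x - f k x))\<^sup>2))"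
          by (metis lim_imp_Liminf sequentially_bot)
      qed
    qed
    also have "\<dots> \<le> liminf (\<lambda>j. \<integral>\<^sup>+x. ennreal ((cmod (f j x - f k x))\<^sup>2) \<partial>lebesgue)"
      by (rule nn_integral_liminf) measurable
    also have "\<dots> \<le> liminf (\<lambda>j. ennreal ((1/4) ^ k))"
      by (rule Liminf_mono) (use fd in \<open>auto intro: eventually_sequentiallyI[of k]\<close>)
    also have "\<dots> = ennreal ((1/4) ^ k)" by (simp add: Liminf_const)
    finally show ?thesis .
  qed
  have "sq_integrable lebesgue (\<lambda>x. g x - f 0 x)"
    unfolding sq_integrable_def
  proof
    show "integrable lebesgue (\<lambda>x. (cmod (g x - f 0 x))\<^sup>2)"
      unfolding integrable_iff_bounded using le_less_trans[OF gd[of 0] ennreal_less_top] by simp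
  qed measurable
  from sq_integrable_add[OF this f(1)[of 0]] have g: "sq_integrable lebesgue g" by simp
  define G where "G = L2_of UNIV g"
  have Gk: "norm (X (r k) - G) \<le> (1/2) ^ k" for k
  proof -
    have "ennreal ((norm (G - X (r k)))\<^sup>2) \<le> ennreal ((1/4) ^ k)"
      using gd[of k] nn_integral_sq_norm[OF g f(1)[of k]] by (simp add: G_def f(2))
    then have "(norm (G - X (r k)))\<^sup>2 \<le> (1/4) ^ k" by simp
    also have "(1/4) ^ k = ((1/2) ^ k :: real)\<^sup>2" by (simp add: power2_eq_square flip: power_mult_distrib)
    finally show ?thesis by (simp add: norm_minus_commute abs_le_square_iff[symmetric])
  qed
  have "X \<longlonglongrightarrow> G"
  proof (rule LIMSEQ_I)
    fix e :: real assume "e > 0"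
    then obtain k where k: "(1/2) ^ k < e / 2" using real_arch_pow_inv[of "e / 2" "1/2"] by auto
    have "norm (X n - G) < e" if "n \<ge> r k" for n
    proof -
      have "norm (X n - X (r k)) < (1/2) ^ k" by (rule N) (use rN[of k k] that in auto)
      then show ?thesis using norm_triangle_ineq[of "X n - X (r k)" "X (r k) - G"] Gk[of k] k by simp
    qed
    then show "\<exists>no. \<forall>n\<ge>no. norm (X n - G) < e" by blast
  qed
  then show "convergent X" by (auto simp: convergent_def)
qed

lemma csubspace_L2_on: assumes I: "I \<in> sets lebesgue" shows "csubspace (L2_on I)"
proof (rule csubspaceI)
  show "0 \<in> L2_on I" unfolding L2_on_def
    by (rule CollectI, rule exI[of _ "\<lambda>_. 0"]) (simp add: L2_of_zero sq_integrable_def)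
  fix F G c assume "F \<in> L2_on I" "G \<in> L2_on I"
  then obtain u v where "F = L2_of I u" "sq_integrable (lebesgue_on I) u" "G = L2_of I v" "sq_integrable (lebesgue_on I) v"
    by (auto simp: L2_on_def)
  then show "F + c *C G \<in> L2_on I" unfolding L2_on_def
    by (intro CollectI exI[of _ "\<lambda>x. u x + c * v x"])
       (simp add: L2_of_lincomb[OF I] sq_integrable_add sq_integrable_scale)
qed

text \<open>The space is the orthogonal complement of the functions supported outside \<open>I\<close>, and orthogonal complements are closed.\<close>

lemma closed_L2_on: assumes I: "I \<in> sets lebesgue" shows "closed (L2_on I)"
proof -
  have cI: "- I \<in> sets lebesgue" using I by (simp add: Compl_in_sets_lebesgue)
  have "L2_on I = orthocomp (L2_on (- I))"
  proof
    have z: "cinner (L2_of (- I) v) (L2_of I u) = 0" if "sq_integrable (lebesgue_on (- I)) v" "sq_integrable (lebesgue_on I) u" for u v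
    proof -
      have "cinner (L2_of (- I) v) (L2_of I u) = (LINT x|lebesgue. cnj (if x \<in> - I then v x else 0) * (if x \<in> I then u x else 0))"
        unfolding L2_of_UNIV[of I] L2_of_UNIV[of "- I"]
        using cinner_L2_of[of UNIV "\<lambda>x. if x \<in> - I then v x else 0" "\<lambda>x. if x \<in> I then u x else 0"]
          that sq_integrable_extend[OF I, of u] sq_integrable_extend[OF cI, of v] by simp
      also have "(\<lambda>x. cnj (if x \<in> - I then v x else 0) * (if x \<in> I then u x else 0)) = (\<lambda>x. 0)" by auto
      finally show ?thesis by simp
    qed
    then show "L2_on I \<subseteq> orthocomp (L2_on (- I))" by (auto simp: L2_on_def orthocomp_def)
    show "orthocomp (L2_on (- I)) \<subseteq> L2_on I"
    proof
      fix F assume F: "F \<in> orthocomp (L2_on (- I))"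
      obtain u where u: "sq_integrable lebesgue u" "F = L2_of UNIV u" by (rule L2_cases)
      have uJ: "sq_integrable (lebesgue_on J) u" if "J \<in> sets lebesgue" for J
      proof -
        have "integrable lebesgue (\<lambda>x. indicator J x *\<^sub>R (cmod (u x))\<^sup>2)"
          by (rule Bochner_Integration.integrable_bound[where f = "\<lambda>x. (cmod (u x))\<^sup>2"])
             (use u(1) that in \<open>auto simp: sq_integrable_def indicator_def\<close>)
        then show ?thesis using u(1) that
          by (auto simp: sq_integrable_def integrable_restrict_space intro: measurable_restrict_space1)
      qed
      have "L2_of I u + 1 *C L2_of (- I) u = L2_of UNIV (\<lambda>x. (if x \<in> I then u x else 0) + 1 * (if x \<in> - I then u x else 0))"
        unfolding L2_of_UNIV[of I] L2_of_UNIV[of "- I"]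
        by (rule L2_of_lincomb[symmetric])
           (use uJ[OF I] uJ[OF cI] sq_integrable_extend[OF I, of u] sq_integrable_extend[OF cI, of u] in simp_all)
      also have "\<dots> = F" unfolding u(2) by (rule arg_cong[of _ _ "L2_of UNIV"]) auto
      finally have dec: "F = L2_of I u + L2_of (- I) u" by (simp add: scaleC_one)
      have "L2_of (- I) u \<in> L2_on (- I)" using uJ[OF cI] by (auto simp: L2_on_def)
      then have "cinner (L2_of (- I) u) F = 0" using F by (auto simp: orthocomp_def)
      then have "cinner (L2_of (- I) u) (L2_of (- I) u) = 0"
        unfolding dec cinner_add_right z[OF uJ[OF cI] uJ[OF I]] by simp
      then have "F = L2_of I u" using dec by simp
      then show "F \<in> L2_on I" using uJ[OF I] by (auto simp: L2_on_def)
    qed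
  qed
  then show ?thesis by (simp add: closed_orthocomp)
qed

lemma sq_integrable_restrict:
  assumes "sq_integrable M u" "K \<in> sets M"
  shows "sq_integrable M (\<lambda>x. if x \<in> K then u x else 0)"
proof -
  have [measurable]: "u \<in> borel_measurable M" "K \<in> sets M" using assms by (auto simp: sq_integrable_def)
  have "integrable M (\<lambda>x. (cmod (if x \<in> K then u x else 0))\<^sup>2)"
    by (rule Bochner_Integration.integrable_bound[where f = "\<lambda>x. (cmod (u x))\<^sup>2"])
       (use assms in \<open>auto simp: sq_integrable_def\<close>)
  moreover have "(\<lambda>x. if x \<in> K then u x else 0) \<in> borel_measurable M" by measurable
  ultimately show ?thesis by (simp add: sq_integrable_def)
qed

text \<open>Restriction to an exhausting sequence of compact subsets converges by dominated convergence.\<close>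

lemma compactly_supported_dense:
  assumes I: "open I"
  shows "L2_on I \<subseteq> closure {f \<in> L2_on I. compactly_supported_in I f}"
proof
  have IL: "I \<in> sets lebesgue" using I by auto
  fix F assume "F \<in> L2_on I"
  then obtain u where u: "sq_integrable (lebesgue_on I) u" "F = L2_of I u" by (auto simp: L2_on_def)
  have [measurable]: "u \<in> borel_measurable (lebesgue_on I)" using u by (simp add: sq_integrable_def)
  obtain K where K: "\<And>n. compact (K n)" "\<And>n. K n \<subseteq> I" "\<And>n. K n \<subseteq> interior (K (Suc n))" "\<Union>(range K) = I"
    using open_Union_compact_subsets[OF I] by metis
  have Kinc: "K m \<subseteq> K n" if "m \<le> n" for m n
    using that by (induction rule: dec_induct) (use K(3) interior_subset in blast)+
  have KL: "K n \<in> sets (lebesgue_on I)" for n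
    using lmeasurable_compact[OF K(1)] K(2) IL by (auto simp: sets_restrict_space_iff dest: fmeasurableD)
  define v where "v = (\<lambda>n x. if x \<in> K n then u x else 0)"
  have v: "sq_integrable (lebesgue_on I) (v n)" for n unfolding v_def by (rule sq_integrable_restrict[OF u(1) KL])
  have [measurable]: "v n \<in> borel_measurable (lebesgue_on I)" for n using v by (simp add: sq_integrable_def)
  have "(\<lambda>n. LINT x|lebesgue_on I. (cmod (v n x - u x))\<^sup>2) \<longlonglongrightarrow> (LINT x|lebesgue_on I. 0)"
  proof (rule integral_dominated_convergence[where w = "\<lambda>x. (cmod (u x))\<^sup>2"])
    show "integrable (lebesgue_on I) (\<lambda>x. (cmod (u x))\<^sup>2)" using u by (simp add: sq_integrable_def)
    show "AE x in lebesgue_on I. (\<lambda>n. (cmod (v n x - u x))\<^sup>2) \<longlonglongrightarrow> 0"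
    proof (rule AE_I2)
      fix x assume "x \<in> space (lebesgue_on I)"
      then obtain m where "x \<in> K m" using K(4) by auto
      then have "eventually (\<lambda>n. (cmod (v n x - u x))\<^sup>2 = 0) sequentially"
        using Kinc by (intro eventually_sequentiallyI[of m]) (auto simp: v_def)
      then show "(\<lambda>n. (cmod (v n x - u x))\<^sup>2) \<longlonglongrightarrow> 0" by (rule tendsto_eventually)
    qed
    show "AE x in lebesgue_on I. norm ((cmod (v n x - u x))\<^sup>2) \<le> (cmod (u x))\<^sup>2" for n
      by (rule AE_I2) (auto simp: v_def)
  qed measurable
  then have lim: "(\<lambda>n. (norm (L2_of I (v n) - F))\<^sup>2) \<longlonglongrightarrow> 0"
    unfolding u(2) L2_of_diff[OF IL v u(1), symmetric] norm_L2_of[OF IL sq_integrable_diff[OF v u(1)]] by simp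
  then have "(\<lambda>n. sqrt ((norm (L2_of I (v n) - F))\<^sup>2)) \<longlonglongrightarrow> sqrt 0" by (rule tendsto_real_sqrt)
  then have "(\<lambda>n. L2_of I (v n) - F) \<longlonglongrightarrow> 0" by (simp add: tendsto_norm_zero_iff)
  then have "(\<lambda>n. L2_of I (v n)) \<longlonglongrightarrow> F" by (rule LIM_zero_cancel)
  moreover have "compactly_supported_in I (L2_of I (v n))" for n
    unfolding compactly_supported_in_def using v[of n] K(1,2)[of n]
    by (intro exI[of _ "v n"] exI[of _ "K n"]) (auto simp: v_def)
  moreover have "L2_of I (v n) \<in> L2_on I" for n using v[of n] by (auto simp: L2_on_def)
  ultimately show "F \<in> closure {f \<in> L2_on I. compactly_supported_in I f}"
    unfolding closure_sequential by (intro exI[of _ "\<lambda>n. L2_of I (v n)"]) auto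
qed

section \<open>Local absolute continuity\<close>

lemma AE_lebesgue_on_iff:
  assumes "I \<in> sets lebesgue"
  shows "(AE x in lebesgue_on I. P x) \<longleftrightarrow> (\<exists>N. negligible N \<and> (\<forall>x\<in>I - N. P x))"
proof
  assume "AE x in lebesgue_on I. P x"
  then have "AE x in lebesgue. x \<in> I \<longrightarrow> P x" using assms by (simp add: AE_restrict_space_iff)
  then obtain N where "N \<in> null_sets lebesgue" "{x \<in> space lebesgue. \<not> (x \<in> I \<longrightarrow> P x)} \<subseteq> N"
    unfolding eventually_ae_filter by blast
  then show "\<exists>N. negligible N \<and> (\<forall>x\<in>I - N. P x)"
    by (intro exI[of _ N]) (auto simp: negligible_iff_null_sets)
next
  assume "\<exists>N. negligible N \<and> (\<forall>x\<in>I - N. P x)"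
  then obtain N where "N \<in> null_sets lebesgue" "\<forall>x\<in>I - N. P x" by (auto simp: negligible_iff_null_sets)
  then have "AE x in lebesgue. x \<in> I \<longrightarrow> P x"
    unfolding eventually_ae_filter by (intro bexI[of _ N]) auto
  then show "AE x in lebesgue_on I. P x" using assms by (simp add: AE_restrict_space_iff)
qed

text \<open>An open set is a countable union of open intervals whose closures it contains, so exceptional sets may be controlled locally.\<close>

lemma AE_lebesgue_on_local:
  fixes I :: "real set"
  assumes I: "open I" and loc: "\<And>c d. {c..d} \<subseteq> I \<Longrightarrow> negligible {x\<in>{c<..<d}. \<not> P x}"
  shows "AE x in lebesgue_on I. P x"
proof -
  define B where "B = (\<lambda>p. {x\<in>{fst p<..<snd p}. \<not> P x})"
  define Q where "Q = {p \<in> \<rat> \<times> \<rat>. {fst p..snd p} \<subseteq> I}"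
  have "countable (\<rat> \<times> \<rat> :: (real \<times> real) set)" using countable_rat by (intro countable_SIGMA)
  then have Q: "countable Q" by (rule countable_subset[rotated]) (auto simp: Q_def)
  have N: "negligible (\<Union>(B ` Q))"
  proof (rule negligible_countable_Union[OF countable_image[OF Q]])
    fix S assume "S \<in> B ` Q"
    then obtain p where p: "p \<in> Q" "S = B p" by blast
    then have "{fst p..snd p} \<subseteq> I" by (simp add: Q_def)
    then show "negligible S" unfolding p(2) B_def by (rule loc)
  qed
  have "P x" if x: "x \<in> I - \<Union>(B ` Q)" for x
  proof (rule ccontr)
    assume nP: "\<not> P x"
    have "x \<in> I" using x by simp
    then obtain e where e: "e > 0" "ball x e \<subseteq> I" using I open_contains_ball by blast
    obtain c where c: "c \<in> \<rat>" "x - e < c" "c < x" using Rats_dense_in_real[of "x - e" x] e(1) by auto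
    obtain d where d: "d \<in> \<rat>" "x < d" "d < x + e" using Rats_dense_in_real[of x "x + e"] e(1) by auto
    have "{c..d} \<subseteq> ball x e" using c d by (auto simp: dist_real_def)
    then have "{c..d} \<subseteq> I" using e(2) by (rule subset_trans)
    then have "(c, d) \<in> Q" using c(1) d(1) by (simp add: Q_def)
    moreover have "x \<in> B (c, d)" using c d nP by (simp add: B_def)
    ultimately have "x \<in> \<Union>(B ` Q)" by (rule UN_I)
    then show False using x by simp
  qed
  moreover have IL: "I \<in> sets lebesgue" using I by auto
  ultimately show ?thesis unfolding AE_lebesgue_on_iff[OF IL]
    by (intro exI[of _ "\<Union>(B ` Q)"] conjI ballI N)
qed

lemma AC_loc_has_vector_derivative_AE:
  assumes f: "AC_loc I f" and I: "open I"
  shows "AE x in lebesgue_on I. (f has_vector_derivative vector_derivative f (at x)) (at x)"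
proof (rule AE_lebesgue_on_local[OF I])
  fix c d assume cd: "{c..d} \<subseteq> I"
  show "negligible {x\<in>{c<..<d}. \<not> (f has_vector_derivative vector_derivative f (at x)) (at x)}"
  proof (cases "c \<le> d")
    case True
    have "AC_on c d f" using f cd by (simp add: AC_loc_def)
    from AC_on_has_vector_derivative[OF this True] show ?thesis
      by (rule negligible_subset) (auto simp: less_imp_le)
  qed simp
qed

lemma AC_loc_has_integral:
  assumes f: "AC_loc I f" and I: "open I" and g: "AE x in lebesgue_on I. (f has_vector_derivative g x) (at x)"
    and st: "s \<le> t" "{s..t} \<subseteq> I"
  shows "(g has_integral (f t - f s)) {s..t}" "g absolutely_integrable_on {s..t}"
proof -
  obtain N where N: "negligible N" "\<forall>x\<in>I - N. (f has_vector_derivative g x) (at x)"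
    using g I by (auto simp: AE_lebesgue_on_iff)
  have eq: "g x = vector_derivative f (at x)" if "x \<in> {s..t} - N" for x
  proof -
    have "(f has_vector_derivative g x) (at x)" using that st N(2) by blast
    from vector_derivative_at[OF this] show ?thesis by simp
  qed
  have f': "AC_on s t f" using f st by (simp add: AC_loc_def)
  show "(g has_integral (f t - f s)) {s..t}"
    by (rule has_integral_spike[OF N(1) eq AC_on_has_integral[OF f' st(1)]]) (use st in auto)
  show "g absolutely_integrable_on {s..t}"
    by (rule absolutely_integrable_spike[OF AC_on_absolutely_integrable[OF f' st(1)] N(1) eq])
qed

lemma AC_loc_mult: "AC_loc I f \<Longrightarrow> AC_loc I g \<Longrightarrow> AC_loc I (\<lambda>x. f x * g x)"
  by (simp add: AC_loc_def AC_on_mult)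
lemma AC_loc_add: "AC_loc I f \<Longrightarrow> AC_loc I g \<Longrightarrow> AC_loc I (\<lambda>x. f x + g x)"
  by (simp add: AC_loc_def AC_on_add)
lemma AC_loc_const: "AC_loc I (\<lambda>_. z)"
  by (simp add: AC_loc_def AC_on_const)
lemma AC_loc_scale: "AC_loc I f \<Longrightarrow> AC_loc I (\<lambda>x. c * f x)"
  by (intro AC_loc_mult AC_loc_const)
lemma AC_loc_diff: "AC_loc I f \<Longrightarrow> AC_loc I g \<Longrightarrow> AC_loc I (\<lambda>x. f x - g x)"
  using AC_loc_add[of I f "\<lambda>x. (-1) * g x"] AC_loc_scale[of I g "-1"] by simp
lemma AC_loc_sum: "(\<And>i. i \<in> A \<Longrightarrow> AC_loc I (f i)) \<Longrightarrow> AC_loc I (\<lambda>x. \<Sum>i\<in>A. f i x)"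
  by (simp add: AC_loc_def AC_on_sum)
lemma AC_loc_cnj: "AC_loc I f \<Longrightarrow> AC_loc I (\<lambda>x. cnj (f x))"
  by (simp add: AC_loc_def AC_on_cnj)
lemma AC_loc_continuous_on:
  assumes f: "AC_loc I f" and I: "open I" shows "continuous_on I f"
proof (rule continuous_at_imp_continuous_on, rule ballI)
  fix x assume "x \<in> I"
  then obtain e where e: "e > 0" "cball x e \<subseteq> I" using I open_contains_cball by blast
  then have "{x - e..x + e} \<subseteq> I" by (simp add: cball_eq_atLeastAtMost)
  then have "continuous_on {x - e..x + e} f" using f AC_on_continuous_on by (auto simp: AC_loc_def)
  then show "isCont f x" by (rule continuous_on_interior) (use e in simp)
qed

text \<open>A nonempty open set is not negligible, so the set where the function is nonzero must be empty.\<close>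

lemma AE_zero_continuous:
  fixes f :: "real \<Rightarrow> complex"
  assumes I: "open I" and f: "continuous_on I f" and ae: "AE x in lebesgue_on I. f x = 0" and x: "x \<in> I"
  shows "f x = 0"
proof (rule ccontr)
  assume nz: "f x \<noteq> 0"
  obtain N where N: "negligible N" "\<forall>x\<in>I - N. f x = 0" using ae I by (auto simp: AE_lebesgue_on_iff)
  have "open {x \<in> I. f x \<noteq> 0}"
    using continuous_open_preimage[OF f I, of "- {0}"] by (auto simp: vimage_def Int_def open_Compl)
  moreover have "{x \<in> I. f x \<noteq> 0} \<subseteq> N" using N(2) by blast
  then have "negligible {x \<in> I. f x \<noteq> 0}" by (rule negligible_subset[OF N(1)])
  ultimately have "{x \<in> I. f x \<noteq> 0} = {}" using open_not_negligible by blast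
  then show False using x nz by blast
qed

section \<open>The first-order system of quasi-derivatives\<close>

text \<open>The derivative of the quasi-derivative of order \<open>k\<close> in terms of the others. Dividing by \<open>p 0\<close> in the middle equation keeps only the
  locally integrable coefficient \<open>1 / p 0\<close>.\<close>

definition rhs :: "nat \<Rightarrow> (nat \<Rightarrow> real \<Rightarrow> complex) \<Rightarrow> (nat \<Rightarrow> real \<Rightarrow> complex) \<Rightarrow> nat \<Rightarrow> real \<Rightarrow> complex" where
  "rhs n p q k x = (if k + 1 < n then q (k + 1) x
     else if k + 1 = n then q n x / p 0 x
     else p (k + 1 - n) x * q (2 * n - 1 - k) x - q (k + 1) x)"

definition qsystem :: "nat \<Rightarrow> (nat \<Rightarrow> real \<Rightarrow> complex) \<Rightarrow> real set \<Rightarrow> (nat \<Rightarrow> real \<Rightarrow> complex) \<Rightarrow> bool" where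
  "qsystem n p I q \<longleftrightarrow> (\<forall>k<2 * n. AC_loc I (q k)) \<and>
     (\<forall>k<2 * n. AE x in lebesgue_on I. (q k has_vector_derivative rhs n p q k x) (at x))"

text \<open>Replacing the almost-everywhere definitions of the quasi-derivatives by a first-order system is the form in which uniqueness and
  the Lagrange identity are proved.\<close>

lemma quasi_derivatives_iff:
  assumes I: "open I" and n: "n \<ge> 1" and p0: "AE x in lebesgue_on I. p 0 x \<noteq> 0"
  shows "quasi_derivatives n p I u q \<longleftrightarrow> qsystem n p I q \<and> (\<forall>x\<in>I. q 0 x = u x)"
proof
  assume q: "quasi_derivatives n p I u q"
  have ac: "AC_loc I (q k)" if "k < 2 * n" for k using q that unfolding quasi_derivatives_def by blast
  have "AE x in lebesgue_on I. (q k has_vector_derivative rhs n p q k x) (at x)" if k: "k < 2 * n" for k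
  proof -
    have d: "AE x in lebesgue_on I. (q k has_vector_derivative vector_derivative (q k) (at x)) (at x)"
      by (rule AC_loc_has_vector_derivative_AE[OF ac[OF k] I])
    consider "k + 1 < n" | "k + 1 = n" | "k + 1 > n" by linarith
    then have "AE x in lebesgue_on I. vector_derivative (q k) (at x) = rhs n p q k x"
    proof cases
      case 1
      then have "AE x in lebesgue_on I. q (k + 1) x = vector_derivative (q (k + 1 - 1)) (at x)"
        using q unfolding quasi_derivatives_def by (metis atLeastLessThan_iff le_add2)
      then show ?thesis by eventually_elim (use 1 in \<open>simp add: rhs_def\<close>)
    next
      case 2
      have "AE x in lebesgue_on I. q n x = p 0 x * vector_derivative (q (n - 1)) (at x)"
        using q unfolding quasi_derivatives_def by blast
      with p0 show ?thesis by eventually_elim (use 2 in \<open>auto simp: rhs_def\<close>)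
    next
      case 3
      define j where "j = k + 1 - n"
      have j: "j \<in> {1..n}" "n + j = k + 1" "n + j - 1 = k" "n - j = 2 * n - 1 - k" using 3 k by (auto simp: j_def)
      have "AE x in lebesgue_on I. q (n + j) x = p j x * q (n - j) x - vector_derivative (q (n + j - 1)) (at x)"
        using q j(1) unfolding quasi_derivatives_def by blast
      then show ?thesis unfolding j(2-4)
        by eventually_elim (use 3 in \<open>simp add: rhs_def j_def\<close>)
    qed
    with d show ?thesis by eventually_elim simp
  qed
  then show "qsystem n p I q \<and> (\<forall>x\<in>I. q 0 x = u x)"
    using ac q unfolding qsystem_def quasi_derivatives_def by blast
next
  assume q: "qsystem n p I q \<and> (\<forall>x\<in>I. q 0 x = u x)"
  have d: "AE x in lebesgue_on I. vector_derivative (q k) (at x) = rhs n p q k x" if "k < 2 * n" for k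
  proof -
    have "AE x in lebesgue_on I. (q k has_vector_derivative rhs n p q k x) (at x)"
      using q that by (simp add: qsystem_def)
    then show ?thesis by eventually_elim (rule vector_derivative_at)
  qed
  show "quasi_derivatives n p I u q"
    unfolding quasi_derivatives_def
  proof (intro conjI ballI)
    show "\<forall>k<2 * n. AC_loc I (q k)" using q by (simp add: qsystem_def)
    show "q 0 x = u x" if "x \<in> I" for x using q that by blast
    show "AE x in lebesgue_on I. q k x = vector_derivative (q (k - 1)) (at x)" if k: "k \<in> {1..<n}" for k
    proof -
      have "AE x in lebesgue_on I. vector_derivative (q (k - 1)) (at x) = rhs n p q (k - 1) x"
        by (rule d) (use k in auto)
      then show ?thesis by eventually_elim (use k in \<open>auto simp: rhs_def\<close>)
    qed
    have "AE x in lebesgue_on I. vector_derivative (q (n - 1)) (at x) = rhs n p q (n - 1) x"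
      by (rule d) (use n in auto)
    with p0 show "AE x in lebesgue_on I. q n x = p 0 x * vector_derivative (q (n - 1)) (at x)"
      by eventually_elim (use n in \<open>auto simp: rhs_def\<close>)
    show "AE x in lebesgue_on I. q (n + k) x = p k x * q (n - k) x - vector_derivative (q (n + k - 1)) (at x)"
      if k: "k \<in> {1..n}" for k
    proof -
      have A: "AE x in lebesgue_on I. vector_derivative (q (n + k - 1)) (at x) = rhs n p q (n + k - 1) x"
        by (rule d) (use k in auto)
      have "\<not> n + k - 1 + 1 < n" "n + k - 1 + 1 \<noteq> n" "n + k - 1 + 1 - n = k" "2 * n - 1 - (n + k - 1) = n - k"
        "n + k - 1 + 1 = n + k" using k by auto
      then have eq: "rhs n p q (n + k - 1) x = p k x * q (n - k) x - q (n + k) x" for x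
        unfolding rhs_def by simp
      from A show ?thesis unfolding eq by eventually_elim simp
    qed
  qed
qed

lemma rhs_lincomb:
  "rhs n p (\<lambda>k x. \<Sum>j\<in>A. c j * q j k x) k x = (\<Sum>j\<in>A. c j * rhs n p (q j) k x)"
  by (auto simp: rhs_def sum_distrib_left sum_divide_distrib sum_subtractf algebra_simps)

lemma qsystem_lincomb:
  assumes "finite A" "\<And>j. j \<in> A \<Longrightarrow> qsystem n p I (q j)"
  shows "qsystem n p I (\<lambda>k x. \<Sum>j\<in>A. c j * q j k x)"
  unfolding qsystem_def
proof (intro conjI allI impI)
  fix k assume k: "k < 2 * n"
  show "AC_loc I (\<lambda>x. \<Sum>j\<in>A. c j * q j k x)"
    using assms(2) k by (intro AC_loc_sum AC_loc_scale) (simp add: qsystem_def)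
  have "AE x in lebesgue_on I. \<forall>j\<in>A. (q j k has_vector_derivative rhs n p (q j) k x) (at x)"
    using assms k by (simp add: eventually_ball_finite_distrib qsystem_def)
  then show "AE x in lebesgue_on I. ((\<lambda>x. \<Sum>j\<in>A. c j * q j k x) has_vector_derivative rhs n p (\<lambda>k x. \<Sum>j\<in>A. c j * q j k x) k x) (at x)"
  proof eventually_elim
    fix x assume "\<forall>j\<in>A. (q j k has_vector_derivative rhs n p (q j) k x) (at x)"
    then show "((\<lambda>x. \<Sum>j\<in>A. c j * q j k x) has_vector_derivative rhs n p (\<lambda>k x. \<Sum>j\<in>A. c j * q j k x) k x) (at x)"
      unfolding rhs_lincomb by (intro has_vector_derivative_sum has_vector_derivative_mult_right) auto
  qed
qed

lemma qsystem_cnj: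
  assumes q: "qsystem n p I q" and p: "\<And>k. k \<le> n \<Longrightarrow> AE x in lebesgue_on I. p k x \<in> \<real>"
  shows "qsystem n p I (\<lambda>k x. cnj (q k x))"
  unfolding qsystem_def
proof (intro conjI allI impI)
  fix k assume k: "k < 2 * n"
  show "AC_loc I (\<lambda>x. cnj (q k x))" using q k by (intro AC_loc_cnj) (simp add: qsystem_def)
  have 1: "AE x in lebesgue_on I. (q k has_vector_derivative rhs n p q k x) (at x)" using q k by (simp add: qsystem_def)
  have 2: "AE x in lebesgue_on I. p 0 x \<in> \<real>" "AE x in lebesgue_on I. p (k + 1 - n) x \<in> \<real>" using p k by auto
  from 1 2 show "AE x in lebesgue_on I. ((\<lambda>x. cnj (q k x)) has_vector_derivative rhs n p (\<lambda>k x. cnj (q k x)) k x) (at x)"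
  proof eventually_elim
    fix x assume x: "(q k has_vector_derivative rhs n p q k x) (at x)" "p 0 x \<in> \<real>" "p (k + 1 - n) x \<in> \<real>"
    have "rhs n p (\<lambda>k x. cnj (q k x)) k x = cnj (rhs n p q k x)"
      using x(2,3) by (simp add: rhs_def Reals_cnj_iff)
    then show "((\<lambda>x. cnj (q k x)) has_vector_derivative rhs n p (\<lambda>k x. cnj (q k x)) k x) (at x)"
      using has_vector_derivative_cnj[OF x(1)] by simp
  qed
qed

section \<open>The Lagrange identity\<close>

text \<open>The symplectic form that appears as boundary term. It is bilinear; conjugation is inserted where it is used.\<close>

definition bracket :: "nat \<Rightarrow> (nat \<Rightarrow> complex) \<Rightarrow> (nat \<Rightarrow> complex) \<Rightarrow> complex" where
  "bracket n u v = (\<Sum>l<n. u l * v (2 * n - 1 - l) - u (2 * n - 1 - l) * v l)"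

text \<open>The terms with the coefficients \<open>p k\<close> are symmetric in the two functions and cancel, and the remaining sum telescopes.\<close>

lemma bracket_derivative:
  assumes n: "n \<ge> 1" and q: "\<And>k. k < 2 * n \<Longrightarrow> (q k has_vector_derivative rhs n p q k x) (at x)"
    and r: "\<And>k. k < 2 * n \<Longrightarrow> (r k has_vector_derivative rhs n p r k x) (at x)"
  shows "((\<lambda>x. bracket n (\<lambda>k. q k x) (\<lambda>k. r k x)) has_vector_derivative q (2 * n) x * r 0 x - q 0 x * r (2 * n) x) (at x)"
proof -
  let ?t = "\<lambda>l. (q l x * rhs n p r (2 * n - 1 - l) x + rhs n p q l x * r (2 * n - 1 - l) x) -
     (q (2 * n - 1 - l) x * rhs n p r l x + rhs n p q (2 * n - 1 - l) x * r l x)"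
  let ?a = "\<lambda>l. q l x * r (2 * n - l) x - q (2 * n - l) x * r l x"
  obtain m where m: "n = Suc m" using n by (cases n) auto
  have up: "rhs n p f (2 * n - 1 - l) x = p (n - l) x * f l x - f (2 * n - l) x" if "l < n" for l f
  proof -
    have "\<not> 2 * n - 1 - l + 1 < n" "2 * n - 1 - l + 1 \<noteq> n" "2 * n - 1 - l + 1 - n = n - l"
      "2 * n - 1 - (2 * n - 1 - l) = l" "2 * n - 1 - l + 1 = 2 * n - l" using that by auto
    then show ?thesis unfolding rhs_def by simp
  qed
  have low: "?t l = ?a (Suc l) - ?a l" if "l < m" for l
  proof -
    have r1: "rhs n p f l x = f (Suc l) x" for f using that m by (simp add: rhs_def)
    have i: "2 * n - 1 - l = 2 * n - Suc l" by simp
    have "rhs n p f (2 * n - Suc l) x = p (n - l) x * f l x - f (2 * n - l) x" for f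
      using up[of l f] that m unfolding i by simp
    then show ?thesis unfolding r1 i by (simp only: left_diff_distrib right_diff_distrib) (simp only: mult_ac, simp)
  qed
  have top: "?t m = - ?a m"
  proof -
    have r1: "rhs n p f m x = f n x / p 0 x" for f using m by (simp add: rhs_def)
    have i: "2 * n - 1 - m = n" using m by simp
    have "m < n" using m by simp
    from up[OF this] have u: "rhs n p f n x = p (n - m) x * f m x - f (2 * n - m) x" for f unfolding i .
    show ?thesis unfolding i r1 u by (simp add: algebra_simps)
  qed
  have "(\<Sum>l<n. ?t l) = (\<Sum>l<m. ?a (Suc l) - ?a l) + ?t m"
    unfolding m using low[unfolded m] by simp
  also have "\<dots> = - ?a 0" unfolding top sum_lessThan_telescope[of ?a m] by simp
  finally have sum: "(\<Sum>l<n. ?t l) = q (2 * n) x * r 0 x - q 0 x * r (2 * n) x" by simp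
  have "((\<lambda>x. \<Sum>l<n. q l x * r (2 * n - 1 - l) x - q (2 * n - 1 - l) x * r l x) has_vector_derivative (\<Sum>l<n. ?t l)) (at x)"
    by (intro has_vector_derivative_sum has_vector_derivative_diff has_vector_derivative_mult q r) auto
  then show ?thesis unfolding sum bracket_def .
qed

lemma qsystem_all_AE:
  assumes "qsystem n p I q"
  shows "AE x in lebesgue_on I. \<forall>k\<in>{..<2 * n}. (q k has_vector_derivative rhs n p q k x) (at x)"
  using assms by (simp add: eventually_ball_finite_distrib qsystem_def)

text \<open>The bracket is locally absolutely continuous, hence the integral of its derivative.\<close>

lemma Lagrange_identity:
  assumes I: "open I" and n: "n \<ge> 1" and q: "qsystem n p I q" and r: "qsystem n p I r"
    and st: "s \<le> t" "{s..t} \<subseteq> I"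
  shows "((\<lambda>x. q (2 * n) x * r 0 x - q 0 x * r (2 * n) x) has_integral
     (bracket n (\<lambda>k. q k t) (\<lambda>k. r k t) - bracket n (\<lambda>k. q k s) (\<lambda>k. r k s))) {s..t}"
proof (rule AC_loc_has_integral(1)[OF _ I _ st])
  show "AC_loc I (\<lambda>x. bracket n (\<lambda>k. q k x) (\<lambda>k. r k x))"
    unfolding bracket_def using q r
    by (intro AC_loc_sum AC_loc_diff AC_loc_mult) (auto simp: qsystem_def)
  from qsystem_all_AE[OF q] qsystem_all_AE[OF r]
  show "AE x in lebesgue_on I. ((\<lambda>x. bracket n (\<lambda>k. q k x) (\<lambda>k. r k x)) has_vector_derivative
     q (2 * n) x * r 0 x - q 0 x * r (2 * n) x) (at x)"
    by eventually_elim (rule bracket_derivative[OF n], auto)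
qed


section \<open>Uniqueness for the initial value problem\<close>

lemma rhs_bound:
  assumes n: "n \<ge> 1" and k: "k < 2 * n" and z: "q (2 * n) x = z * q 0 x"
  shows "cmod (rhs n p q k x) \<le> (1 + cmod z + cmod (1 / p 0 x) + (\<Sum>j=1..n. cmod (p j x))) * (\<Sum>j<2 * n. cmod (q j x))"
proof -
  let ?A = "1 + cmod z + cmod (1 / p 0 x) + (\<Sum>j=1..n. cmod (p j x))" and ?S = "\<Sum>j<2 * n. cmod (q j x)"
  have S0: "0 \<le> ?S" by (rule sum_nonneg) simp
  have P0: "0 \<le> (\<Sum>j=1..n. cmod (p j x))" by (rule sum_nonneg) simp
  have qS: "cmod (q j x) \<le> ?S" if "j < 2 * n" for j by (rule member_le_sum) (use that in auto)
  have pP: "cmod (p j x) \<le> (\<Sum>j=1..n. cmod (p j x))" if "1 \<le> j" "j \<le> n" for j by (rule member_le_sum) (use that in auto)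
  consider "k + 1 < n" | "k + 1 = n" | "k + 1 > n" by linarith
  then show ?thesis
  proof cases
    case 1
    then have "cmod (rhs n p q k x) \<le> 1 * ?S" using qS[of "k + 1"] by (simp add: rhs_def)
    also have "\<dots> \<le> ?A * ?S" using P0 S0 by (intro mult_right_mono) auto
    finally show ?thesis .
  next
    case 2
    then have "cmod (rhs n p q k x) = cmod (1 / p 0 x) * cmod (q n x)" by (simp add: rhs_def norm_divide)
    also have "\<dots> \<le> cmod (1 / p 0 x) * ?S" using n by (intro mult_left_mono qS) auto
    also have "\<dots> \<le> ?A * ?S" using P0 S0 by (intro mult_right_mono) auto
    finally show ?thesis .
  next
    case 3
    define j where "j = k + 1 - n"
    have j: "1 \<le> j" "j \<le> n" "2 * n - 1 - k < 2 * n" using 3 k by (auto simp: j_def)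
    have r: "rhs n p q k x = p j x * q (2 * n - 1 - k) x - q (k + 1) x" using 3 by (simp add: rhs_def j_def)
    have "cmod (q (k + 1) x) \<le> (1 + cmod z) * ?S"
    proof (cases "k + 1 < 2 * n")
      case True
      have "cmod (q (k + 1) x) \<le> 1 * ?S" using qS[OF True] by simp
      also have "\<dots> \<le> (1 + cmod z) * ?S" using S0 by (intro mult_right_mono) auto
      finally show ?thesis .
    next
      case False
      then have "k + 1 = 2 * n" using k by simp
      then have "cmod (q (k + 1) x) = cmod z * cmod (q 0 x)" using z by (simp add: norm_mult)
      also have "\<dots> \<le> (1 + cmod z) * ?S" using n qS[of 0] by (intro mult_mono) auto
      finally show ?thesis .
    qed
    moreover have "cmod (p j x * q (2 * n - 1 - k) x) \<le> (\<Sum>j=1..n. cmod (p j x)) * ?S"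
      unfolding norm_mult using j P0 by (intro mult_mono pP qS) auto
    ultimately have "cmod (rhs n p q k x) \<le> (\<Sum>j=1..n. cmod (p j x)) * ?S + (1 + cmod z) * ?S"
      unfolding r by (intro norm_triangle_le_diff) linarith
    also have "\<dots> = (1 + cmod z + (\<Sum>j=1..n. cmod (p j x))) * ?S" by (simp add: algebra_simps)
    also have "\<dots> \<le> ?A * ?S" using S0 by (intro mult_right_mono) auto
    finally show ?thesis .
  qed
qed

lemma L1_loc_cmod: "L1_loc I f \<Longrightarrow> {c..d} \<subseteq> I \<Longrightarrow> (\<lambda>x. cmod (f x)) absolutely_integrable_on {c..d}"
  by (rule set_integrable_norm) (simp add: L1_loc_def)

text \<open>The set where the whole vector of quasi-derivatives vanishes is closed in \<open>I\<close> by continuity. It is open because on an interval so short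
  that the integral of the coefficient bound is small, the maximum of the vector is at most half of itself. Connectedness does the rest.\<close>

lemma qsystem_unique:
  assumes I: "open I" "connected I" and n: "n \<ge> 1" 
    and p: "L1_loc I (\<lambda>x. 1 / p 0 x)" "\<And>k. 1 \<le> k \<Longrightarrow> k \<le> n \<Longrightarrow> L1_loc I (p k)"
    and q: "qsystem n p I q" and z: "AE x in lebesgue_on I. q (2 * n) x = z * q 0 x"
    and c: "c \<in> I" "\<And>k. k < 2 * n \<Longrightarrow> q k c = 0" and x: "x \<in> I" and k: "k < 2 * n"
  shows "q k x = 0"
proof -
  define \<alpha> where "\<alpha> = (\<lambda>x. 1 + cmod z + cmod (1 / p 0 x) + (\<Sum>j=1..n. cmod (p j x)))"
  define S where "S = (\<lambda>x. \<Sum>j<2 * n. cmod (q j x))"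
  have \<alpha>0: "0 \<le> \<alpha> x" for x unfolding \<alpha>_def by (intro add_nonneg_nonneg sum_nonneg) auto
  have S0: "0 \<le> S x" for x unfolding S_def by (intro sum_nonneg) auto
  have \<alpha>int: "\<alpha> absolutely_integrable_on {c..d}" if "{c..d} \<subseteq> I" for c d
  proof -
    have P: "(\<lambda>x. \<Sum>j=1..n. cmod (p j x)) absolutely_integrable_on {c..d}"
      by (rule absolutely_integrable_sum) (use L1_loc_cmod[OF p(2) that] in auto)
    have K: "(\<lambda>x. 1 + cmod z) absolutely_integrable_on {c..d}"
      by (intro absolutely_integrable_continuous_real continuous_intros)
    show ?thesis
      unfolding \<alpha>_def by (rule set_integral_add(1)[OF set_integral_add(1)[OF K L1_loc_cmod[OF p(1) that]] P])
  qed
  have qc: "continuous_on I (q k)" if "k < 2 * n" for k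
    using q that I(1) by (intro AC_loc_continuous_on) (auto simp: qsystem_def)
  have Sc: "continuous_on I S" unfolding S_def by (intro continuous_intros qc) auto
  have incr: "cmod (q k t - q k s) \<le> M * integral {s..t} \<alpha>"
    if st: "s \<le> t" "{s..t} \<subseteq> I" and k: "k < 2 * n" and M: "\<And>x. x \<in> {s..t} \<Longrightarrow> S x \<le> M" for s t k M
  proof -
    have ae: "AE x in lebesgue_on I. (q k has_vector_derivative rhs n p q k x) (at x)" and ac: "AC_loc I (q k)"
      using q k by (auto simp: qsystem_def)
    obtain N where N: "negligible N" "\<forall>x\<in>I - N. q (2 * n) x = z * q 0 x"
      using z I(1) by (auto simp: AE_lebesgue_on_iff)
    have int: "(rhs n p q k has_integral (q k t - q k s)) {s..t}"
      by (rule AC_loc_has_integral(1)[OF ac I(1) ae st])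
    have "((\<lambda>x. if x \<in> N then 0 else rhs n p q k x) has_integral (q k t - q k s)) {s..t}"
      by (rule has_integral_spike[OF N(1) _ int]) auto
    moreover have "\<alpha> integrable_on {s..t}" using set_lebesgue_integral_eq_integral(1)[OF \<alpha>int[OF st(2)]] .
    then have "((\<lambda>x. M * \<alpha> x) has_integral (M * integral {s..t} \<alpha>)) {s..t}"
      by (intro has_integral_mult_right integrable_integral)
    moreover have "cmod (if x \<in> N then 0 else rhs n p q k x) \<le> M * \<alpha> x" if x: "x \<in> {s..t}" for x
    proof (cases "x \<in> N")
      case False
      then have "cmod (rhs n p q k x) \<le> \<alpha> x * S x"
        unfolding \<alpha>_def S_def by (intro rhs_bound n k) (use N(2) x st in blast)
      also have "\<dots> \<le> M * \<alpha> x" using M[OF x] \<alpha>0 by (simp add: mult.commute mult_right_mono)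
      finally show ?thesis using False by simp
    qed (use M[OF x] S0[of x] \<alpha>0[of x] in \<open>simp add: mult_nonneg_nonneg\<close>)
    ultimately show ?thesis
      using integral_norm_bound_integral[of "\<lambda>x. if x \<in> N then 0 else rhs n p q k x" "{s..t}" "\<lambda>x. M * \<alpha> x"]
      by (metis (no_types, lifting) has_integral_integrable integral_unique)
  qed
  define Z where "Z = {x \<in> I. S x = 0}"
  have Zq: "S x = 0 \<longleftrightarrow> (\<forall>k<2 * n. q k x = 0)" for x
    unfolding S_def by (subst sum_nonneg_eq_0_iff) auto
  have "openin (top_of_set I) Z"
  proof -
    have "\<exists>e>0. ball y e \<subseteq> Z" if y: "y \<in> Z" for y
    proof -
      obtain r where r: "r > 0" "cball y r \<subseteq> I" using y I(1) open_contains_cball unfolding Z_def by blast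
      have sub: "{y - r..y + r} \<subseteq> I" using r(2) by (simp add: cball_eq_atLeastAtMost)
      have ai: "\<alpha> integrable_on {y - r..y + r}" using set_lebesgue_integral_eq_integral(1)[OF \<alpha>int[OF sub]] .
      define \<eta> where "\<eta> = 1 / (4 * real n)"
      have "\<eta> > 0" using n by (simp add: \<eta>_def)
      have "continuous_on {y - r..y + r} (\<lambda>t. integral {y - r..t} \<alpha>)" by (rule indefinite_integral_continuous_1[OF ai])
      then have "isCont (\<lambda>t. integral {y - r..t} \<alpha>) y" by (rule continuous_on_interior) (use r in simp)
      then obtain d where d: "d > 0" "\<And>t. dist t y < d \<Longrightarrow> dist (integral {y - r..t} \<alpha>) (integral {y - r..y} \<alpha>) < \<eta>"
        using \<open>\<eta> > 0\<close> unfolding continuous_at_eps_delta by blast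
      define e where "e = min (d / 2) r"
      have e: "e > 0" "e < d" "e \<le> r" using d r by (auto simp: e_def)
      define J where "J = {y - e..y + e}"
      have J: "J \<subseteq> I" using sub e by (auto simp: J_def)
      have split: "integral {s..t} \<alpha> = integral {y - r..t} \<alpha> - integral {y - r..s} \<alpha>" if "y - r \<le> s" "s \<le> t" "t \<le> y + r" for s t
        using Henstock_Kurzweil_Integration.integral_combine[of "y - r" s t \<alpha>] integrable_subinterval_real[OF ai, of "y - r" t] that by auto
      have small: "integral {s..t} \<alpha> < \<eta>" if "s \<le> t" "s = y \<and> t \<in> J \<or> t = y \<and> s \<in> J" for s t
      proof -
        have "dist s y < d" "dist t y < d" using that(2) e by (auto simp: J_def dist_real_def)
        note d(2)[OF this(1)] d(2)[OF this(2)]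
        then show ?thesis using split[of s t] that e by (auto simp: J_def dist_real_def)
      qed
      have "compact J" "J \<noteq> {}" using e by (auto simp: J_def)
      moreover have "continuous_on J S" using Sc J by (rule continuous_on_subset)
      ultimately obtain w where w: "w \<in> J" "\<And>x. x \<in> J \<Longrightarrow> S x \<le> S w" using continuous_attains_sup by metis
      have qy: "q k y = 0" if "k < 2 * n" for k using y that Zq by (auto simp: Z_def)
      have "cmod (q k w) \<le> S w * \<eta>" if k: "k < 2 * n" for k
      proof (cases "y \<le> w")
        case True
        have s: "{y..w} \<subseteq> J" using w(1) e by (auto simp: J_def)
        have "cmod (q k w - q k y) \<le> S w * integral {y..w} \<alpha>"
          by (rule incr[OF True _ k]) (use s J w in blast)+
        also have "\<dots> \<le> S w * \<eta>" using small[OF True] w(1) S0 by (intro mult_left_mono) auto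
        finally show ?thesis using qy[OF k] by simp
      next
        case False
        then have le: "w \<le> y" by simp
        have s: "{w..y} \<subseteq> J" using w(1) e by (auto simp: J_def)
        have "cmod (q k y - q k w) \<le> S w * integral {w..y} \<alpha>"
          by (rule incr[OF le _ k]) (use s J w in blast)+
        also have "\<dots> \<le> S w * \<eta>" using small[OF le] w(1) S0 by (intro mult_left_mono) auto
        finally show ?thesis using qy[OF k] by simp
      qed
      then have "S w \<le> (\<Sum>j<2 * n. S w * \<eta>)" by (subst S_def) (rule sum_mono, simp)
      also have "\<dots> = S w / 2" using n by (simp add: \<eta>_def)
      finally have "S w = 0" using S0[of w] by simp
      then have "S x = 0" if "x \<in> J" for x using w(2)[OF that] S0[of x] by simp
      moreover have "ball y e \<subseteq> J" by (auto simp: J_def dist_real_def)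
      ultimately have "ball y e \<subseteq> Z" using J by (auto simp: Z_def)
      then show ?thesis using e by blast
    qed
    then have "open Z" unfolding open_contains_ball by blast
    moreover have "Z \<subseteq> I" by (auto simp: Z_def)
    ultimately show ?thesis by (simp add: open_subset)
  qed
  moreover have "closedin (top_of_set I) Z"
    unfolding Z_def using continuous_closedin_preimage[OF Sc, of "{0}"] by (simp add: vimage_def Int_def)
  moreover have "c \<in> Z" using c Zq by (auto simp: Z_def)
  ultimately have "Z = I" using I(2) connected_clopen by blast
  then show ?thesis using x k Zq by (auto simp: Z_def)
qed


section \<open>Inverting a fundamental matrix by brackets\<close>

text \<open>Let \<open>V\<close> be the matrix of the vectors and \<open>J\<close> the matrix of the bracket. The Gram matrix of brackets \<open>V^T J V\<close> is invertible; if \<open>B\<close> is its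
  inverse, then \<open>B V^T J\<close> is a left inverse of \<open>V\<close>, hence also a right inverse. Only the last column of the resulting identity is
  stated. As \<open>B\<close> depends on the Gram matrix alone, one \<open>M\<close> serves all points at which the brackets take the same values.\<close>

lemma symplectic_completeness:
  fixes Y :: "nat \<Rightarrow> nat \<Rightarrow> complex"
  assumes n: "n \<ge> 1"
    and indep: "\<And>a. (\<forall>k<2 * n. (\<Sum>j<2 * n. a j * Y j k) = 0) \<Longrightarrow> \<forall>j<2 * n. a j = 0"
  shows "\<exists>M. \<forall>X. (\<forall>i<2 * n. \<forall>j<2 * n. bracket n (X i) (X j) = bracket n (Y i) (Y j)) \<longrightarrow>
     (\<forall>k<2 * n. (\<Sum>j<2 * n. X j k * (\<Sum>i<2 * n. M j i * X i 0)) = (if k = 2 * n - 1 then 1 else 0))"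
proof -
  define N where "N = 2 * n"
  define J :: "complex mat" where "J = mat N N (\<lambda>(k, l). if k + l = N - 1 then (if k < n then 1 else -1) else 0)"
  define V where "V = (\<lambda>X::nat \<Rightarrow> nat \<Rightarrow> complex. mat N N (\<lambda>(k, j). X j k))"
  have N: "N > 0" using n by (simp add: N_def)
  have J: "J \<in> carrier_mat N N" by (simp add: J_def)
  have V: "V X \<in> carrier_mat N N" for X by (simp add: V_def)
  have JX: "(J * V X) $$ (k, j) = (if k < n then 1 else -1) * X j (N - 1 - k)" if "k < N" "j < N" for X k j
  proof -
    have "(J * V X) $$ (k, j) = (\<Sum>l\<in>{0..<N}. J $$ (k, l) * V X $$ (l, j))"
      using that J V[of X] by (simp add: scalar_prod_def)
    also have "\<dots> = (\<Sum>l\<in>{0..<N}. if l = N - 1 - k then (if k < n then 1 else -1) * X j l else 0)"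
      by (rule sum.cong) (use that in \<open>auto simp: J_def V_def\<close>)
    also have "\<dots> = (if k < n then 1 else -1) * X j (N - 1 - k)" using that N by simp
    finally show ?thesis .
  qed
  have Gram: "((V X)\<^sup>T * (J * V X)) $$ (i, j) = bracket n (X i) (X j)" if "i < N" "j < N" for X i j
  proof -
    have "((V X)\<^sup>T * (J * V X)) $$ (i, j) = (\<Sum>k\<in>{0..<N}. (V X)\<^sup>T $$ (i, k) * (J * V X) $$ (k, j))"
      using that J V[of X] by (simp add: scalar_prod_def)
    also have "\<dots> = (\<Sum>k\<in>{0..<N}. X i k * ((if k < n then 1 else -1) * X j (N - 1 - k)))"
      by (rule sum.cong) (use that JX in \<open>auto simp: V_def\<close>)
    also have "\<dots> = (\<Sum>k<n. X i k * X j (N - 1 - k)) + (\<Sum>k=n..<N. - (X i k * X j (N - 1 - k)))"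
    proof -
      have "{0..<N} = {..<n} \<union> {n..<N}" by (auto simp: N_def)
      then show ?thesis by (subst \<open>{0..<N} = _\<close>, subst sum.union_disjoint) auto
    qed
    also have "(\<Sum>k=n..<N. - (X i k * X j (N - 1 - k))) = (\<Sum>l<n. - (X i (N - 1 - l) * X j l))"
      by (rule sum.reindex_bij_witness[of _ "\<lambda>l. N - 1 - l" "\<lambda>k. N - 1 - k"]) (auto simp: N_def)
    finally show ?thesis by (simp add: bracket_def N_def sum_subtractf sum_negf)
  qed
  have "det (V Y) \<noteq> 0"
  proof
    assume "det (V Y) = 0"
    then obtain v where v: "v \<in> carrier_vec N" "v \<noteq> 0\<^sub>v N" "V Y *\<^sub>v v = 0\<^sub>v N"
      using det_0_iff_vec_prod_zero[OF V] by blast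
    have "(\<Sum>j<N. v $ j * Y j k) = 0" if "k < N" for k
    proof -
      have "(V Y *\<^sub>v v) $ k = (\<Sum>j\<in>{0..<N}. Y j k * v $ j)"
        using that v(1) by (simp add: V_def scalar_prod_def)
      then show ?thesis using v(3) that by (simp add: mult.commute lessThan_atLeast0)
    qed
    then have "\<forall>j<N. v $ j = 0" using indep[of "\<lambda>j. v $ j"] by (simp add: N_def)
    then have "v = 0\<^sub>v N" using v(1) by (intro eq_vecI) auto
    then show False using v(2) by simp
  qed
  moreover have "det J \<noteq> 0"
  proof
    assume "det J = 0"
    then obtain v where v: "v \<in> carrier_vec N" "v \<noteq> 0\<^sub>v N" "J *\<^sub>v v = 0\<^sub>v N"
      using det_0_iff_vec_prod_zero[OF J] by blast
    have "v $ j = 0" if j: "j < N" for j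
    proof -
      have "(J *\<^sub>v v) $ (N - 1 - j) = (\<Sum>l\<in>{0..<N}. J $$ (N - 1 - j, l) * v $ l)"
        using j v(1) J by (simp add: scalar_prod_def)
      also have "\<dots> = (\<Sum>l\<in>{0..<N}. if l = j then (if N - 1 - j < n then 1 else -1) * v $ l else 0)"
        by (rule sum.cong) (use j in \<open>auto simp: J_def\<close>)
      also have "\<dots> = (if N - 1 - j < n then 1 else -1) * v $ j" using j by simp
      finally show ?thesis using v(3) j by (auto split: if_splits)
    qed
    then have "v = 0\<^sub>v N" using v(1) by (intro eq_vecI) auto
    then show False using v(2) by simp
  qed
  ultimately have "det ((V Y)\<^sup>T * (J * V Y)) \<noteq> 0"
    using V[of Y] J by (simp add: det_mult[of _ N] det_transpose)
  then obtain B where B: "B \<in> carrier_mat N N" "B * ((V Y)\<^sup>T * (J * V Y)) = 1\<^sub>m N"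
    using det_non_zero_imp_unit[of "(V Y)\<^sup>T * (J * V Y)" N "()"] V[of Y] J
    by (auto simp: Units_def ring_mat_simps)
  show ?thesis
  proof (intro exI[of _ "\<lambda>j i. B $$ (j, i)"] allI impI)
    fix X k assume X: "\<forall>i<2 * n. \<forall>j<2 * n. bracket n (X i) (X j) = bracket n (Y i) (Y j)" and k: "k < 2 * n"
    have "(V X)\<^sup>T * (J * V X) = (V Y)\<^sup>T * (J * V Y)"
    proof (rule eq_matI)
      fix i j assume "i < dim_row ((V Y)\<^sup>T * (J * V Y))" "j < dim_col ((V Y)\<^sup>T * (J * V Y))"
      then have "i < N" "j < N" using V[of Y] by auto
      then show "((V X)\<^sup>T * (J * V X)) $$ (i, j) = ((V Y)\<^sup>T * (J * V Y)) $$ (i, j)"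
        using Gram X by (simp add: N_def)
    qed (use V[of X] V[of Y] in auto)
    then have "B * ((V X)\<^sup>T * (J * V X)) = 1\<^sub>m N" using B by simp
    then have "(B * (V X)\<^sup>T * J) * V X = 1\<^sub>m N"
      using B(1) J V[of X] by (simp add: assoc_mult_mat[of _ N N _ N _ N])
    (* A left inverse of a square matrix is a right inverse; this turns brackets into a pointwise identity. *)
    then have "V X * (B * (V X)\<^sup>T * J) = 1\<^sub>m N"
      by (rule mat_mult_left_right_inverse[rotated 2]) (use B(1) J V[of X] in auto)
    then have "(V X * (B * (V X)\<^sup>T * J)) $$ (k, N - 1) = 1\<^sub>m N $$ (k, N - 1)" by simp
    moreover have "(V X * (B * (V X)\<^sup>T * J)) $$ (k, N - 1) = (\<Sum>j\<in>{0..<N}. X j k * (B * (V X)\<^sup>T * J) $$ (j, N - 1))"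
      using k B(1) J V[of X] N by (simp add: scalar_prod_def V_def N_def)
    moreover have "(B * (V X)\<^sup>T * J) $$ (j, N - 1) = (\<Sum>i<2 * n. B $$ (j, i) * X i 0)" if j: "j < N" for j
    proof -
      have "(B * (V X)\<^sup>T * J) $$ (j, N - 1) =
          (\<Sum>i\<in>{0..<N}. B $$ (j, i) * (\<Sum>l\<in>{0..<N}. V X $$ (l, i) * J $$ (l, N - 1)))"
        using j B(1) J V[of X] N by (simp add: scalar_prod_def)
      also have "\<dots> = (\<Sum>i\<in>{0..<N}. B $$ (j, i) * X i 0)"
      proof (rule sum.cong[OF refl])
        fix i assume i: "i \<in> {0..<N}"
        have "(\<Sum>l\<in>{0..<N}. V X $$ (l, i) * J $$ (l, N - 1)) = (\<Sum>l\<in>{0..<N}. if l = 0 then X i l else 0)"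
          by (rule sum.cong) (use n i in \<open>auto simp: J_def V_def N_def\<close>)
        also have "\<dots> = X i 0" using N by simp
        finally show "B $$ (j, i) * (\<Sum>l\<in>{0..<N}. V X $$ (l, i) * J $$ (l, N - 1)) = B $$ (j, i) * X i 0" by simp
      qed
      finally show ?thesis by (simp add: N_def lessThan_atLeast0)
    qed
    ultimately show "(\<Sum>j<2 * n. X j k * (\<Sum>i<2 * n. B $$ (j, i) * X i 0)) = (if k = 2 * n - 1 then 1 else 0)"
      using k N by (simp add: N_def lessThan_atLeast0)
  qed
qed


locale expression =
  fixes n :: nat and p :: "nat \<Rightarrow> real \<Rightarrow> complex" and I :: "real set"
  assumes n: "n \<ge> 1" and I: "open I" "connected I" "I \<noteq> {}"
    and p_real: "\<And>k. k \<le> n \<Longrightarrow> AE x in lebesgue_on I. p k x \<in> \<real>"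
    and p0: "AE x in lebesgue_on I. p 0 x \<noteq> 0"
    and p_loc: "L1_loc I (\<lambda>x. 1 / p 0 x)" "\<And>k. 1 \<le> k \<Longrightarrow> k \<le> n \<Longrightarrow> L1_loc I (p k)"
begin

lemma I_sets [simp]: "I \<in> sets lebesgue" using I(1) by auto

lemma interval_subset:
  assumes "s \<in> I" "t \<in> I" shows "{s..t} \<subseteq> I"
proof
  fix x assume "x \<in> {s..t}"
  then show "x \<in> I" using I(2)[unfolded connected_iff_interval, rule_format, of s t x] assms by simp
qed

lemma compact_in_interval:
  assumes "compact K" "K \<subseteq> I"
  obtains c d where "c \<in> I" "d \<in> I" "c \<le> d" "K \<subseteq> {c<..<d}"
proof -
  obtain x0 where x0: "x0 \<in> I" using I(3) by blast
  let ?K = "insert x0 K"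
  have K: "compact ?K" "?K \<noteq> {}" "?K \<subseteq> I" using assms x0 by auto
  obtain a where a: "a \<in> ?K" "\<forall>x\<in>?K. a \<le> x" using compact_attains_inf[OF K(1,2)] by blast
  obtain b where b: "b \<in> ?K" "\<forall>x\<in>?K. x \<le> b" using compact_attains_sup[OF K(1,2)] by blast
  obtain e where e: "e > 0" "ball a e \<subseteq> I" using I(1) a(1) K(3) open_contains_ball by blast
  obtain e' where e': "e' > 0" "ball b e' \<subseteq> I" using I(1) b(1) K(3) open_contains_ball by blast
  have "a - e / 2 \<in> I" using e by (intro subsetD[OF e(2)]) (simp add: dist_real_def)
  moreover have "b + e' / 2 \<in> I" using e' by (intro subsetD[OF e'(2)]) (simp add: dist_real_def)
  moreover have "a - e / 2 \<le> b + e' / 2" using a(2) b(2) x0 e(1) e'(1) by fastforce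
  moreover have "K \<subseteq> {a - e / 2<..<b + e' / 2}" using a(2) b(2) e(1) e'(1) by fastforce
  ultimately show ?thesis using that by blast
qed

lemma AE_subset:
  assumes "AE x in lebesgue_on I. P x" "open J" "J \<subseteq> I"
  shows "AE x in lebesgue_on J. P x"
proof -
  have "J \<in> sets lebesgue" using assms(2) by auto
  then show ?thesis using assms(1,3) unfolding AE_lebesgue_on_iff[OF I_sets] AE_lebesgue_on_iff[OF \<open>J \<in> sets lebesgue\<close>] by blast
qed

text \<open>Where \<open>q k\<close> vanishes on an open set, so does its derivative, and the system gives \<open>q (k + 1)\<close> almost everywhere, hence everywhere by continuity.\<close>

lemma qsystem_vanishes:
  assumes q: "qsystem n p I q" and J: "open J" "J \<subseteq> I" and z: "\<And>x. x \<in> J \<Longrightarrow> q 0 x = 0"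
  shows "k < 2 * n \<Longrightarrow> x \<in> J \<Longrightarrow> q k x = 0" "AE x in lebesgue_on J. q (2 * n) x = 0"
proof -
  have step: "AE x in lebesgue_on J. q (Suc k) x = 0" if k: "k < 2 * n" and zero: "\<And>l x. l \<le> k \<Longrightarrow> x \<in> J \<Longrightarrow> q l x = 0" for k
  proof -
    have "AE x in lebesgue_on J. x \<in> J" using AE_space[of "lebesgue_on J"] by simp
    moreover have "AE x in lebesgue_on J. (q k has_vector_derivative rhs n p q k x) (at x)"
      by (rule AE_subset[OF _ J]) (use q k in \<open>simp add: qsystem_def\<close>)
    moreover have "AE x in lebesgue_on J. p 0 x \<noteq> 0" by (rule AE_subset[OF p0 J])
    ultimately show ?thesis
    proof eventually_elim
      fix x assume x: "x \<in> J" and d: "(q k has_vector_derivative rhs n p q k x) (at x)" and p0: "p 0 x \<noteq> 0"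
      have "((\<lambda>_. 0) has_vector_derivative rhs n p q k x) (at x)"
        by (rule has_vector_derivative_transform_within_open[OF d J(1) x]) (use zero[of k] in simp)
      then have r0: "rhs n p q k x = 0" using vector_derivative_at[of "\<lambda>_. 0"] vector_derivative_const_at by metis
      consider "k + 1 < n" | "k + 1 = n" | "k + 1 > n" by linarith
      then show "q (Suc k) x = 0"
      proof cases
        case 3
        then have "2 * n - 1 - k \<le> k" by simp
        from zero[OF this x] show ?thesis using r0 3 by (simp add: rhs_def)
      qed (use r0 p0 in \<open>auto simp: rhs_def\<close>)
    qed
  qed
  have all: "k < 2 * n \<Longrightarrow> \<forall>l\<le>k. \<forall>x\<in>J. q l x = 0" for k
  proof (induction k)
    case (Suc k)
    then have ih: "\<And>l x. l \<le> k \<Longrightarrow> x \<in> J \<Longrightarrow> q l x = 0" by simp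
    have "continuous_on I (q (Suc k))" using q Suc.prems I(1) by (intro AC_loc_continuous_on) (auto simp: qsystem_def)
    then have "continuous_on J (q (Suc k))" using J(2) by (rule continuous_on_subset)
    from AE_zero_continuous[OF J(1) this step[of k]] Suc.prems ih have "\<forall>x\<in>J. q (Suc k) x = 0" by simp
    then show ?case using ih by (auto simp: le_Suc_eq)
  qed (use z in simp)
  show "k < 2 * n \<Longrightarrow> x \<in> J \<Longrightarrow> q k x = 0" using all[of k] by blast
  have "AE x in lebesgue_on J. q (Suc (2 * n - 1)) x = 0"
    by (rule step) (use n all[of "2 * n - 1"] in auto)
  then show "AE x in lebesgue_on J. q (2 * n) x = 0" using n by simp
qed

lemma qsystem_add_scale:
  assumes "qsystem n p I q" "qsystem n p I r"
  shows "qsystem n p I (\<lambda>k x. q k x + c * r k x)"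
  using qsystem_lincomb[of "UNIV :: bool set" n p I "\<lambda>b. if b then r else q" "\<lambda>b. if b then c else 1"] assms
  by (simp add: UNIV_bool)

end

lemma sq_integrable_cnj: "sq_integrable M f \<Longrightarrow> sq_integrable M (\<lambda>x. cnj (f x))"
  by (auto simp: sq_integrable_def)

lemma sq_integrable_sum:
  "(\<And>i. i \<in> A \<Longrightarrow> sq_integrable M (f i)) \<Longrightarrow> sq_integrable M (\<lambda>x. \<Sum>i\<in>A. c i * f i x)"
proof (induction A rule: infinite_finite_induct)
  case (insert a A)
  have "sq_integrable M (\<lambda>x. c a * f a x + (\<Sum>i\<in>A. c i * f i x))"
    by (intro sq_integrable_add sq_integrable_scale insert) auto
  then show ?case using insert(1,2) by simp
qed (simp_all add: sq_integrable_def)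

lemma sq_integrable_cmod: "sq_integrable M f \<Longrightarrow> sq_integrable M (\<lambda>x. complex_of_real (cmod (f x)))"
  by (auto simp: sq_integrable_def)

lemma integral_cmod_mult_le:
  assumes "I \<in> sets lebesgue" "sq_integrable (lebesgue_on I) f" "sq_integrable (lebesgue_on I) g"
  shows "integrable (lebesgue_on I) (\<lambda>x. f x * g x)"
    "(LINT x|lebesgue_on I. cmod (f x * g x)) \<le> norm (L2_of I f) * norm (L2_of I g)"
proof -
  let ?f = "\<lambda>x. complex_of_real (cmod (f x))" and ?g = "\<lambda>x. complex_of_real (cmod (g x))"
  show "integrable (lebesgue_on I) (\<lambda>x. f x * g x)"
    using sq_integrable_mult[OF sq_integrable_cnj[OF assms(2)] assms(3)] by simp
  have eq: "norm (L2_of I (\<lambda>x. complex_of_real (cmod (h x)))) = norm (L2_of I h)" if "sq_integrable (lebesgue_on I) h" for h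
  proof -
    have "(norm (L2_of I (\<lambda>x. complex_of_real (cmod (h x)))))\<^sup>2 = (norm (L2_of I h))\<^sup>2"
      by (simp add: norm_L2_of[OF assms(1)] sq_integrable_cmod that)
    then show ?thesis by simp
  qed
  have "complex_of_real (LINT x|lebesgue_on I. cmod (f x * g x)) = (LINT x|lebesgue_on I. cnj (?f x) * ?g x)"
    by (simp add: norm_mult flip: integral_complex_of_real)
  also have "\<dots> = cinner (L2_of I ?f) (L2_of I ?g)"
    by (rule cinner_L2_of[symmetric]) (use assms in \<open>auto intro: sq_integrable_cmod\<close>)
  finally have "cmod (complex_of_real (LINT x|lebesgue_on I. cmod (f x * g x))) \<le> norm (L2_of I ?f) * norm (L2_of I ?g)"
    using cmod_cinner_le by simp
  then show "(LINT x|lebesgue_on I. cmod (f x * g x)) \<le> norm (L2_of I f) * norm (L2_of I g)"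
    using eq[OF assms(2)] eq[OF assms(3)] by simp
qed

text \<open>The varying coefficients of the ansatz are such primitives: bounded by the total integral of the modulus, zero to the left of the
  support of \<open>g\<close> and constant to its right.\<close>

lemma primitive_AC_loc:
  fixes g :: "real \<Rightarrow> complex"
  assumes g: "g absolutely_integrable_on UNIV"
  defines "f \<equiv> \<lambda>x. integral {..x} g"
  shows "AC_loc I f" "open I \<Longrightarrow> AE x in lebesgue_on I. (f has_vector_derivative g x) (at x)"
    "cmod (f x) \<le> integral UNIV (\<lambda>x. cmod (g x))"
    "(\<And>t. t \<le> x \<Longrightarrow> g t = 0) \<Longrightarrow> f x = 0" "(\<And>t. x < t \<Longrightarrow> g t = 0) \<Longrightarrow> f x = integral UNIV g"
proof -
  have gi: "g integrable_on S" if "S \<in> sets lebesgue" for S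
  proof -
    have "g absolutely_integrable_on S" using set_integrable_subset[OF g that] by simp
    then show ?thesis by (rule set_lebesgue_integral_eq_integral(1))
  qed
  have inc: "f x = f c + integral {c..x} g" if "c \<le> x" for c x
  proof -
    have "{..x} = {..c} \<union> {c..x}" using that by auto
    moreover have "integral ({..c} \<union> {c..x}) g = integral {..c} g + integral {c..x} g"
    proof (rule Henstock_Kurzweil_Integration.integral_Un)
      have "{..c} \<inter> {c..x} \<subseteq> {c}" by auto
      then show "negligible ({..c} \<inter> {c..x})" by (rule negligible_subset[rotated]) simp
    qed (auto intro!: gi)
    ultimately show ?thesis by (simp add: f_def)
  qed
  have gabs: "g absolutely_integrable_on {c..d}" for c d using set_integrable_subset[OF g] by simp
  show "AC_loc I f" unfolding AC_loc_def
  proof (intro allI impI)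
    fix c d
    show "AC_on c d f"
    proof (rule AC_on_integral[OF gabs])
      fix x assume "x \<in> {c..d}"
      then show "f x = f c + integral {c..x} g" by (intro inc) simp
    qed
  qed
  show "AE x in lebesgue_on I. (f has_vector_derivative g x) (at x)" if "open I"
  proof (rule AE_lebesgue_on_local[OF that])
    fix c d
    have "negligible {x\<in>{c..d}. \<not> ((\<lambda>u. integral {c..u} g) has_vector_derivative g x) (at x within {c..d})}"
      by (rule lebesgue_differentiation) (use gi in simp)
    moreover have "(f has_vector_derivative g x) (at x)"
      if x: "x \<in> {c<..<d}" and d: "((\<lambda>u. integral {c..u} g) has_vector_derivative g x) (at x within {c..d})" for x
    proof -
      have "((\<lambda>u. integral {c..u} g) has_vector_derivative g x) (at x within {c<..<d})"
        by (rule has_vector_derivative_within_subset[OF d]) auto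
      then have "((\<lambda>u. integral {c..u} g) has_vector_derivative g x) (at x)"
        unfolding at_within_open[OF x open_greaterThanLessThan] .
      from has_vector_derivative_add[OF has_vector_derivative_const[of "f c"] this]
      have D: "((\<lambda>u. f c + integral {c..u} g) has_vector_derivative g x) (at x)" unfolding add_0 .
      show ?thesis
      proof (rule has_vector_derivative_transform_within_open[OF D open_greaterThanLessThan x])
        fix u assume "u \<in> {c<..<d}"
        then have "c \<le> u" by simp
        from inc[OF this] show "f c + integral {c..u} g = f u" by (rule sym)
      qed
    qed
    ultimately show "negligible {x\<in>{c<..<d}. \<not> (f has_vector_derivative g x) (at x)}"
      by (elim negligible_subset) force
  qed
  have gn: "(\<lambda>x. cmod (g x)) integrable_on S" if "S \<in> sets lebesgue" for S
    using set_integrable_subset[OF g that] by (simp add: absolutely_integrable_on_def)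
  have "cmod (f x) \<le> integral {..x} (\<lambda>x. cmod (g x))" unfolding f_def
    by (rule integral_norm_bound_integral) (auto intro!: gi gn)
  also have "\<dots> \<le> integral UNIV (\<lambda>x. cmod (g x))"
    by (rule integral_subset_le) (auto intro!: gn)
  finally show "cmod (f x) \<le> integral UNIV (\<lambda>x. cmod (g x))" .
  show "f x = 0" if "\<And>t. t \<le> x \<Longrightarrow> g t = 0"
  proof -
    have "integral {..x} g = integral {..x} (\<lambda>_. 0)" by (rule Henstock_Kurzweil_Integration.integral_cong) (use that in simp)
    then show ?thesis by (simp add: f_def)
  qed
  show "f x = integral UNIV g" if z: "\<And>t. x < t \<Longrightarrow> g t = 0"
  proof -
    have "(\<lambda>t. if t \<in> {..x} then g t else 0) = g" using z by (auto simp: fun_eq_iff not_le)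
    then show ?thesis unfolding f_def using integral_restrict_UNIV[of "{..x}" g] by simp
  qed
qed

locale fundamental_system = expression +
  fixes z :: complex and Y :: "nat \<Rightarrow> nat \<Rightarrow> real \<Rightarrow> complex"
  assumes Y: "\<And>j. j < 2 * n \<Longrightarrow> qsystem n p I (Y j)"
    and Yz: "\<And>j. j < 2 * n \<Longrightarrow> AE x in lebesgue_on I. Y j (2 * n) x = z * Y j 0 x"
    and Ysq: "\<And>j. j < 2 * n \<Longrightarrow> sq_integrable (lebesgue_on I) (Y j 0)"
    and Yind: "\<And>c. (\<forall>x\<in>I. (\<Sum>j<2 * n. c j * Y j 0 x) = 0) \<Longrightarrow> \<forall>j<2 * n. c j = 0"
begin

lemma AE_all_Yz: "AE x in lebesgue_on I. \<forall>j\<in>{..<2 * n}. Y j (2 * n) x = z * Y j 0 x"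
  using Yz by (simp add: eventually_ball_finite_distrib)

text \<open>Two solutions for the same \<open>z\<close> make the integrand in the Lagrange identity vanish.\<close>

lemma bracket_constant:
  assumes "i < 2 * n" "j < 2 * n" "s \<in> I" "t \<in> I"
  shows "bracket n (\<lambda>k. Y i k t) (\<lambda>k. Y j k t) = bracket n (\<lambda>k. Y i k s) (\<lambda>k. Y j k s)"
proof -
  let ?b = "\<lambda>x. bracket n (\<lambda>k. Y i k x) (\<lambda>k. Y j k x)"
  have le: "?b t = ?b s" if "s \<le> t" "s \<in> I" "t \<in> I" for s t
  proof -
    have "((\<lambda>x. Y i (2 * n) x * Y j 0 x - Y i 0 x * Y j (2 * n) x) has_integral (?b t - ?b s)) {s..t}"
      by (rule Lagrange_identity[OF I(1) n Y Y]) (use assms that interval_subset in auto)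
    moreover obtain N where N: "negligible N" "\<forall>x\<in>I - N. \<forall>j\<in>{..<2 * n}. Y j (2 * n) x = z * Y j 0 x"
      using AE_all_Yz unfolding AE_lebesgue_on_iff[OF I_sets] by blast
    moreover have "((\<lambda>x. 0) has_integral (?b t - ?b s)) {s..t}"
    proof (rule has_integral_spike[OF N(1) _ calculation(1)])
      fix x assume "x \<in> {s..t} - N"
      then have "x \<in> I - N" using interval_subset[of s t] that by blast
      then show "0 = Y i (2 * n) x * Y j 0 x - Y i 0 x * Y j (2 * n) x" using N(2) assms(1,2) by simp
    qed
    ultimately have "?b t - ?b s = 0" using has_integral_unique has_integral_0 by blast
    then show ?thesis by simp
  qed
  show ?thesis using le[of s t] le[of t s] assms(3,4) by (cases "s \<le> t") simp_all
qed

text \<open>Constant brackets make the pointwise linear algebra hold with the same coefficients \<open>M\<close> on the whole interval.\<close>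

lemma completeness:
  "\<exists>M. \<forall>x\<in>I. \<forall>k<2 * n.
    (\<Sum>j<2 * n. Y j k x * (\<Sum>i<2 * n. M j i * Y i 0 x)) = (if k = 2 * n - 1 then 1 else 0)"
proof -
  obtain c where c: "c \<in> I" using I(3) by blast
  have indep: "\<forall>j<2 * n. a j = 0" if a: "\<forall>k<2 * n. (\<Sum>j<2 * n. a j * Y j k c) = 0" for a
  proof (rule Yind, rule ballI)
    fix x assume x: "x \<in> I"
    have sys: "qsystem n p I (\<lambda>k x. \<Sum>j<2 * n. a j * Y j k x)" by (rule qsystem_lincomb) (use Y in auto)
    have "AE x in lebesgue_on I. (\<Sum>j<2 * n. a j * Y j (2 * n) x) = z * (\<Sum>j<2 * n. a j * Y j 0 x)"
      using AE_all_Yz by eventually_elim (simp add: sum_distrib_left mult.left_commute)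
    from qsystem_unique[OF I(1,2) n p_loc sys this c _ x, of 0] a n
    show "(\<Sum>j<2 * n. a j * Y j 0 x) = 0" by simp
  qed
  have ex: "\<exists>M. \<forall>X. (\<forall>i<2 * n. \<forall>j<2 * n. bracket n (X i) (X j) = bracket n (\<lambda>k. Y i k c) (\<lambda>k. Y j k c)) \<longrightarrow>
     (\<forall>k<2 * n. (\<Sum>j<2 * n. X j k * (\<Sum>i<2 * n. M j i * X i 0)) = (if k = 2 * n - 1 then 1 else 0))"
    by (rule symplectic_completeness[of n "\<lambda>j k. Y j k c", OF n]) (rule indep)
  from ex obtain M where M: "\<forall>X. (\<forall>i<2 * n. \<forall>j<2 * n. bracket n (X i) (X j) = bracket n (\<lambda>k. Y i k c) (\<lambda>k. Y j k c)) \<longrightarrow>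
     (\<forall>k<2 * n. (\<Sum>j<2 * n. X j k * (\<Sum>i<2 * n. M j i * X i 0)) = (if k = 2 * n - 1 then 1 else 0))"
    by (elim exE)
  show ?thesis
  proof (intro exI[of _ M] ballI allI impI)
    fix x k assume x: "x \<in> I" and k: "k < 2 * n"
    have "\<forall>i<2 * n. \<forall>j<2 * n. bracket n (\<lambda>k. Y i k x) (\<lambda>k. Y j k x) = bracket n (\<lambda>k. Y i k c) (\<lambda>k. Y j k c)"
      using bracket_constant[OF _ _ c x] by blast
    from M[THEN spec, of "\<lambda>j k. Y j k x", THEN mp, OF this, rule_format, OF k]
    show "(\<Sum>j<2 * n. Y j k x * (\<Sum>i<2 * n. M j i * Y i 0 x)) = (if k = 2 * n - 1 then 1 else 0)" .
  qed
qed

text \<open>Variation of parameters. The ansatz with variable coefficients needs derivatives \<open>- w j * h\<close> of the coefficients, where \<open>w j\<close>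
  is a combination of the square-integrable solutions; so the coefficients are bounded by Cauchy--Schwarz and the solution is square-integrable.
  If \<open>h\<close> has compact support and is orthogonal to the conjugate solutions, the coefficients vanish to both sides of the support.\<close>

lemma solve_inhomogeneous:
  "\<exists>C. \<forall>h. sq_integrable (lebesgue_on I) h \<longrightarrow> (\<exists>Q. qsystem n p I Q \<and> (\<forall>x. Q (2 * n) x = z * Q 0 x + h x) \<and>
     sq_integrable (lebesgue_on I) (Q 0) \<and> norm (L2_of I (Q 0)) \<le> C * norm (L2_of I h) \<and>
     (\<forall>K. compact K \<and> K \<subseteq> I \<and> (\<forall>x\<in>I - K. h x = 0) \<and> (\<forall>j<2 * n. (LINT x|lebesgue_on I. Y j 0 x * h x) = 0) \<longrightarrow>
       (\<exists>K'. compact K' \<and> K' \<subseteq> I \<and> (\<forall>x\<in>I - K'. Q 0 x = 0))))"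
proof -
  from completeness obtain M where M': "\<forall>x\<in>I. \<forall>k<2 * n.
    (\<Sum>j<2 * n. Y j k x * (\<Sum>i<2 * n. M j i * Y i 0 x)) = (if k = 2 * n - 1 then 1 else 0)"
    by (elim exE)
  note M = M'[rule_format]
  define w where "w = (\<lambda>j x. \<Sum>i<2 * n. M j i * Y i 0 x)"
  have w: "sq_integrable (lebesgue_on I) (w j)" for j unfolding w_def by (rule sq_integrable_sum) (use Ysq in auto)
  define C where "C = (\<Sum>j<2 * n. norm (L2_of I (w j)) * norm (L2_of I (Y j 0)))"
  show ?thesis
  proof (intro exI[of _ C] allI impI)
    fix h assume h: "sq_integrable (lebesgue_on I) h"
    (* The minus sign is the one with which the highest quasi-derivative enters the last equation of the system. *)
    define g where "g = (\<lambda>j x. if x \<in> I then - (w j x * h x) else 0)"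
    have gI: "integrable (lebesgue_on I) (\<lambda>x. w j x * h x)" for j by (rule integral_cmod_mult_le(1)[OF I_sets w h])
    have gabs: "g j absolutely_integrable_on UNIV" for j
    proof -
      have "integrable (lebesgue_on I) (\<lambda>x. - (w j x * h x))" using gI by simp
      then have "(\<lambda>x. - (w j x * h x)) absolutely_integrable_on I"
        by (simp add: integrable_restrict_space set_integrable_def)
      then show ?thesis unfolding g_def using absolutely_integrable_restrict_UNIV[of I "\<lambda>x. - (w j x * h x)"] by simp
    qed
    have gint: "integral UNIV (\<lambda>x. cmod (g j x)) \<le> norm (L2_of I (w j)) * norm (L2_of I h)" for j
    proof -
      have "(\<lambda>x. cmod (g j x)) = (\<lambda>x. if x \<in> I then cmod (w j x * h x) else 0)" by (auto simp: g_def)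
      then have "integral UNIV (\<lambda>x. cmod (g j x)) = integral I (\<lambda>x. cmod (w j x * h x))"
        by (simp only: integral_restrict_UNIV)
      also have "\<dots> = (LINT x|lebesgue_on I. cmod (w j x * h x))"
        by (rule lebesgue_integral_eq_integral[symmetric]) (use gI in auto)
      finally show ?thesis using integral_cmod_mult_le(2)[OF I_sets w h, of j] by simp
    qed
    define c where "c = (\<lambda>j x. integral {..x} (g j))"
    have cbd: "cmod (c j x) \<le> norm (L2_of I (w j)) * norm (L2_of I h)" for j x
      using primitive_AC_loc(3)[OF gabs[of j], of x] gint[of j] unfolding c_def by linarith
    define Q' where "Q' = (\<lambda>k x. \<Sum>j<2 * n. c j x * Y j k x)"
    define Q where "Q = (\<lambda>k x. if k = 2 * n then z * Q' 0 x + h x else Q' k x)"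
    have Q0: "Q 0 = Q' 0" using n by (simp add: Q_def)
    have Q2: "Q (2 * n) x = z * Q 0 x + h x" for x unfolding Q0 by (simp add: Q_def)
    have sysQ: "qsystem n p I Q"
      unfolding qsystem_def
    proof (intro conjI allI impI)
      fix k assume k: "k < 2 * n"
      have Qk: "Q k = (\<lambda>x. \<Sum>j<2 * n. c j x * Y j k x)" using k by (simp add: Q_def Q'_def)
      show "AC_loc I (Q k)" unfolding Qk
        using Y k primitive_AC_loc(1)[OF gabs] by (intro AC_loc_sum AC_loc_mult) (auto simp: qsystem_def c_def)
      have a1: "AE x in lebesgue_on I. \<forall>j\<in>{..<2 * n}. (Y j k has_vector_derivative rhs n p (Y j) k x) (at x)"
        using Y k by (simp add: eventually_ball_finite_distrib qsystem_def)
      have a2: "AE x in lebesgue_on I. \<forall>j\<in>{..<2 * n}. (c j has_vector_derivative g j x) (at x)"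
        using primitive_AC_loc(2)[OF gabs I(1)] by (simp add: eventually_ball_finite_distrib c_def)
      have a3: "AE x in lebesgue_on I. x \<in> I" using AE_space[of "lebesgue_on I"] by simp
      from a1 a2 a3 AE_all_Yz
      show "AE x in lebesgue_on I. (Q k has_vector_derivative rhs n p Q k x) (at x)"
      proof eventually_elim
        fix x assume d1: "\<forall>j\<in>{..<2 * n}. (Y j k has_vector_derivative rhs n p (Y j) k x) (at x)"
          and d2: "\<forall>j\<in>{..<2 * n}. (c j has_vector_derivative g j x) (at x)" and x: "x \<in> I"
          and yz: "\<forall>j\<in>{..<2 * n}. Y j (2 * n) x = z * Y j 0 x"
        have "(Q k has_vector_derivative (\<Sum>j<2 * n. c j x * rhs n p (Y j) k x + g j x * Y j k x)) (at x)"
          unfolding Qk using d1 d2 by (intro has_vector_derivative_sum has_vector_derivative_mult) auto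
        moreover have "(\<Sum>j<2 * n. c j x * rhs n p (Y j) k x + g j x * Y j k x) = rhs n p Q k x"
        proof -
          have "(\<Sum>j<2 * n. g j x * Y j k x) = - h x * (\<Sum>j<2 * n. Y j k x * w j x)"
            using x by (simp add: g_def sum_distrib_left mult_ac sum_negf)
          also have "\<dots> = (if k = 2 * n - 1 then - h x else 0)" unfolding w_def M[OF x k] by simp
          finally have G: "(\<Sum>j<2 * n. g j x * Y j k x) = (if k = 2 * n - 1 then - h x else 0)" .
          have R: "(\<Sum>j<2 * n. c j x * rhs n p (Y j) k x) = rhs n p (\<lambda>k y. \<Sum>j<2 * n. c j x * Y j k y) k x"
            by (rule rhs_lincomb[symmetric])
          have "Q' (2 * n) x = z * Q' 0 x" using yz by (simp add: Q'_def sum_distrib_left mult.left_commute)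
          then have "rhs n p (\<lambda>k y. \<Sum>j<2 * n. c j x * Y j k y) k x = rhs n p Q k x + (if k = 2 * n - 1 then h x else 0)"
            using k n by (auto simp: rhs_def Q_def Q'_def)
          then show ?thesis unfolding sum.distrib G R by simp
        qed
        ultimately show "(Q k has_vector_derivative rhs n p Q k x) (at x)" by simp
      qed
    qed
    have ac0: "continuous_on I (Q 0)" using sysQ n I(1) by (intro AC_loc_continuous_on) (auto simp: qsystem_def)
    have Qm: "Q 0 \<in> borel_measurable (lebesgue_on I)" by (rule continuous_imp_measurable_on_sets_lebesgue[OF ac0 I_sets])
    let ?B = "\<lambda>j. norm (L2_of I (w j)) * norm (L2_of I h)"
    let ?b = "\<lambda>x. \<Sum>j<2 * n. complex_of_real (?B j) * complex_of_real (cmod (Y j 0 x))"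
    have bsq: "sq_integrable (lebesgue_on I) ?b" by (rule sq_integrable_sum) (use Ysq in \<open>auto intro: sq_integrable_cmod\<close>)
    have bb: "?b x = complex_of_real (\<Sum>j<2 * n. ?B j * cmod (Y j 0 x))" for x by simp
    have Qb: "cmod (Q 0 x) \<le> cmod (?b x)" for x
    proof -
      have "cmod (Q 0 x) \<le> (\<Sum>j<2 * n. ?B j * cmod (Y j 0 x))"
        unfolding Q0 Q'_def using cbd by (intro order_trans[OF norm_sum] sum_mono) (auto simp: norm_mult intro!: mult_right_mono)
      also have "\<dots> \<le> cmod (?b x)" unfolding bb norm_of_real by simp
      finally show ?thesis .
    qed
    then have sq: "(cmod (Q 0 x))\<^sup>2 \<le> (cmod (?b x))\<^sup>2" for x by (intro power_mono) auto
    have Qsq: "sq_integrable (lebesgue_on I) (Q 0)"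
      unfolding sq_integrable_def
    proof
      show "integrable (lebesgue_on I) (\<lambda>x. (cmod (Q 0 x))\<^sup>2)"
        by (rule Bochner_Integration.integrable_bound[where f = "\<lambda>x. (cmod (?b x))\<^sup>2"])
           (use bsq Qm sq in \<open>auto simp: sq_integrable_def\<close>)
    qed (rule Qm)
    have "(norm (L2_of I (Q 0)))\<^sup>2 \<le> (norm (L2_of I ?b))\<^sup>2"
      unfolding norm_L2_of[OF I_sets Qsq] norm_L2_of[OF I_sets bsq]
      by (rule integral_mono) (use bsq Qsq sq in \<open>auto simp: sq_integrable_def\<close>)
    then have "norm (L2_of I (Q 0)) \<le> norm (L2_of I ?b)" by simp
    also have "\<dots> \<le> (\<Sum>j<2 * n. ?B j * norm (L2_of I (Y j 0)))"
    proof -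
      have "sq_integrable (lebesgue_on I) (\<lambda>x. \<Sum>j<m. complex_of_real (?B j) * complex_of_real (cmod (Y j 0 x))) \<and>
         norm (L2_of I (\<lambda>x. \<Sum>j<m. complex_of_real (?B j) * complex_of_real (cmod (Y j 0 x)))) \<le> (\<Sum>j<m. ?B j * norm (L2_of I (Y j 0)))"
        if "m \<le> 2 * n" for m
        using that
      proof (induction m)
        case (Suc m)
        let ?s = "\<lambda>x. \<Sum>j<m. complex_of_real (?B j) * complex_of_real (cmod (Y j 0 x))" and ?y = "\<lambda>x. complex_of_real (cmod (Y m 0 x))"
        have s: "sq_integrable (lebesgue_on I) ?s" "norm (L2_of I ?s) \<le> (\<Sum>j<m. ?B j * norm (L2_of I (Y j 0)))"
          using Suc by simp_all
        have y: "sq_integrable (lebesgue_on I) ?y" using Ysq[of m] Suc.prems by (intro sq_integrable_cmod) simp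
        have "(norm (L2_of I ?y))\<^sup>2 = (norm (L2_of I (Y m 0)))\<^sup>2"
          using norm_L2_of[OF I_sets y] norm_L2_of[OF I_sets, of "Y m 0"] Ysq[of m] Suc.prems by simp
        then have ny: "norm (L2_of I ?y) = norm (L2_of I (Y m 0))" by simp
        have "L2_of I (\<lambda>x. ?s x + complex_of_real (?B m) * ?y x) = L2_of I ?s + complex_of_real (?B m) *C L2_of I ?y"
          by (rule L2_of_lincomb[OF I_sets s(1) y])
        then have "norm (L2_of I (\<lambda>x. ?s x + complex_of_real (?B m) * ?y x)) \<le> norm (L2_of I ?s) + ?B m * norm (L2_of I ?y)"
          using norm_triangle_ineq[of "L2_of I ?s" "complex_of_real (?B m) *C L2_of I ?y"] by (simp add: norm_mult)
        then show ?case using s ny sq_integrable_add[OF s(1) sq_integrable_scale[OF y]] by simp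
      qed (simp add: L2_of_zero sq_integrable_def)
      then show ?thesis by blast
    qed
    also have "\<dots> = C * norm (L2_of I h)" by (simp add: C_def sum_distrib_left sum_distrib_right mult_ac)
    finally have bound: "norm (L2_of I (Q 0)) \<le> C * norm (L2_of I h)" .
    have supp: "\<exists>K'. compact K' \<and> K' \<subseteq> I \<and> (\<forall>x\<in>I - K'. Q 0 x = 0)"
      if K: "compact K" "K \<subseteq> I" "\<forall>x\<in>I - K. h x = 0" and orth: "\<forall>j<2 * n. (LINT x|lebesgue_on I. Y j 0 x * h x) = 0" for K
    proof -
      obtain s t where st: "s \<in> I" "t \<in> I" "s \<le> t" "K \<subseteq> {s<..<t}" by (rule compact_in_interval[OF K(1,2)])
      have g0: "g j x = 0" if "x \<notin> {s<..<t}" for j x using that st(4) K(3) by (auto simp: g_def)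
      have "c j x = 0" if "x \<in> I - {s..t}" for j x
      proof (cases "x < s")
        case True
        then show ?thesis unfolding c_def by (intro primitive_AC_loc(4)[OF gabs] g0) auto
      next
        case False
        then have "t < x" using that by auto
        then have "c j x = integral UNIV (g j)" unfolding c_def by (intro primitive_AC_loc(5)[OF gabs] g0) auto
        also have "\<dots> = integral I (\<lambda>x. - (w j x * h x))" unfolding g_def by (simp only: integral_restrict_UNIV)
        also have "\<dots> = (LINT x|lebesgue_on I. - (w j x * h x))"
          by (rule lebesgue_integral_eq_integral[symmetric]) (use gI in auto)
        also have "(\<lambda>x. - (w j x * h x)) = (\<lambda>x. \<Sum>i<2 * n. (- M j i) * (Y i 0 x * h x))"
          by (simp add: w_def sum_distrib_right mult.assoc sum_negf)
        also have "(LINT x|lebesgue_on I. (\<Sum>i<2 * n. (- M j i) * (Y i 0 x * h x))) = (\<Sum>i<2 * n. (LINT x|lebesgue_on I. (- M j i) * (Y i 0 x * h x)))"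
          by (rule Bochner_Integration.integral_sum) (use integral_cmod_mult_le(1)[OF I_sets Ysq h] in auto)
        also have "\<dots> = 0" using orth by (intro sum.neutral) simp
        finally show ?thesis .
      qed
      then have "\<forall>x\<in>I - {s..t}. Q 0 x = 0" unfolding Q0 Q'_def by simp
      then show ?thesis using interval_subset[OF st(1,2)] by (intro exI[of _ "{s..t}"]) auto
    qed
    show "\<exists>Q. qsystem n p I Q \<and> (\<forall>x. Q (2 * n) x = z * Q 0 x + h x) \<and>
     sq_integrable (lebesgue_on I) (Q 0) \<and> norm (L2_of I (Q 0)) \<le> C * norm (L2_of I h) \<and>
     (\<forall>K. compact K \<and> K \<subseteq> I \<and> (\<forall>x\<in>I - K. h x = 0) \<and> (\<forall>j<2 * n. (LINT x|lebesgue_on I. Y j 0 x * h x) = 0) \<longrightarrow>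
       (\<exists>K'. compact K' \<and> K' \<subseteq> I \<and> (\<forall>x\<in>I - K'. Q 0 x = 0)))"
      using sysQ Q2 Qsq bound supp by (intro exI[of _ Q]) blast
  qed
qed

end

section \<open>The minimal and the maximal operator\<close>

text \<open>A dual system of \<open>w\<close> inside \<open>W\<close> produces the orthogonal projection of \<open>g\<close> to \<open>W\<close>.\<close>

lemma finite_dim_double_orthocomp:
  assumes H: "csubspace H" and W: "csubspace W" "W \<subseteq> H" and w: "is_basis W d w"
    and g: "g \<in> H" "\<And>u. u \<in> H \<inter> orthocomp W \<Longrightarrow> cinner u g = 0"
  shows "g \<in> W"
proof -
  have wi: "lin_indep_seq d w" and wW: "\<And>i. i < d \<Longrightarrow> w i \<in> W" using w unfolding is_basis_def by blast+
  have sep: "(\<Sum>i<d. c i *C w i) = 0" if c: "\<forall>x\<in>W. cinner (\<Sum>i<d. c i *C w i) x = 0" for c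
  proof -
    have "(\<Sum>i<d. c i *C w i) \<in> W" using wW by (intro csubspace_sum[OF W(1)]) auto
    with c have "cinner (\<Sum>i<d. c i *C w i) (\<Sum>i<d. c i *C w i) = 0" by blast
    then show ?thesis by simp
  qed
  have ex: "\<exists>x. (\<forall>j<d. x j \<in> W) \<and> (\<forall>i<d. \<forall>j<d. cinner (w i) (x j) = (if i = j then 1 else 0))"
    by (rule dual_system[OF W(1) wi]) (rule sep)
  from ex obtain x where x: "\<forall>j<d. x j \<in> W"
    "\<forall>i<d. \<forall>j<d. cinner (w i) (x j) = (if i = j then 1 else 0)" by (elim exE conjE)
  define s where "s = (\<Sum>j<d. cinner (w j) g *C x j)"
  have sW: "s \<in> W" unfolding s_def using x(1) by (intro csubspace_sum[OF W(1)]) auto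
  have ws: "cinner (w i) s = cinner (w i) g" if i: "i < d" for i
  proof -
    have "cinner (w i) s = (\<Sum>j<d. cinner (w j) g * cinner (w i) (x j))"
      unfolding s_def by (simp add: cinner_sum_right cinner_scaleC_right)
    also have "\<dots> = (\<Sum>j<d. if i = j then cinner (w i) g else 0)"
      by (rule sum.cong) (use x(2) i in auto)
    also have "\<dots> = cinner (w i) g" using i by simp
    finally show ?thesis .
  qed
  have perp: "g - s \<in> orthocomp W"
    unfolding orthocomp_def
  proof (intro CollectI ballI)
    fix v assume "v \<in> W"
    then obtain c where v: "v = (\<Sum>i<d. c i *C w i)" using w unfolding is_basis_def by blast
    have "(\<Sum>i<d. cnj (c i) * cinner (w i) g) = (\<Sum>i<d. cnj (c i) * cinner (w i) s)"
      by (rule sum.cong) (use ws in auto)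
    then show "cinner v (g - s) = 0"
      unfolding v cinner_sum_left cinner_scaleC_left cinner_diff_right
      by (simp add: right_diff_distrib sum_subtractf)
  qed
  moreover have "g - s \<in> H" using g(1) sW W(2) H by (intro csubspace_diff) auto
  ultimately have "cinner (g - s) g = 0" using g(2) by blast
  moreover have "cinner (g - s) s = 0" using perp sW cinner_eq_0_commute unfolding orthocomp_def by blast
  ultimately have "cinner (g - s) (g - s) = 0" by (simp add: cinner_diff_right)
  then have "g = s" by simp
  then show ?thesis using sW by simp
qed

context expression
begin

abbreviation "H \<equiv> L2_on I"
abbreviation "Tmax \<equiv> maximal_operator n p I"
text \<open>The pre-minimal operator, whose closure is the minimal one.\<close>

definition "Tpre = {(f, g) \<in> Tmax. compactly_supported_in I f}"
abbreviation "Tmin \<equiv> closure Tpre"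

lemma Tmin: "minimal_operator n p I = Tmin"
  by (simp add: minimal_operator_def Tpre_def)

lemma H: "csubspace H" "closed H"
  by (simp_all add: csubspace_L2_on closed_L2_on)

lemma L2_of_cong: "(\<And>x. x \<in> I \<Longrightarrow> u x = v x) \<Longrightarrow> L2_of I u = L2_of I v"
  unfolding L2_of_def by (rule arg_cong[of _ _ abs_L2]) auto

lemma sq_integrable_cong: 
  assumes "\<And>x. x \<in> I \<Longrightarrow> u x = v x" shows "sq_integrable (lebesgue_on I) u = sq_integrable (lebesgue_on I) v"
proof -
  have "u \<in> borel_measurable (lebesgue_on I) \<longleftrightarrow> v \<in> borel_measurable (lebesgue_on I)"
    by (rule measurable_cong) (use assms in simp)
  moreover have "integrable (lebesgue_on I) (\<lambda>x. (cmod (u x))\<^sup>2) \<longleftrightarrow> integrable (lebesgue_on I) (\<lambda>x. (cmod (v x))\<^sup>2)"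
    by (rule Bochner_Integration.integrable_cong) (use assms in simp_all)
  ultimately show ?thesis by (simp add: sq_integrable_def)
qed

lemma TmaxE:
  assumes "(f, g) \<in> Tmax"
  obtains q where "qsystem n p I q" "sq_integrable (lebesgue_on I) (q 0)" "sq_integrable (lebesgue_on I) (q (2 * n))"
    "f = L2_of I (q 0)" "g = L2_of I (q (2 * n))"
proof -
  obtain u q where q: "f = L2_of I u" "g = L2_of I (q (2 * n))" "quasi_derivatives n p I u q"
    "sq_integrable (lebesgue_on I) u" "sq_integrable (lebesgue_on I) (q (2 * n))"
    using assms unfolding maximal_operator_def by blast
  have sys: "qsystem n p I q" "\<forall>x\<in>I. q 0 x = u x"
    using q(3) quasi_derivatives_iff[of I n p, OF I(1) n p0] by blast+
  show ?thesis
    by (rule that[OF sys(1) _ q(5) _ q(2)])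
       (use sys(2) q(1,4) sq_integrable_cong[of "q 0" u] L2_of_cong[of "q 0" u] in simp_all)
qed

lemma TmaxI:
  assumes "qsystem n p I q" "sq_integrable (lebesgue_on I) (q 0)" "sq_integrable (lebesgue_on I) (q (2 * n))"
  shows "(L2_of I (q 0), L2_of I (q (2 * n))) \<in> Tmax"
proof -
  have "quasi_derivatives n p I (q 0) q" using assms(1) quasi_derivatives_iff[of I n p, OF I(1) n p0] by blast
  then show ?thesis unfolding maximal_operator_def using assms by blast
qed

lemma linrel_Tmax: "linrel H Tmax"
  unfolding linrel_def
proof (intro conjI allI impI)
  show "Tmax \<subseteq> H \<times> H" by (auto simp: L2_on_def elim!: TmaxE)
  have "qsystem n p I (\<lambda>k x. \<Sum>j\<in>{}. 0 * (0::complex))" using qsystem_lincomb[of "{}" n p I "\<lambda>j k x. 0" "\<lambda>_. 0"] by simp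
  then have "qsystem n p I (\<lambda>k x. 0)" by simp
  from TmaxI[OF this] show "(0, 0) \<in> Tmax" by (simp add: L2_of_zero sq_integrable_def)
  fix f f' g g' c assume "(f, f') \<in> Tmax" "(g, g') \<in> Tmax"
  then obtain q r where q: "qsystem n p I q" "sq_integrable (lebesgue_on I) (q 0)" "sq_integrable (lebesgue_on I) (q (2 * n))"
    "f = L2_of I (q 0)" "f' = L2_of I (q (2 * n))"
    and r: "qsystem n p I r" "sq_integrable (lebesgue_on I) (r 0)" "sq_integrable (lebesgue_on I) (r (2 * n))"
    "g = L2_of I (r 0)" "g' = L2_of I (r (2 * n))"
    by (elim TmaxE)
  have "(L2_of I (\<lambda>x. q 0 x + c * r 0 x), L2_of I (\<lambda>x. q (2 * n) x + c * r (2 * n) x)) \<in> Tmax"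
    by (rule TmaxI[OF qsystem_add_scale[OF q(1) r(1)]]) (intro sq_integrable_add sq_integrable_scale q r)+
  then show "(f + c *C g, f' + c *C g') \<in> Tmax"
    using L2_of_lincomb[OF I_sets q(2) r(2), of c] L2_of_lincomb[OF I_sets q(3) r(3), of c] q r by simp
qed

lemma AE_eq_of_L2_of_eq:
  assumes "sq_integrable (lebesgue_on I) u" "sq_integrable (lebesgue_on I) v" "L2_of I u = L2_of I v"
  shows "AE x in lebesgue_on I. u x = v x"
  using L2_of_eq_iff[OF I_sets assms(1,2)] assms(3) by simp

text \<open>The image is determined almost everywhere by the first component, because a vanishing function has vanishing quasi-derivatives.\<close>

lemma single_valued_Tmax_0:
  assumes "(0, g) \<in> Tmax" shows "g = 0"
proof -
  obtain q where q: "qsystem n p I q" "sq_integrable (lebesgue_on I) (q 0)" "sq_integrable (lebesgue_on I) (q (2 * n))"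
    "0 = L2_of I (q 0)" "g = L2_of I (q (2 * n))" using assms by (elim TmaxE)
  have z: "sq_integrable (lebesgue_on I) (\<lambda>_. 0)" by (simp add: sq_integrable_def)
  have "AE x in lebesgue_on I. q 0 x = 0"
    by (rule AE_eq_of_L2_of_eq[OF q(2) z]) (use q(4) in \<open>simp add: L2_of_zero\<close>)
  moreover have "continuous_on I (q 0)" using q(1) n I(1) by (intro AC_loc_continuous_on) (auto simp: qsystem_def)
  ultimately have "q 0 x = 0" if "x \<in> I" for x using AE_zero_continuous[OF I(1)] that by blast
  from qsystem_vanishes(2)[OF q(1) I(1) subset_refl this]
  have "AE x in lebesgue_on I. q (2 * n) x = 0" .
  then have "L2_of I (q (2 * n)) = L2_of I (\<lambda>_. 0)" using L2_of_eq_iff[OF I_sets q(3) z] by simp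
  then show ?thesis by (simp add: q(5) L2_of_zero)
qed

lemma TpreE:
  assumes "(f, g) \<in> Tpre"
  obtains q K where "qsystem n p I q" "sq_integrable (lebesgue_on I) (q 0)" "sq_integrable (lebesgue_on I) (q (2 * n))"
    "f = L2_of I (q 0)" "g = L2_of I (q (2 * n))" "compact K" "K \<subseteq> I" "\<forall>x\<in>I - K. q 0 x = 0"
proof -
  have "(f, g) \<in> Tmax" "compactly_supported_in I f" using assms by (auto simp: Tpre_def)
  then obtain q where q: "qsystem n p I q" "sq_integrable (lebesgue_on I) (q 0)" "sq_integrable (lebesgue_on I) (q (2 * n))"
    "f = L2_of I (q 0)" "g = L2_of I (q (2 * n))" by (elim TmaxE)
  obtain u K where u: "sq_integrable (lebesgue_on I) u" "f = L2_of I u" "compact K" "K \<subseteq> I" "\<forall>x\<in>I - K. u x = 0"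
    using \<open>compactly_supported_in I f\<close> unfolding compactly_supported_in_def by blast
  have op: "open (I - K)" using I(1) u(3) by (intro open_Diff compact_imp_closed)
  have sub: "I - K \<subseteq> I" by blast
  have "AE x in lebesgue_on I. q 0 x = u x" by (rule AE_eq_of_L2_of_eq[OF q(2) u(1)]) (use q(4) u(2) in simp)
  then have "AE x in lebesgue_on (I - K). q 0 x = u x" by (rule AE_subset[OF _ op sub])
  moreover have "AE x in lebesgue_on (I - K). x \<in> I - K" using AE_space[of "lebesgue_on (I - K)"] by simp
  ultimately have ae: "AE x in lebesgue_on (I - K). q 0 x = 0" by eventually_elim (use u(5) in auto)
  have "continuous_on I (q 0)" using q(1) n I(1) by (intro AC_loc_continuous_on) (auto simp: qsystem_def)
  then have "continuous_on (I - K) (q 0)" using sub by (rule continuous_on_subset)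
  then have "\<forall>x\<in>I - K. q 0 x = 0" using AE_zero_continuous[OF op _ ae] by blast
  then show ?thesis using that q u(3,4) by blast
qed

lemma linrel_Tpre: "linrel H Tpre"
  unfolding linrel_def
proof (intro conjI allI impI)
  show "Tpre \<subseteq> H \<times> H" using linrel_Tmax by (auto simp: linrel_def Tpre_def)
  have "compactly_supported_in I 0"
    unfolding compactly_supported_in_def
    by (rule exI[of _ "\<lambda>_. 0"], rule exI[of _ "{}"]) (simp add: L2_of_zero sq_integrable_def)
  then show "(0, 0) \<in> Tpre" using linrel_Tmax by (auto simp: linrel_def Tpre_def)
  fix f f' g g' c assume fg: "(f, f') \<in> Tpre" "(g, g') \<in> Tpre"
  then have "(f + c *C g, f' + c *C g') \<in> Tmax" using linrel_Tmax by (auto simp: linrel_def Tpre_def)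
  moreover have "compactly_supported_in I (f + c *C g)"
  proof -
    obtain u K v L where u: "sq_integrable (lebesgue_on I) u" "f = L2_of I u" "compact K" "K \<subseteq> I" "\<forall>x\<in>I - K. u x = 0"
      and v: "sq_integrable (lebesgue_on I) v" "g = L2_of I v" "compact L" "L \<subseteq> I" "\<forall>x\<in>I - L. v x = 0"
      using fg unfolding Tpre_def compactly_supported_in_def by blast
    show ?thesis
      unfolding compactly_supported_in_def
    proof (intro exI[of _ "\<lambda>x. u x + c * v x"] exI[of _ "K \<union> L"] conjI)
      show "f + c *C g = L2_of I (\<lambda>x. u x + c * v x)" using u v by (simp add: L2_of_lincomb)
    qed (use u v in \<open>auto intro: sq_integrable_add sq_integrable_scale\<close>)
  qed
  ultimately show "(f + c *C g, f' + c *C g') \<in> Tpre" by (simp add: Tpre_def)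
qed

text \<open>The boundary terms in the Lagrange identity vanish when one of the two functions has compact support.\<close>

lemma Tmax_adjoint_Tpre:
  assumes "(f, f') \<in> Tpre" "(g, g') \<in> Tmax"
  shows "cinner g f' = cinner g' f"
proof -
  obtain q K where q: "qsystem n p I q" "sq_integrable (lebesgue_on I) (q 0)" "sq_integrable (lebesgue_on I) (q (2 * n))"
    "f = L2_of I (q 0)" "f' = L2_of I (q (2 * n))" and K: "compact K" "K \<subseteq> I" "\<forall>x\<in>I - K. q 0 x = 0"
    using assms(1) by (elim TpreE)
  obtain r where r: "qsystem n p I r" "sq_integrable (lebesgue_on I) (r 0)" "sq_integrable (lebesgue_on I) (r (2 * n))"
    "g = L2_of I (r 0)" "g' = L2_of I (r (2 * n))" using assms(2) by (elim TmaxE)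
  have op: "open (I - K)" "I - K \<subseteq> I" using I(1) K(1) by (auto intro: open_Diff compact_imp_closed)
  note van = qsystem_vanishes[OF q(1) op K(3)[rule_format]]
  obtain s t where st: "s \<in> I" "t \<in> I" "s \<le> t" "K \<subseteq> {s<..<t}" by (rule compact_in_interval[OF K(1,2)])
  have sub: "{s..t} \<subseteq> I" by (rule interval_subset[OF st(1,2)])
  let ?\<phi> = "\<lambda>x. q (2 * n) x * cnj (r 0 x) - q 0 x * cnj (r (2 * n) x)"
  have "s \<in> I - K" "t \<in> I - K" using st by auto
  then have "bracket n (\<lambda>k. q k t) (\<lambda>k. cnj (r k t)) = 0" "bracket n (\<lambda>k. q k s) (\<lambda>k. cnj (r k s)) = 0"
    using van(1) by (auto simp: bracket_def intro!: sum.neutral)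
  then have "(?\<phi> has_integral 0) {s..t}"
    using Lagrange_identity[OF I(1) n q(1) qsystem_cnj[OF r(1) p_real] st(3) sub] by simp
  then have 1: "((\<lambda>x. if x \<in> {s..t} then ?\<phi> x else 0) has_integral 0) I"
    using has_integral_restrict[OF sub, of ?\<phi> 0] by simp
  have "I - K \<in> sets lebesgue" using op(1) by auto
  then obtain N where N: "negligible N" "\<forall>x\<in>(I - K) - N. q (2 * n) x = 0"
    using van(2) unfolding AE_lebesgue_on_iff[OF \<open>I - K \<in> sets lebesgue\<close>] by blast
  have 2: "(?\<phi> has_integral 0) I"
  proof (rule has_integral_spike[OF N(1) _ 1])
    fix x assume x: "x \<in> I - N"
    show "?\<phi> x = (if x \<in> {s..t} then ?\<phi> x else 0)"
    proof (cases "x \<in> {s..t}")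
      case False
      then have "x \<in> I - K" using x st(4) by force
      then show ?thesis using False N(2) K(3) x by simp
    qed simp
  qed
  have i1: "integrable (lebesgue_on I) (\<lambda>x. cnj (r 0 x) * q (2 * n) x)" by (rule sq_integrable_mult[OF r(2) q(3)])
  have i2: "integrable (lebesgue_on I) (\<lambda>x. cnj (r (2 * n) x) * q 0 x)" by (rule sq_integrable_mult[OF r(3) q(2)])
  have "cinner g f' - cinner g' f = (LINT x|lebesgue_on I. cnj (r 0 x) * q (2 * n) x) - (LINT x|lebesgue_on I. cnj (r (2 * n) x) * q 0 x)"
    using q r by (simp add: cinner_L2_of)
  also have "\<dots> = (LINT x|lebesgue_on I. cnj (r 0 x) * q (2 * n) x - cnj (r (2 * n) x) * q 0 x)"
    by (rule Bochner_Integration.integral_diff[OF i1 i2, symmetric])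
  also have "\<dots> = integral I (\<lambda>x. cnj (r 0 x) * q (2 * n) x - cnj (r (2 * n) x) * q 0 x)"
    by (rule lebesgue_integral_eq_integral) (use i1 i2 in auto)
  also have "\<dots> = integral I ?\<phi>" by (simp add: mult.commute)
  also have "\<dots> = 0" using 2 by (rule integral_unique)
  finally show ?thesis by simp
qed

text \<open>The coefficients are real almost everywhere, so conjugation exchanges the solutions at \<open>z\<close> and at its conjugate.\<close>

lemma fundamental_system_cnj:
  assumes "fundamental_system n p I z Y"
  shows "fundamental_system n p I (cnj z) (\<lambda>j k x. cnj (Y j k x))"
proof -
  interpret fundamental_system n p I z Y by (rule assms)
  show ?thesis
  proof unfold_locales
    fix j assume j: "j < 2 * n"
    show "qsystem n p I (\<lambda>k x. cnj (Y j k x))" by (rule qsystem_cnj[OF Y[OF j] p_real])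
    show "AE x in lebesgue_on I. cnj (Y j (2 * n) x) = cnj z * cnj (Y j 0 x)" using Yz[OF j] by eventually_elim simp
    show "sq_integrable (lebesgue_on I) (\<lambda>x. cnj (Y j 0 x))" by (rule sq_integrable_cnj[OF Ysq[OF j]])
  next
    fix c :: "nat \<Rightarrow> complex" assume *: "\<forall>x\<in>I. (\<Sum>j<2 * n. c j * cnj (Y j 0 x)) = 0"
    have "(\<Sum>j<2 * n. cnj (c j) * Y j 0 x) = 0" if "x \<in> I" for x
    proof -
      have "(\<Sum>j<2 * n. cnj (c j) * Y j 0 x) = cnj (\<Sum>j<2 * n. c j * cnj (Y j 0 x))" by simp
      then show ?thesis using * that by simp
    qed
    then have "\<forall>j<2 * n. cnj (c j) = 0" using Yind[of "\<lambda>j. cnj (c j)"] by blast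
    then show "\<forall>j<2 * n. c j = 0" by simp
  qed
qed

end

context fundamental_system
begin

definition "E j = L2_of I (Y j 0)"

lemma E_in_H: "j < 2 * n \<Longrightarrow> E j \<in> H"
  using Ysq by (auto simp: E_def L2_on_def)

lemma E_in_Tmax:
  assumes j: "j < 2 * n" shows "(E j, z *C E j) \<in> Tmax"
proof -
  let ?q = "\<lambda>k. if k = 2 * n then (\<lambda>x. z * Y j 0 x) else Y j k"
  have eq: "AE x in lebesgue_on I. rhs n p ?q k x = rhs n p (Y j) k x" for k
    using Yz[OF j] by eventually_elim (use n in \<open>auto simp: rhs_def\<close>)
  have "qsystem n p I ?q"
    unfolding qsystem_def
  proof (intro conjI allI impI)
    fix k assume k: "k < 2 * n"
    then show "AC_loc I (?q k)" using Y[OF j] by (simp add: qsystem_def)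
    have "AE x in lebesgue_on I. (Y j k has_vector_derivative rhs n p (Y j) k x) (at x)" using Y[OF j] k by (simp add: qsystem_def)
    then show "AE x in lebesgue_on I. (?q k has_vector_derivative rhs n p ?q k x) (at x)"
      using eq[of k] by eventually_elim (use k in simp)
  qed
  from TmaxI[OF this] show ?thesis
    using n Ysq[OF j] sq_integrable_scale[OF Ysq[OF j], of z] L2_of_scale[OF I_sets Ysq[OF j], of z] by (simp add: E_def)
qed

definition "W = {\<Sum>j<2 * n. c j *C E j | c. True}"

lemma csubspace_W: "csubspace W"
proof (rule csubspaceI)
  have "(\<Sum>j<2 * n. 0 *C E j) = 0" by simp
  then show "0 \<in> W" unfolding W_def by (intro CollectI exI[of _ "\<lambda>_. 0"] conjI TrueI) simp
  fix x y c assume "x \<in> W" "y \<in> W"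
  then obtain a b where "x = (\<Sum>j<2 * n. a j *C E j)" "y = (\<Sum>j<2 * n. b j *C E j)" by (auto simp: W_def)
  then have "x + c *C y = (\<Sum>j<2 * n. (a j + c * b j) *C E j)"
    by (simp add: complex_vector.scale_sum_right sum.distrib scaleC_add_left scaleC_scaleC)
  then show "x + c *C y \<in> W" unfolding W_def by (intro CollectI exI[of _ "\<lambda>j. a j + c * b j"] conjI TrueI)
qed

lemma W_subset: "W \<subseteq> H"
  unfolding W_def using E_in_H H(1) by (auto intro!: csubspace_sum)

lemma basis_W: "is_basis W (2 * n) E"
  unfolding is_basis_def
proof (intro conjI allI impI ballI)
  fix j assume j: "j < 2 * n"
  have "(\<Sum>i<2 * n. (if i = j then 1 else 0) *C E i) = (\<Sum>i<2 * n. if i = j then E i else 0)"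
    by (rule sum.cong) (auto simp: scaleC_one)
  also have "\<dots> = E j" using j by simp
  finally have "E j = (\<Sum>i<2 * n. (if i = j then 1 else 0) *C E i)" by (rule sym)
  then show "E j \<in> W" unfolding W_def by (intro CollectI exI[of _ "\<lambda>i. if i = j then 1 else 0"] conjI TrueI)
next
  show "lin_indep_seq (2 * n) E"
    unfolding lin_indep_seq_def
  proof (rule allI, rule impI)
    fix c assume c: "(\<Sum>j<2 * n. c j *C E j) = 0"
    have sum: "L2_of I (\<lambda>x. \<Sum>j<m. c j * Y j 0 x) = (\<Sum>j<m. c j *C E j)" if "m \<le> 2 * n" for m
      using that
    proof (induction m)
      case (Suc m)
      have "sq_integrable (lebesgue_on I) (\<lambda>x. \<Sum>j<m. c j * Y j 0 x)" by (rule sq_integrable_sum) (use Ysq Suc.prems in auto)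
      then have "L2_of I (\<lambda>x. (\<Sum>j<m. c j * Y j 0 x) + c m * Y m 0 x) = L2_of I (\<lambda>x. \<Sum>j<m. c j * Y j 0 x) + c m *C L2_of I (Y m 0)"
        using Ysq[of m] Suc.prems by (intro L2_of_lincomb) auto
      then show ?case using Suc by (simp add: E_def)
    qed (simp add: L2_of_zero)
    let ?s = "\<lambda>x. \<Sum>j<2 * n. c j * Y j 0 x"
    have sq: "sq_integrable (lebesgue_on I) ?s" by (rule sq_integrable_sum) (use Ysq in auto)
    have "AE x in lebesgue_on I. ?s x = 0"
      by (rule AE_eq_of_L2_of_eq[OF sq]) (use sum[of "2 * n"] c in \<open>simp_all add: L2_of_zero sq_integrable_def\<close>)
    moreover have "continuous_on I ?s"
      using Y n I(1) by (intro continuous_intros AC_loc_continuous_on) (auto simp: qsystem_def)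
    ultimately have "\<forall>x\<in>I. ?s x = 0" using AE_zero_continuous[OF I(1)] by blast
    then show "\<forall>i<2 * n. c i = 0" by (rule Yind)
  qed
next
  fix x assume "x \<in> W"
  then show "\<exists>c. x = (\<Sum>i<2 * n. c i *C E i)" by (auto simp: W_def)
qed

lemma W_eigen: "u \<in> W \<Longrightarrow> (u, z *C u) \<in> Tmax"
proof -
  assume "u \<in> W"
  then obtain c where u: "u = (\<Sum>j<2 * n. c j *C E j)" by (auto simp: W_def)
  have "((\<Sum>j<2 * n. c j *C E j), (\<Sum>j<2 * n. c j *C z *C E j)) \<in> Tmax"
    by (rule linrel_sum[OF linrel_Tmax]) (use E_in_Tmax in auto)
  moreover have "(\<Sum>j<2 * n. c j *C z *C E j) = z *C u"
    unfolding u by (simp add: complex_vector.scale_sum_right scaleC_scaleC mult.commute)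
  ultimately show ?thesis using u by simp
qed

text \<open>Every right-hand side is attained with a norm bound. By duality this will bound the minimal operator from below, even at real \<open>z\<close>.\<close>

lemma Tmax_surjective:
  "\<exists>C. \<forall>h\<in>H. \<exists>g. (g, z *C g + h) \<in> Tmax \<and> norm g \<le> C * norm h"
proof -
  from solve_inhomogeneous obtain C where C: "\<forall>h. sq_integrable (lebesgue_on I) h \<longrightarrow> (\<exists>Q. qsystem n p I Q \<and> (\<forall>x. Q (2 * n) x = z * Q 0 x + h x) \<and>
     sq_integrable (lebesgue_on I) (Q 0) \<and> norm (L2_of I (Q 0)) \<le> C * norm (L2_of I h) \<and>
     (\<forall>K. compact K \<and> K \<subseteq> I \<and> (\<forall>x\<in>I - K. h x = 0) \<and> (\<forall>j<2 * n. (LINT x|lebesgue_on I. Y j 0 x * h x) = 0) \<longrightarrow>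
       (\<exists>K'. compact K' \<and> K' \<subseteq> I \<and> (\<forall>x\<in>I - K'. Q 0 x = 0))))"
    by (elim exE)
  show ?thesis
  proof (intro exI[of _ C] ballI)
    fix f assume "f \<in> H"
    then obtain h where h: "sq_integrable (lebesgue_on I) h" "f = L2_of I h" by (auto simp: L2_on_def)
    from mp[OF spec[OF C, of h] h(1)] obtain Q where Q: "qsystem n p I Q" "\<forall>x. Q (2 * n) x = z * Q 0 x + h x"
      "sq_integrable (lebesgue_on I) (Q 0)" "norm (L2_of I (Q 0)) \<le> C * norm (L2_of I h)"
      and supp: "\<forall>K. compact K \<and> K \<subseteq> I \<and> (\<forall>x\<in>I - K. h x = 0) \<and> (\<forall>j<2 * n. (LINT x|lebesgue_on I. Y j 0 x * h x) = 0) \<longrightarrow>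
       (\<exists>K'. compact K' \<and> K' \<subseteq> I \<and> (\<forall>x\<in>I - K'. Q 0 x = 0))"
      by (elim exE conjE)
    have Q2: "Q (2 * n) = (\<lambda>x. h x + z * Q 0 x)" using Q(2) by (auto simp: add.commute)
    have "sq_integrable (lebesgue_on I) (Q (2 * n))" unfolding Q2 by (intro sq_integrable_add sq_integrable_scale h Q)
    from TmaxI[OF Q(1,3) this] have "(L2_of I (Q 0), f + z *C L2_of I (Q 0)) \<in> Tmax"
      unfolding Q2 L2_of_lincomb[OF I_sets h(1) Q(3)] h(2) .
    then show "\<exists>g. (g, z *C g + f) \<in> Tmax \<and> norm g \<le> C * norm f"
      using Q(4) h(2) by (intro exI[of _ "L2_of I (Q 0)"]) (simp add: add.commute)
  qed
qed

text \<open>The compactly supported solutions of the inhomogeneous equation identify the range of the pre-minimal operator up to closure.\<close>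

lemma Range_Tpre:
  assumes f: "compactly_supported_in I f" and orth: "\<And>j. j < 2 * n \<Longrightarrow> cinner (L2_of I (\<lambda>x. cnj (Y j 0 x))) f = 0"
  shows "f \<in> Range (shift Tpre z)"
proof -
  obtain h K where h: "sq_integrable (lebesgue_on I) h" "f = L2_of I h" "compact K" "K \<subseteq> I" "\<forall>x\<in>I - K. h x = 0"
    using f unfolding compactly_supported_in_def by blast
  have o: "\<forall>j<2 * n. (LINT x|lebesgue_on I. Y j 0 x * h x) = 0"
  proof (intro allI impI)
    fix j assume j: "j < 2 * n"
    have "cinner (L2_of I (\<lambda>x. cnj (Y j 0 x))) f = (LINT x|lebesgue_on I. cnj (cnj (Y j 0 x)) * h x)"
      unfolding h(2) by (rule cinner_L2_of[OF I_sets sq_integrable_cnj[OF Ysq[OF j]] h(1)])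
    then show "(LINT x|lebesgue_on I. Y j 0 x * h x) = 0" using orth[OF j] by simp
  qed
  from solve_inhomogeneous obtain C where C: "\<forall>h. sq_integrable (lebesgue_on I) h \<longrightarrow> (\<exists>Q. qsystem n p I Q \<and> (\<forall>x. Q (2 * n) x = z * Q 0 x + h x) \<and>
     sq_integrable (lebesgue_on I) (Q 0) \<and> norm (L2_of I (Q 0)) \<le> C * norm (L2_of I h) \<and>
     (\<forall>K. compact K \<and> K \<subseteq> I \<and> (\<forall>x\<in>I - K. h x = 0) \<and> (\<forall>j<2 * n. (LINT x|lebesgue_on I. Y j 0 x * h x) = 0) \<longrightarrow>
       (\<exists>K'. compact K' \<and> K' \<subseteq> I \<and> (\<forall>x\<in>I - K'. Q 0 x = 0))))"
    by (elim exE)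
  from mp[OF spec[OF C, of h] h(1)] obtain Q where Q: "qsystem n p I Q" "\<forall>x. Q (2 * n) x = z * Q 0 x + h x"
    "sq_integrable (lebesgue_on I) (Q 0)" "norm (L2_of I (Q 0)) \<le> C * norm (L2_of I h)"
    and supp: "\<forall>K. compact K \<and> K \<subseteq> I \<and> (\<forall>x\<in>I - K. h x = 0) \<and> (\<forall>j<2 * n. (LINT x|lebesgue_on I. Y j 0 x * h x) = 0) \<longrightarrow>
     (\<exists>K'. compact K' \<and> K' \<subseteq> I \<and> (\<forall>x\<in>I - K'. Q 0 x = 0))"
    by (elim exE conjE)
  have hK: "compact K \<and> K \<subseteq> I \<and> (\<forall>x\<in>I - K. h x = 0) \<and> (\<forall>j<2 * n. (LINT x|lebesgue_on I. Y j 0 x * h x) = 0)"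
    using h(3-5) o by (intro conjI)
  from mp[OF spec[OF supp, of K] hK] obtain K' where K': "compact K'" "K' \<subseteq> I" "\<forall>x\<in>I - K'. Q 0 x = 0"
    by (elim exE conjE)
  have Q2: "Q (2 * n) = (\<lambda>x. h x + z * Q 0 x)" using Q(2) by (auto simp: add.commute)
  have "sq_integrable (lebesgue_on I) (Q (2 * n))" unfolding Q2 by (intro sq_integrable_add sq_integrable_scale h Q)
  from TmaxI[OF Q(1,3) this] have "(L2_of I (Q 0), f + z *C L2_of I (Q 0)) \<in> Tmax"
    unfolding Q2 L2_of_lincomb[OF I_sets h(1) Q(3)] h(2) .
  moreover have "compactly_supported_in I (L2_of I (Q 0))"
    unfolding compactly_supported_in_def using Q(3) K' by blast
  ultimately have "(L2_of I (Q 0), f) \<in> shift Tpre z" by (simp add: mem_shift Tpre_def)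
  then show ?thesis by blast
qed

end

lemma linrel_carrier: "linrel H T \<Longrightarrow> (f, g) \<in> T \<Longrightarrow> f \<in> H \<and> g \<in> H"
  unfolding linrel_def by blast

lemma linrel_lincomb: "linrel H T \<Longrightarrow> (f, f') \<in> T \<Longrightarrow> (g, g') \<in> T \<Longrightarrow> (f + c *C g, f' + c *C g') \<in> T"
  unfolding linrel_def by blast

lemma orthocomp_antimono: "A \<subseteq> B \<Longrightarrow> orthocomp B \<subseteq> orthocomp A"
  unfolding orthocomp_def by blast

text \<open>The range of \<open>Tpre - z\<close> contains the compactly supported elements orthogonal to the solutions at the conjugate point. These
  are dense in the orthogonal complement of the solutions, which gives the codimension \<open>2 * n\<close>. A vector orthogonal to the
  domain is the image under \<open>Tmax - cnj z\<close> of some \<open>g\<close>; then \<open>g\<close> is orthogonal to the range, so it is a combination of the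
  conjugate solutions and its image vanishes. The lower bound comes from pairing \<open>(T - z) f\<close> with a solution \<open>g\<close> of \<open>(Tmax - cnj z) g = f\<close>.\<close>

lemma (in fundamental_system) minimal_operator_properties:
  shows "linrel H Tmin" "single_valued Tmin" "H \<subseteq> closure (Domain Tmin)"
    "\<And>f f' g g'. (f, f') \<in> Tmin \<Longrightarrow> (g, g') \<in> Tmin \<Longrightarrow> cinner f' g = cinner f g'"
    "has_defect H (2 * n) (shift Tmin z)" "\<exists>C. bounded_below C (shift Tmin z)"
proof -
  interpret conj: fundamental_system n p I "cnj z" "\<lambda>j k x. cnj (Y j k x)"
    by (rule fundamental_system_cnj) unfold_locales
  let ?R = "Range (shift Tpre z)"
  let ?D = "{f \<in> H. compactly_supported_in I f}"
  have Dsub: "csubspace ?D"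
  proof (rule csubspaceI)
    have "(0, 0) \<in> Tpre" using linrel_Tpre by (simp add: linrel_def)
    then show "0 \<in> ?D" using csubspace_0[OF H(1)] by (simp add: Tpre_def)
    fix f g c assume fg: "f \<in> ?D" "g \<in> ?D"
    then obtain u K v L where u: "sq_integrable (lebesgue_on I) u" "f = L2_of I u" "compact K" "K \<subseteq> I" "\<forall>x\<in>I - K. u x = 0"
      and v: "sq_integrable (lebesgue_on I) v" "g = L2_of I v" "compact L" "L \<subseteq> I" "\<forall>x\<in>I - L. v x = 0"
      unfolding compactly_supported_in_def by blast
    have "compactly_supported_in I (f + c *C g)"
      unfolding compactly_supported_in_def
    proof (intro exI[of _ "\<lambda>x. u x + c * v x"] exI[of _ "K \<union> L"] conjI)
      show "f + c *C g = L2_of I (\<lambda>x. u x + c * v x)" using u v by (simp add: L2_of_lincomb)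
    qed (use u v in \<open>auto intro: sq_integrable_add sq_integrable_scale\<close>)
    then show "f + c *C g \<in> ?D" using fg H(1) by (simp add: csubspace_add csubspace_scale)
  qed
  have Dsub_H: "?D \<subseteq> H" by blast
  have conj_E_eq: "conj.E j = L2_of I (\<lambda>x. cnj (Y j 0 x))" for j by (simp add: conj.E_def)
  have inR: "f \<in> ?R" if "f \<in> ?D \<inter> orthocomp conj.W" for f
  proof (rule Range_Tpre)
    show "compactly_supported_in I f" using that by simp
    fix j assume "j < 2 * n"
    then have "conj.E j \<in> conj.W" using conj.basis_W[unfolded is_basis_def, THEN conjunct1] by blast
    moreover have "f \<in> orthocomp conj.W" using that by (rule IntD2)
    ultimately have "cinner (conj.E j) f = 0" by (simp add: orthocomp_def)
    then show "cinner (L2_of I (\<lambda>x. cnj (Y j 0 x))) f = 0" by (simp only: conj_E_eq)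
  qed
  from dense_subspace_finite_codim[OF H(1) Dsub Dsub_H compactly_supported_dense[OF I(1)] conj.basis_W conj.W_subset]
  obtain x where "\<forall>j<2 * n. x j \<in> ?D"
    "\<forall>y\<in>H. y - (\<Sum>j<2 * n. cinner (conj.E j) y *C x j) \<in> H \<inter> orthocomp conj.W"
    and dense: "H \<inter> orthocomp conj.W \<subseteq> closure (?D \<inter> orthocomp conj.W)"
    and "\<forall>c. \<forall>i<2 * n. cinner (conj.E i) (\<Sum>j<2 * n. c j *C x j) = c i"
    by (elim exE conjE)
  have perp_W: "g \<in> conj.W" if g: "g \<in> H" "g \<in> orthocomp ?R" for g
  proof (rule finite_dim_double_orthocomp[OF H(1) conj.csubspace_W conj.W_subset conj.basis_W g(1)])
    fix u assume "u \<in> H \<inter> orthocomp conj.W"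
    then have u: "u \<in> closure (?D \<inter> orthocomp conj.W)" by (rule subsetD[OF dense])
    have "?D \<inter> orthocomp conj.W \<subseteq> ?R" using inR by (rule subsetI)
    from subsetD[OF closure_mono[OF this] u] have "u \<in> closure ?R" .
    then show "cinner u g = 0" using g(2) unfolding orthocomp_closure[of ?R, symmetric] by (simp add: orthocomp_def)
  qed
  have W_perp: "g \<in> orthocomp ?R" if g: "g \<in> conj.W" for g
    unfolding orthocomp_def
  proof (intro CollectI ballI)
    fix v assume "v \<in> ?R"
    then obtain f where "(f, v + z *C f) \<in> Tpre" by (auto simp: mem_shift)
    from Tmax_adjoint_Tpre[OF this conj.W_eigen[OF g]]
    have "cinner g v = 0" by (simp add: cinner_add_right cinner_scaleC_right cinner_scaleC_left)
    then show "cinner v g = 0" using cinner_eq_0_commute by blast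
  qed
  have defW: "H \<inter> orthocomp ?R = conj.W" using perp_W W_perp conj.W_subset by blast
  from conj.Tmax_surjective
  obtain C where C': "\<forall>h\<in>H. \<exists>g. (g, cnj z *C g + h) \<in> Tmax \<and> norm g \<le> C * norm h" by (elim exE)
  note C = C'[rule_format]
  have perp_Dom: "w = 0" if w: "w \<in> H" "\<And>f f'. (f, f') \<in> Tpre \<Longrightarrow> cinner w f = 0" for w
  proof -
    from C[OF w(1)] obtain g where g: "(g, cnj z *C g + w) \<in> Tmax" and "norm g \<le> C * norm w" by (elim exE conjE)
    have "g \<in> orthocomp ?R"
      unfolding orthocomp_def
    proof (intro CollectI ballI)
      fix v assume "v \<in> ?R"
      then obtain f where f: "(f, v + z *C f) \<in> Tpre" by (auto simp: mem_shift)
      from Tmax_adjoint_Tpre[OF f g] w(2)[OF f]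
      have "cinner g v = 0" by (simp add: cinner_add_right cinner_add_left cinner_scaleC_right cinner_scaleC_left)
      then show "cinner v g = 0" using cinner_eq_0_commute by blast
    qed
    moreover have "g \<in> H" using linrel_carrier[OF linrel_Tmax g] by (rule conjunct1)
    ultimately have "g \<in> conj.W" by (intro perp_W)
    then have "(g, cnj z *C g) \<in> Tmax" by (rule conj.W_eigen)
    from linrel_diff[OF linrel_Tmax g this] have "(0, w) \<in> Tmax" by simp
    then show ?thesis by (rule single_valued_Tmax_0)
  qed
  have lpre: "linrel H Tpre" by (rule linrel_Tpre)
  have cDom: "csubspace (closure (Domain Tpre))"
  proof (rule csubspaceI)
    show "0 \<in> closure (Domain Tpre)" by (rule subsetD[OF closure_subset csubspace_0[OF csubspace_Domain[OF lpre]]])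
    fix x y c assume xy: "x \<in> closure (Domain Tpre)" "y \<in> closure (Domain Tpre)"
    from xy(1)[unfolded closure_sequential] obtain s where s: "\<forall>k. s k \<in> Domain Tpre" "s \<longlonglongrightarrow> x" by (elim exE conjE)
    from xy(2)[unfolded closure_sequential] obtain t where t: "\<forall>k. t k \<in> Domain Tpre" "t \<longlonglongrightarrow> y" by (elim exE conjE)
    have "(\<lambda>k. s k + c *C t k) \<longlonglongrightarrow> x + c *C y" by (intro tendsto_intros s t)
    moreover have "s k + c *C t k \<in> Domain Tpre" for k
      by (rule csubspace_add[OF csubspace_Domain[OF lpre] s(1)[THEN spec] csubspace_scale[OF csubspace_Domain[OF lpre] t(1)[THEN spec]]])
    ultimately show "x + c *C y \<in> closure (Domain Tpre)"
      unfolding closure_sequential by (intro exI[of _ "\<lambda>k. s k + c *C t k"] conjI allI)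
  qed
  have DomH: "Domain Tpre \<subseteq> H" using linrel_carrier[OF lpre] by blast
  then have clDomH: "closure (Domain Tpre) \<subseteq> H" by (rule closure_minimal[OF _ H(2)])
  have denseDom: "H \<subseteq> closure (Domain Tpre)"
  proof
    fix x assume x: "x \<in> H"
    obtain v w where vw: "v \<in> closure (Domain Tpre)" "w \<in> orthocomp (closure (Domain Tpre))" "x = v + w"
      by (rule orthogonal_decomposition[OF cDom closed_closure, of x])
    have "w = 0"
    proof (rule perp_Dom)
      have "w = x - v" using vw(3) by simp
      then show "w \<in> H" using csubspace_diff[OF H(1) x subsetD[OF clDomH vw(1)]] by simp
      fix f f' assume "(f, f') \<in> Tpre"
      then have "f \<in> closure (Domain Tpre)" by (rule subsetD[OF closure_subset DomainI])
      then have "cinner f w = 0" using vw(2) by (simp add: orthocomp_def)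
      then show "cinner w f = 0" by (simp only: cinner_eq_0_commute[of w f])
    qed
    then show "x \<in> closure (Domain Tpre)" using vw by simp
  qed
  have seqE: "\<exists>s s'. (\<forall>k. (s k, s' k) \<in> Tpre) \<and> s \<longlonglongrightarrow> f \<and> s' \<longlonglongrightarrow> f'" if ff: "(f, f') \<in> Tmin" for f f'
  proof -
    from ff[unfolded closure_sequential] obtain u where u: "\<forall>k. u k \<in> Tpre" "u \<longlonglongrightarrow> (f, f')"
      by (elim exE conjE)
    have "(\<lambda>k. fst (u k)) \<longlonglongrightarrow> f" "(\<lambda>k. snd (u k)) \<longlonglongrightarrow> f'"
      using tendsto_fst[OF u(2)] tendsto_snd[OF u(2)] by simp_all
    then show ?thesis using u(1) by (intro exI[of _ "\<lambda>k. fst (u k)"] exI[of _ "\<lambda>k. snd (u k)"]) simp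
  qed
  show lmin: "linrel H Tmin"
    unfolding linrel_def
  proof (intro conjI allI impI)
    have "Tpre \<subseteq> H \<times> H" using lpre by (simp add: linrel_def)
    then show "Tmin \<subseteq> H \<times> H" by (rule closure_minimal) (intro closed_Times H(2))
    have "(0, 0) \<in> Tpre" using lpre by (simp add: linrel_def)
    then show "(0, 0) \<in> Tmin" by (rule subsetD[OF closure_subset])
    fix f f' g g' c assume fg: "(f, f') \<in> Tmin" "(g, g') \<in> Tmin"
    from seqE[OF fg(1)] obtain s s' where s: "\<forall>k. (s k, s' k) \<in> Tpre" "s \<longlonglongrightarrow> f" "s' \<longlonglongrightarrow> f'" by (elim exE conjE)
    from seqE[OF fg(2)] obtain t t' where t: "\<forall>k. (t k, t' k) \<in> Tpre" "t \<longlonglongrightarrow> g" "t' \<longlonglongrightarrow> g'" by (elim exE conjE)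
    have "(\<lambda>k. (s k + c *C t k, s' k + c *C t' k)) \<longlonglongrightarrow> (f + c *C g, f' + c *C g')"
      by (intro tendsto_intros s t)
    moreover have "(s k + c *C t k, s' k + c *C t' k) \<in> Tpre" for k
      by (rule linrel_lincomb[OF lpre s(1)[THEN spec] t(1)[THEN spec]])
    ultimately show "(f + c *C g, f' + c *C g') \<in> Tmin"
      unfolding closure_sequential by (intro exI[of _ "\<lambda>k. (s k + c *C t k, s' k + c *C t' k)"] conjI allI)
  qed
  have adj: "cinner f' g = cinner f g'" if f: "(f, f') \<in> Tmin" and g: "(g, g') \<in> Tpre" for f f' g g'
  proof -
    from seqE[OF f] obtain s s' where s: "\<forall>k. (s k, s' k) \<in> Tpre" "s \<longlonglongrightarrow> f" "s' \<longlonglongrightarrow> f'" by (elim exE conjE)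
    have eq: "cinner (s' k) g = cinner (s k) g'" for k
    proof -
      have "(s k, s' k) \<in> Tmax" using s(1)[THEN spec, of k] unfolding Tpre_def by blast
      from Tmax_adjoint_Tpre[OF g this] show ?thesis by (rule sym)
    qed
    have lim: "(\<lambda>k. cinner (s' k) g) \<longlonglongrightarrow> cinner f' g" "(\<lambda>k. cinner (s k) g') \<longlonglongrightarrow> cinner f g'"
      by (intro tendsto_intros s)+
    show ?thesis by (rule LIMSEQ_unique[OF lim(1)[unfolded eq] lim(2)])
  qed
  show sym: "cinner f' g = cinner f g'" if f: "(f, f') \<in> Tmin" and g: "(g, g') \<in> Tmin" for f f' g g'
  proof -
    from seqE[OF g] obtain s s' where s: "\<forall>k. (s k, s' k) \<in> Tpre" "s \<longlonglongrightarrow> g" "s' \<longlonglongrightarrow> g'" by (elim exE conjE)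
    have eq: "cinner f' (s k) = cinner f (s' k)" for k by (rule adj[OF f s(1)[THEN spec]])
    have lim: "(\<lambda>k. cinner f' (s k)) \<longlonglongrightarrow> cinner f' g" "(\<lambda>k. cinner f (s' k)) \<longlonglongrightarrow> cinner f g'"
      by (intro tendsto_intros s)+
    show ?thesis by (rule LIMSEQ_unique[OF lim(1)[unfolded eq] lim(2)])
  qed
  show "single_valued Tmin"
  proof (rule single_valuedI)
    fix f g h assume fg: "(f, g) \<in> Tmin" "(f, h) \<in> Tmin"
    from linrel_diff[OF lmin fg] have 0: "(0, g - h) \<in> Tmin" by simp
    have "g - h = 0"
    proof (rule perp_Dom)
      show "g - h \<in> H" using linrel_carrier[OF lmin 0] by (rule conjunct2)
      show "cinner (g - h) u = 0" if "(u, u') \<in> Tpre" for u u' using adj[OF 0 that] by simp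
    qed
    then show "g = h" by simp
  qed
  have "Domain Tpre \<subseteq> Domain Tmin" by (rule Domain_mono[OF closure_subset])
  from subset_trans[OF denseDom closure_mono[OF this]] show "H \<subseteq> closure (Domain Tmin)" .
  have "orthocomp (Range (shift Tmin z)) = orthocomp ?R"
  proof
    have "?R \<subseteq> Range (shift Tmin z)"
    proof
      fix v assume "v \<in> ?R"
      then obtain f where "(f, v + z *C f) \<in> Tpre" by (auto simp: mem_shift)
      then have "(f, v + z *C f) \<in> Tmin" by (rule subsetD[OF closure_subset])
      then show "v \<in> Range (shift Tmin z)" by (auto simp: mem_shift)
    qed
    then show "orthocomp (Range (shift Tmin z)) \<subseteq> orthocomp ?R" by (rule orthocomp_antimono)
    have "Range (shift Tmin z) \<subseteq> closure ?R"
    proof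
      fix v assume "v \<in> Range (shift Tmin z)"
      then obtain f where "(f, v + z *C f) \<in> Tmin" by (auto simp: mem_shift)
      from seqE[OF this] obtain s s' where s: "\<forall>k. (s k, s' k) \<in> Tpre" "s \<longlonglongrightarrow> f" "s' \<longlonglongrightarrow> v + z *C f" by (elim exE conjE)
      have "(\<lambda>k. s' k - z *C s k) \<longlonglongrightarrow> v + z *C f - z *C f" by (intro tendsto_intros s)
      then have "(\<lambda>k. s' k - z *C s k) \<longlonglongrightarrow> v" by simp
      moreover have "s' k - z *C s k \<in> ?R" for k
      proof -
        have "(s k, s' k - z *C s k) \<in> shift Tpre z" using s(1) by (simp add: mem_shift)
        then show ?thesis by blast
      qed
      ultimately show "v \<in> closure ?R"
        unfolding closure_sequential by (intro exI[of _ "\<lambda>k. s' k - z *C s k"] conjI allI)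
    qed
    then show "orthocomp ?R \<subseteq> orthocomp (Range (shift Tmin z))"
      unfolding orthocomp_closure[of ?R, symmetric] by (rule orthocomp_antimono)
  qed
  then have "H \<inter> orthocomp (Range (shift Tmin z)) = conj.W" using defW by simp
  then show "has_defect H (2 * n) (shift Tmin z)" unfolding has_defect_def using conj.basis_W by auto
  show "\<exists>C. bounded_below C (shift Tmin z)"
  proof (intro exI[of _ C])
    have "norm f \<le> C * norm v" if fv: "(f, v + z *C f) \<in> Tmin" for f v
    proof -
      have "f \<in> H" using linrel_carrier[OF lmin fv] by (rule conjunct1)
      from C[OF this] obtain g where g: "(g, cnj z *C g + f) \<in> Tmax" "norm g \<le> C * norm f" by (elim exE conjE)
      from seqE[OF fv] obtain s s' where s: "\<forall>k. (s k, s' k) \<in> Tpre" "s \<longlonglongrightarrow> f" "s' \<longlonglongrightarrow> v + z *C f" by (elim exE conjE)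
      have eq: "cinner g (s' k) = cinner (cnj z *C g + f) (s k)" for k
        by (rule Tmax_adjoint_Tpre[OF s(1)[THEN spec] g(1)])
      have lim: "(\<lambda>k. cinner g (s' k)) \<longlonglongrightarrow> cinner g (v + z *C f)"
        "(\<lambda>k. cinner (cnj z *C g + f) (s k)) \<longlonglongrightarrow> cinner (cnj z *C g + f) f"
        by (intro tendsto_intros s)+
      have "cinner g (v + z *C f) = cinner (cnj z *C g + f) f" by (rule LIMSEQ_unique[OF lim(1)[unfolded eq] lim(2)])
      then have "cinner g v = cinner f f" by (simp add: cinner_add_right cinner_add_left cinner_scaleC_right cinner_scaleC_left)
      then have "cmod (complex_of_real ((norm f)\<^sup>2)) = cmod (cinner g v)" by (simp only: cinner_self)
      then have "(norm f)\<^sup>2 \<le> norm g * norm v" using cmod_cinner_le[of g v] by (simp only: norm_of_real)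
      also have "\<dots> \<le> (C * norm f) * norm v" using g(2) by (intro mult_right_mono) auto
      finally have "norm f * norm f \<le> norm f * (C * norm v)" by (simp add: power2_eq_square mult_ac)
      then show ?thesis
      proof (cases "f = 0")
        case True
        have "0 \<le> C * norm v"
        proof (cases "v = 0")
          case False
          have "v \<in> H" using linrel_carrier[OF lmin fv] True by simp
          from C[OF this] obtain u where "(u, cnj z *C u + v) \<in> Tmax" "norm u \<le> C * norm v" by (elim exE conjE)
          then show ?thesis using norm_ge_zero[of u] by linarith
        qed simp
        then show ?thesis using True by simp
      next
        case False
        then have "0 < norm f" by simp
        with \<open>norm f * norm f \<le> norm f * (C * norm v)\<close> show ?thesis by (rule mult_left_le_imp_le)
      qed
    qed
    then show "bounded_below C (shift Tmin z)" unfolding bounded_below_def by (auto simp: mem_shift)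
  qed
qed

section \<open>Deficiency indices\<close>

text \<open>The defining identity of the adjoint, read as orthogonality to the range.\<close>

lemma eigenspace_adjoint:
  assumes H: "csubspace H" and S: "S \<subseteq> H \<times> H"
  shows "eigenspace (adjoint_operator H S) z = H \<inter> orthocomp (Range (shift S (cnj z)))"
proof (intro equalityI subsetI)
  fix g assume "g \<in> eigenspace (adjoint_operator H S) z"
  then have g: "g \<in> H" "\<And>f f'. (f, f') \<in> S \<Longrightarrow> cinner g f' = cinner (z *C g) f"
    by (auto simp: eigenspace_def adjoint_operator_def)
  have "cinner v g = 0" if "(f, v + cnj z *C f) \<in> S" for f v
  proof -
    have "cinner g v = 0" using g(2)[OF that] by (simp add: cinner_add_right cinner_scaleC_right cinner_scaleC_left)
    then show ?thesis using cinner_eq_0_commute by blast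
  qed
  then show "g \<in> H \<inter> orthocomp (Range (shift S (cnj z)))" using g(1) by (auto simp: orthocomp_def mem_shift)
next
  fix g assume g: "g \<in> H \<inter> orthocomp (Range (shift S (cnj z)))"
  have "cinner g f' = cinner (z *C g) f" if "(f, f') \<in> S" for f f'
  proof -
    have "(f, f' - cnj z *C f) \<in> shift S (cnj z)" using that by (simp add: mem_shift)
    then have "cinner (f' - cnj z *C f) g = 0" using g by (auto simp: orthocomp_def)
    then have "cinner g (f' - cnj z *C f) = 0" using cinner_eq_0_commute by blast
    then show ?thesis by (simp add: cinner_diff_right cinner_scaleC_right cinner_scaleC_left)
  qed
  moreover have "z *C g \<in> H" using g H by (simp add: csubspace_scale)
  ultimately show "g \<in> eigenspace (adjoint_operator H S) z"
    using g by (auto simp: eigenspace_def adjoint_operator_def)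
qed

lemma relpow_symmetric:
  assumes sym: "\<And>f f' g g'. (f, f') \<in> S \<Longrightarrow> (g, g') \<in> S \<Longrightarrow> cinner f' g = cinner f g'"
  shows "(f, f') \<in> S ^^ m \<Longrightarrow> (g, g') \<in> S ^^ m \<Longrightarrow> cinner f' g = cinner f g'"
proof (induction m arbitrary: f f' g g')
  case (Suc m)
  from Suc.prems(1) obtain u where u: "(f, u) \<in> S ^^ m" "(u, f') \<in> S" by auto
  from Suc.prems(2) obtain v where v: "(g, v) \<in> S" "(v, g') \<in> S ^^ m" by (rule relpow_Suc_E2)
  have "cinner f' g = cinner u v" by (rule sym[OF u(2) v(1)])
  also have "\<dots> = cinner f g'" by (rule Suc.IH[OF u(1) v(2)])
  finally show ?case .
qed auto

text \<open>Both deficiency spaces are orthogonal complements of ranges of shifted powers. That a power is closed and densely defined is read off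
  from the regularity of one of its shifts.\<close>

lemma power_deficiency_indices:
  fixes H :: "'a::{complex_inner, complete_space} set"
  assumes H: "csubspace H" "closed H" and S: "linrel H S" "single_valued S"
    and sym: "\<And>f f' g g'. (f, f') \<in> S \<Longrightarrow> (g, g') \<in> S \<Longrightarrow> cinner f' g = cinner f g'"
    and reg: "\<And>z. Im z \<noteq> 0 \<Longrightarrow> regular_rel H d (shift S z)" and m: "m \<ge> 1"
  shows "has_deficiency_indices H (S ^^ m) (enat (d * m), enat (d * m))"
proof -
  have reg_m: "regular_rel H (d * m) (shift (S ^^ m) z)" if "Im z \<noteq> 0" for z
    by (rule power_shift_regular[OF H S reg m that])
  have r: "regular_rel H (d * m) (shift (S ^^ m) \<i>)" by (rule reg_m) simp
  (* Undoing the shift transfers linearity and closedness from the shifted power to the power itself. *)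
  have unshift: "shift (shift T \<i>) (- \<i>) = T" for T :: "('a \<times> 'a) set"
    unfolding shift_shift by (auto simp: mem_shift set_eq_iff)
  have lin: "linrel H (S ^^ m)"
    using linrel_shift[of H "shift (S ^^ m) \<i>" "- \<i>"] r H(1) unfolding unshift by (auto simp: regular_rel_def)
  have cl: "closed (S ^^ m)"
    using closed_shift[of "shift (S ^^ m) \<i>" "- \<i>"] r unfolding unshift by (auto simp: regular_rel_def)
  have dense: "H \<subseteq> closure (Domain (S ^^ m))" using r by (auto simp: regular_rel_def)
  have sv: "single_valued (S ^^ m)"
  proof (induction m)
    case (Suc m)
    then show ?case using S(2) by (auto intro: single_valued_relcomp)
  qed (simp add: single_valued_Id)
  have "linear_operator H (S ^^ m)"
    using lin sv unfolding linear_operator_def linrel_def by (auto split: prod.splits)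
  then have "symmetric_operator H (S ^^ m)"
    unfolding symmetric_operator_def using relpow_symmetric[of S, OF sym] by (auto split: prod.splits)
  then have csym: "closed_symmetric_operator H (S ^^ m)"
    unfolding closed_symmetric_operator_def using cl dense by simp
  have sub: "S ^^ m \<subseteq> H \<times> H" using lin by (simp add: linrel_def)
  have "ecdim (eigenspace (adjoint_operator H (S ^^ m)) w) = enat (d * m)" if "Im w \<noteq> 0" for w
  proof -
    have "has_defect H (d * m) (shift (S ^^ m) (cnj w))" using reg_m[of "cnj w"] that by (simp add: regular_rel_def)
    then show ?thesis unfolding eigenspace_adjoint[OF H(1) sub] has_defect_def using ecdim_is_basis by blast
  qed
  then show ?thesis unfolding has_deficiency_indices_def deficiency_indices_def using csym by simp
qed

text \<open>It suffices to find the codimension at non-real points. The given point and its conjugate both carry a fundamental system, and each is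
  in the closure of one of the two half planes.\<close>

theorem proposition3p3:
  fixes n :: nat and a b :: ereal and p :: "nat \<Rightarrow> real \<Rightarrow> complex"
  assumes "n \<ge> 1" and "a < b"
    and "\<And>k. k \<le> n \<Longrightarrow> p k \<in> borel_measurable (lebesgue_on (einterval a b))"
    and "\<And>k. k \<le> n \<Longrightarrow> AE x in lebesgue_on (einterval a b). p k x \<in> \<real>"
    and "AE x in lebesgue_on (einterval a b). p 0 x \<noteq> 0"
    and "L1_loc (einterval a b) (\<lambda>x. 1 / p 0 x)"
    and "\<And>k. 1 \<le> k \<Longrightarrow> k \<le> n \<Longrightarrow> L1_loc (einterval a b) (p k)"
    and "limit_circle n p (einterval a b)"
  shows "has_deficiency_indices (L2_on (einterval a b))
           (minimal_operator n p (einterval a b)) (enat (2 * n), enat (2 * n)) \<and>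
         (\<forall>m\<ge>1. has_deficiency_indices (L2_on (einterval a b))
           (minimal_operator n p (einterval a b) ^^ m) (enat (2 * m * n), enat (2 * m * n)))"
proof -
  define I where "I = einterval a b"
  have "connected I"
  proof -
    have "is_interval I"
      unfolding is_interval_1
    proof (intro ballI allI impI)
      fix s t x assume "s \<in> I" "t \<in> I" "s \<le> x \<and> x \<le> t"
      then have *: "a < ereal s" "ereal s \<le> ereal x" "ereal x \<le> ereal t" "ereal t < b" by (simp_all add: I_def einterval_def)
      have "a < ereal x" by (rule less_le_trans[OF *(1,2)])
      moreover have "ereal x < b" by (rule le_less_trans[OF *(3,4)])
      ultimately show "x \<in> I" by (simp add: I_def einterval_def)
    qed
    then show ?thesis by (simp add: is_interval_connected_1)
  qed
  moreover have "I \<noteq> {}" unfolding I_def using einterval_nonempty[OF \<open>a < b\<close>] by blast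
  moreover have "open I" unfolding I_def by simp
  ultimately interpret expression n p I
    using assms unfolding I_def[symmetric] by unfold_locales auto
  obtain z y where y: "\<And>j. j \<in> {1..2 * n} \<Longrightarrow> is_solution n p I z (y j) \<and> sq_integrable (lebesgue_on I) (y j)"
    and ind: "\<And>c. (\<forall>x\<in>I. (\<Sum>j=1..2 * n. c j * y j x) = 0) \<Longrightarrow> \<forall>j\<in>{1..2 * n}. c j = 0"
    using assms(8) unfolding limit_circle_def I_def[symmetric] by blast
  have ex: "\<exists>q. qsystem n p I q \<and> (\<forall>x\<in>I. q 0 x = y (Suc j) x) \<and> (AE x in lebesgue_on I. q (2 * n) x = z * q 0 x)"
    if j: "j < 2 * n" for j
  proof -
    have "is_solution n p I z (y (Suc j))" using y[of "Suc j"] j by simp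
    then obtain q where q: "quasi_derivatives n p I (y (Suc j)) q" "AE x in lebesgue_on I. q (2 * n) x = z * y (Suc j) x"
      unfolding is_solution_def by blast
    have sys: "qsystem n p I q" "\<forall>x\<in>I. q 0 x = y (Suc j) x"
      using q(1) quasi_derivatives_iff[of I n p, OF I(1) n p0] by blast+
    have "AE x in lebesgue_on I. x \<in> I" using AE_space[of "lebesgue_on I"] by simp
    with q(2) have "AE x in lebesgue_on I. q (2 * n) x = z * q 0 x" by eventually_elim (use sys(2) in simp)
    then show ?thesis using sys by blast
  qed
  have "\<forall>j. \<exists>q. j < 2 * n \<longrightarrow> qsystem n p I q \<and> (\<forall>x\<in>I. q 0 x = y (Suc j) x) \<and> (AE x in lebesgue_on I. q (2 * n) x = z * q 0 x)"
  proof
    fix j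
    show "\<exists>q. j < 2 * n \<longrightarrow> qsystem n p I q \<and> (\<forall>x\<in>I. q 0 x = y (Suc j) x) \<and> (AE x in lebesgue_on I. q (2 * n) x = z * q 0 x)"
    proof (cases "j < 2 * n")
      case True
      from ex[OF True] obtain q where "qsystem n p I q \<and> (\<forall>x\<in>I. q 0 x = y (Suc j) x) \<and> (AE x in lebesgue_on I. q (2 * n) x = z * q 0 x)"
        by (elim exE)
      then show ?thesis by (intro exI[of _ q] impI)
    next
      case False
      then show ?thesis by (intro exI impI) (erule notE, assumption)
    qed
  qed
  from choice[OF this] obtain Y where Y': "\<forall>j. j < 2 * n \<longrightarrow> qsystem n p I (Y j) \<and> (\<forall>x\<in>I. Y j 0 x = y (Suc j) x) \<and> (AE x in lebesgue_on I. Y j (2 * n) x = z * Y j 0 x)"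
    by (elim exE)
  note Y = mp[OF spec[OF Y'], THEN conjunct1] mp[OF spec[OF Y'], THEN conjunct2, THEN conjunct1, THEN bspec]
    mp[OF spec[OF Y'], THEN conjunct2, THEN conjunct2]
  have fs: "fundamental_system n p I z Y"
  proof unfold_locales
    fix j assume j: "j < 2 * n"
    show "sq_integrable (lebesgue_on I) (Y j 0)"
      using sq_integrable_cong[of "Y j 0" "y (Suc j)"] Y(2)[OF j] y[of "Suc j"] j by simp
  next
    fix c assume c: "\<forall>x\<in>I. (\<Sum>j<2 * n. c j * Y j 0 x) = 0"
    have "\<forall>j\<in>{1..2 * n}. c (j - 1) = 0"
    proof (rule ind, rule ballI)
      fix x assume x: "x \<in> I"
      have "(\<Sum>j=1..2 * n. c (j - 1) * y j x) = (\<Sum>j<2 * n. c j * y (Suc j) x)"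
        by (rule sum.reindex_bij_witness[of _ Suc "\<lambda>j. j - 1"]) auto
      also have "\<dots> = (\<Sum>j<2 * n. c j * Y j 0 x)" by (rule sum.cong) (use Y(2) x in auto)
      finally show "(\<Sum>j=1..2 * n. c (j - 1) * y j x) = 0" using c x by simp
    qed
    then show "\<forall>j<2 * n. c j = 0" by (metis Suc_leI atLeastAtMost_iff diff_Suc_1 le_add1 plus_1_eq_Suc)
  qed (use Y in auto)
  interpret F: fundamental_system n p I z Y by (rule fs)
  interpret G: fundamental_system n p I "cnj z" "\<lambda>j k x. cnj (Y j k x)" by (rule fundamental_system_cnj[OF fs])
  note M = F.minimal_operator_properties
  obtain C C' where C: "bounded_below C (shift Tmin z)" "bounded_below C' (shift Tmin (cnj z))"
    using M(6) G.minimal_operator_properties(6) by blast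
  have defect: "has_defect H (2 * n) (shift Tmin w)" if w: "Im w \<noteq> 0" for w
  proof -
    (* The sign selects the half plane of w, and z or its conjugate lies in the closure of that half plane. *)
    define s :: real where "s = (if Im w > 0 then 1 else -1)"
    have s: "s = 1 \<or> s = -1" "s * Im w > 0" using w by (auto simp: s_def)
    show ?thesis
    proof (cases "s * Im z \<ge> 0")
      case True
      show ?thesis by (rule has_defect_half_plane[OF H M(1) closed_closure M(4) s(1) True C(1) M(5) s(2)])
    next
      case False
      then have "s * Im (cnj z) \<ge> 0" by simp
      from has_defect_half_plane[OF H M(1) closed_closure M(4) s(1) this C(2) G.minimal_operator_properties(5) s(2)]
      show ?thesis .
    qed
  qed
  have reg: "regular_rel H (2 * n) (shift Tmin w)" if w: "Im w \<noteq> 0" for w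
    unfolding regular_rel_def Domain_shift
  proof (intro conjI exI)
    show "linrel H (shift Tmin w)" by (rule linrel_shift[OF M(1) H(1)])
    show "closed (shift Tmin w)" by (rule closed_shift[OF closed_closure])
    show "bounded_below (1 / \<bar>Im w\<bar>) (shift Tmin w)" by (rule bounded_below_symmetric[OF _ w]) (rule M(4))
  qed (use M(3) defect[OF w] in auto)
  have main: "has_deficiency_indices H (Tmin ^^ m) (enat (2 * m * n), enat (2 * m * n))" if "m \<ge> 1" for m
    using power_deficiency_indices[OF H M(1,2) M(4) reg that] by (simp add: mult_ac)
  have "Tmin ^^ 1 = Tmin" by simp
  then have "has_deficiency_indices H Tmin (enat (2 * n), enat (2 * n))" using main[of 1] by simp
  then show ?thesis using main unfolding I_def[symmetric] Tmin by blast
qed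

end
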